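(* Assume the setting and assumptions (B1)-(B4) described in the context. For a design $i$ let $$\Delta_{i,t}=\big(\hat\delta_{ij,t}-\delta_{ij}(\theta^c)\big)_{j\in\{1,\dots,K\},\,j\neq i}\in\mathbb R^{K-1}.$$ Then, for any $\eta\in[0,1)$ and any design $i$, $$\sqrt t\,\Delta_{i,t}\Rightarrow\mathcal N(0,\Sigma_{i,\infty})\qquad\text{as }t\to\infty,$$ where $\Rightarrow$ denotes convergence in distribution and, for $j,j'\neq i$, $$\Sigma_{i,\infty}(j,j')=\lambda_{I,\eta}\,\nabla\delta_{ij}(\theta^c)^\intercal\,\bar\Sigma_D\,\nabla\delta_{ij'}(\theta^c)+\lambda_{S,\eta}\,\bar m^{-1}\,\mathrm{Cov}\big(X_i(\theta^c)-X_j(\theta^c),\,X_i(\theta^c)-X_{j'}(\theta^c)\big),$$ with $\bar\Sigma_D=\mathrm{diag}(\bar n_1^{-1}\Sigma_{D,1},\dots,\bar n_S^{-1}\Sigma_{D,S})$ (block diagonal) and $$\lambda_{I,\eta}=\frac{2}{1-\eta}+\frac{2\eta\ln\eta}{(1-\eta)^2},\qquad \lambda_{S,\eta}=\frac1{1-\eta}$$ (with $\eta\ln\eta=0$ for $\eta=0$).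
   Context: Setting. There are designs $\mathcal I=\{1,\dots,K\}$, $K\ge 2$, and a parametric family of input distributions $P_\theta=\prod_{s=1}^S P_{\theta_s}$, $\theta=(\theta_1,\dots,\theta_S)\in\Theta\subseteq\mathbb R^d$, $\theta_s\in\mathbb R^{d_s}$, $d=\sum_s d_s$, with unknown true parameter $\theta^c\in\Theta$. For each $\theta\in\Theta$, $(X_1(\theta),\dots,X_K(\theta))$ is the random vector of simulation outputs of the designs when the random inputs are drawn from $P_\theta$ (the designs may be driven by common random numbers, so the components may be dependent); $\mu_i(\theta)=\mathbb E[X_i(\theta)]$ and $\delta_{ij}(\theta)=\mu_i(\theta)-\mu_j(\theta)$. Data. For each $s$, transformed input data $D_{s,1},D_{s,2},\dots$ are i.i.d. random vectors in $\mathbb R^{d_s}$ with mean $\theta_s^c$; data streams for different $s$ are independent. At stage $t=1,2,\dots$ a batch of $n_s(t)\ge1$ samples arrives for each $s$; $N_s(t)=\sum_{\ell=1}^t n_s(\ell)$. Set $\hat\theta_{s,t}=\frac1{N_s(t)}\sum_{j=1}^{N_s(t)}D_{s,j}$ and $\hat\theta_t=(\hat\theta_{1,t},\dots,\hat\theta_{S,t})$; these estimates take values in $\Theta$. At stage $t$, $m(t)\ge1$ simulation replications $X_{i,r}(\hat\theta_t)$, $r=1,\dots,m(t)$, are run for every design; conditionally on all the $\hat\theta_\ell$, the output vectors $(X_{1,r}(\hat\theta_\ell),\dots,X_{K,r}(\hat\theta_\ell))$ are independent over $(\ell,r)$, each distributed as $(X_1(\theta),\dots,X_K(\theta))$ with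 $\theta=\hat\theta_\ell$. The batch sizes are positive integers; $M(t)=\sum_{\ell=1}^t m(\ell)$, $M(0)=0$. Estimators. For the drop rate $\eta$ let $t_\eta=\lfloor\eta t\rfloor$, $$\hat\mu_{i,t}=[M(t)-M(t_\eta)]^{-1}\sum_{\ell=t_\eta+1}^t\sum_{r=1}^{m(\ell)}X_{i,r}(\hat\theta_\ell),\qquad \hat\delta_{ij,t}=\hat\mu_{i,t}-\hat\mu_{j,t}.$$ Assumptions, for all $i\in\mathcal I$ and $s\in\{1,\dots,S\}$. (B1) $\Sigma_{D,s}=\mathrm{Cov}(D_{s,1})$ exists. (B2) The matrix $\Sigma(\theta)$ with entries $\Sigma_{ij}(\theta)=\mathrm{Cov}[X_i(\theta),X_j(\theta)]$ exists and is continuous in $\theta\in\Theta$. (B3) $\mu_i(\cdot)$ is twice continuously differentiable in $\Theta$. (B4) $\{n_s(t)\}_t$ and $\{m(t)\}_t$ are uniformly bounded, and there exist positive constants $\bar n_s$ and $\bar m$ such that $N_s(t)/t\to\bar n_s$ and $M(t)/t\to\bar m$ as $t\to\infty$.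
   Formalization: The formal theorem additionally assumes that the law of the output vector (X_1(θ),…,X_K(θ)) is weakly continuous in θ at θ^c within Θ; without some such condition (B1)–(B4) do not give the Lindeberg condition and the claim fails. *)

theory Defs
  imports "HOL-Probability.Probability"
begin

definition covariance :: "'a measure \<Rightarrow> ('a \<Rightarrow> real) \<Rightarrow> ('a \<Rightarrow> real) \<Rightarrow> real" where
  "covariance P U V = (\<integral>\<omega>. (U \<omega> - (\<integral>x. U x \<partial>P)) * (V \<omega> - (\<integral>x. V x \<partial>P)) \<partial>P)"

definition covariance_exists :: "'a measure \<Rightarrow> ('a \<Rightarrow> real) \<Rightarrow> ('a \<Rightarrow> real) \<Rightarrow> bool" where
  "covariance_exists P U V \<longleftrightarrow> integrable P U \<and> integrable P V \<and>
     integrable P (\<lambda>\<omega>. (U \<omega> - (\<integral>x. U x \<partial>P)) * (V \<omega> - (\<integral>x. V x \<partial>P)))"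

text \<open>The library's weak convergence is restricted to sequences of laws on the real line; this is
  the usual definition by bounded continuous test functions, for an arbitrary filter.\<close>

definition converges_in_law ::
    "('i \<Rightarrow> 'a::topological_space measure) \<Rightarrow> 'a measure \<Rightarrow> 'i filter \<Rightarrow> bool" where
  "converges_in_law \<mu> \<nu> F \<longleftrightarrow>
     (\<forall>f :: 'a \<Rightarrow> real. continuous_on UNIV f \<and> bounded (range f) \<longrightarrow>
        ((\<lambda>t. \<integral>x. f x \<partial>(\<mu> t)) \<longlongrightarrow> (\<integral>x. f x \<partial>\<nu>)) F)"

text \<open>\<open>c\<close> is the mean and \<open>v \<ge> 0\<close> the variance (the library's density takes the standard deviation).\<close>

definition normal_law :: "real \<Rightarrow> real \<Rightarrow> real measure" where
  "normal_law c v = (if v = 0 then return borel c else density lborel (normal_density c (sqrt v)))"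

text \<open>\<open>\<nu>\<close> is the normal law with mean \<open>c\<close> and (possibly singular) covariance matrix \<open>C\<close>: every
  linear form is univariate normal.  This determines \<open>\<nu>\<close>.\<close>

definition is_multivariate_normal :: "real^'n \<Rightarrow> real^'n^'n \<Rightarrow> (real^'n) measure \<Rightarrow> bool" where
  "is_multivariate_normal c C \<nu> \<longleftrightarrow>
     sets \<nu> = sets borel \<and> prob_space \<nu> \<and>
     transpose C = C \<and> (\<forall>u. 0 \<le> u \<bullet> (C *v u)) \<and>
     (\<forall>u. distr \<nu> borel (\<lambda>x. u \<bullet> x) = normal_law (u \<bullet> c) (u \<bullet> (C *v u)))"

text \<open>Nothing is assumed about the parameter set \<open>S\<close>, so derivatives are taken within \<open>S\<close>; for
  open \<open>S\<close> they are the ordinary ones.\<close>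

definition twice_continuously_differentiable_on :: "(real^'n) set \<Rightarrow> (real^'n \<Rightarrow> real) \<Rightarrow> bool" where
  "twice_continuously_differentiable_on S f \<longleftrightarrow>
     (\<exists>G :: real^'n \<Rightarrow> real^'n. \<exists>H :: real^'n \<Rightarrow> real^'n^'n.
        (\<forall>x\<in>S. (f has_derivative (\<lambda>h. G x \<bullet> h)) (at x within S)) \<and>
        (\<forall>x\<in>S. (G has_derivative (\<lambda>h. H x *v h)) (at x within S)) \<and>
        continuous_on S H)"

definition gradient_within :: "(real^'n) set \<Rightarrow> (real^'n \<Rightarrow> real) \<Rightarrow> real^'n \<Rightarrow> real^'n" where
  "gradient_within S f x = (SOME g. (f has_derivative (\<lambda>h. g \<bullet> h)) (at x within S))"

text \<open>\<open>X \<theta>\<close> is the vector of outputs of all designs, a random vector on the probability space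
  \<open>Q \<theta>\<close> that carries the random inputs drawn under the parameter \<open>\<theta>\<close>.\<close>

definition output_law :: "('p \<Rightarrow> 'z measure) \<Rightarrow> ('p \<Rightarrow> 'z \<Rightarrow> real^'k) \<Rightarrow> 'p \<Rightarrow> (real^'k) measure" where
  "output_law Q X \<theta> = distr (Q \<theta>) borel (X \<theta>)"

definition output_mean :: "('p \<Rightarrow> 'z measure) \<Rightarrow> ('p \<Rightarrow> 'z \<Rightarrow> real^'k) \<Rightarrow> 'k \<Rightarrow> 'p \<Rightarrow> real" where
  "output_mean Q X i \<theta> = (\<integral>z. X \<theta> z $ i \<partial>(Q \<theta>))"

definition output_diff ::
    "('p \<Rightarrow> 'z measure) \<Rightarrow> ('p \<Rightarrow> 'z \<Rightarrow> real^'k) \<Rightarrow> 'k \<Rightarrow> 'k \<Rightarrow> 'p \<Rightarrow> real" where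
  "output_diff Q X i j \<theta> = output_mean Q X i \<theta> - output_mean Q X j \<theta>"

definition output_cov ::
    "('p \<Rightarrow> 'z measure) \<Rightarrow> ('p \<Rightarrow> 'z \<Rightarrow> real^'k) \<Rightarrow> 'p \<Rightarrow> real^'k^'k" where
  "output_cov Q X \<theta> = (\<chi> i j. covariance (Q \<theta>) (\<lambda>z. X \<theta> z $ i) (\<lambda>z. X \<theta> z $ j))"

text \<open>The coordinates of \<open>\<real>\<^sup>d\<close> are the elements of a finite type \<open>'d\<close>, and \<open>b :: 'd \<Rightarrow> 's\<close> assigns
  each coordinate to the input distribution it belongs to.  Thus \<open>\<theta>\<^sub>s\<close> consists of the coordinates of
  \<open>\<theta>\<close> in \<open>block b s\<close>, and \<open>d\<^sub>s = card (block b s)\<close>.  A \<open>d\<^sub>s\<close>-dimensional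
  vector is represented as an element of \<open>space (block_space b s)\<close>.\<close>

definition block :: "('d \<Rightarrow> 's) \<Rightarrow> 's \<Rightarrow> 'd set" where
  "block b s = {k. b k = s}"

definition block_space :: "('d \<Rightarrow> 's) \<Rightarrow> 's \<Rightarrow> ('d \<Rightarrow> real) measure" where
  "block_space b s = PiM (block b s) (\<lambda>_. borel)"

text \<open>Stages, samples and replications are numbered from 1.\<close>

definition total :: "(nat \<Rightarrow> nat) \<Rightarrow> nat \<Rightarrow> nat" where
  "total n t = (\<Sum>l=1..t. n l)"

definition theta_hat ::
    "('d \<Rightarrow> 's) \<Rightarrow> ('s \<Rightarrow> nat \<Rightarrow> nat) \<Rightarrow> ('s \<Rightarrow> nat \<Rightarrow> 'w \<Rightarrow> 'd \<Rightarrow> real) \<Rightarrow> nat \<Rightarrow> 'w \<Rightarrow> real^'d" where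
  "theta_hat b n D t \<omega> =
     (\<chi> k. (\<Sum>j=1..total (n (b k)) t. D (b k) j \<omega> k) / real (total (n (b k)) t))"

definition theta_hat_algebra ::
    "'w measure \<Rightarrow> ('d \<Rightarrow> 's) \<Rightarrow> ('s \<Rightarrow> nat \<Rightarrow> nat) \<Rightarrow> ('s \<Rightarrow> nat \<Rightarrow> 'w \<Rightarrow> 'd::finite \<Rightarrow> real) \<Rightarrow> 'w measure" where
  "theta_hat_algebra M b n D =
     vimage_algebra (space M) (\<lambda>\<omega>. restrict (\<lambda>t. theta_hat b n D t \<omega>) {1..}) (PiM {1..} (\<lambda>_. borel))"

definition mu_hat ::
    "real \<Rightarrow> (nat \<Rightarrow> nat) \<Rightarrow> (nat \<Rightarrow> nat \<Rightarrow> 'w \<Rightarrow> real^'k) \<Rightarrow> 'k \<Rightarrow> nat \<Rightarrow> 'w \<Rightarrow> real" where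
  "mu_hat \<eta> m Y i t \<omega> =
     (let t\<eta> = nat \<lfloor>\<eta> * real t\<rfloor> in
        (\<Sum>l=t\<eta>+1..t. \<Sum>r=1..m l. Y l r \<omega> $ i) / (real (total m t) - real (total m t\<eta>)))"

definition delta_hat ::
    "real \<Rightarrow> (nat \<Rightarrow> nat) \<Rightarrow> (nat \<Rightarrow> nat \<Rightarrow> 'w \<Rightarrow> real^'k) \<Rightarrow> 'k \<Rightarrow> 'k \<Rightarrow> nat \<Rightarrow> 'w \<Rightarrow> real" where
  "delta_hat \<eta> m Y i j t \<omega> = mu_hat \<eta> m Y i t \<omega> - mu_hat \<eta> m Y j t \<omega>"

text \<open>\<open>ln 0 = 0\<close> in HOL, so \<open>\<eta> ln \<eta> = 0\<close> for \<open>\<eta> = 0\<close>.\<close>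

definition lambda_I :: "real \<Rightarrow> real" where
  "lambda_I \<eta> = 2 / (1 - \<eta>) + 2 * \<eta> * ln \<eta> / (1 - \<eta>)\<^sup>2"

definition lambda_S :: "real \<Rightarrow> real" where
  "lambda_S \<eta> = 1 / (1 - \<eta>)"

definition Sigma_D_bar ::
    "'w measure \<Rightarrow> ('d \<Rightarrow> 's) \<Rightarrow> ('s \<Rightarrow> real) \<Rightarrow> ('s \<Rightarrow> nat \<Rightarrow> 'w \<Rightarrow> 'd \<Rightarrow> real) \<Rightarrow> real^'d^'d" where
  "Sigma_D_bar M b nbar D =
     (\<chi> k k'. if b k = b k'
        then inverse (nbar (b k)) * covariance M (\<lambda>\<omega>. D (b k) 1 \<omega> k) (\<lambda>\<omega>. D (b k) 1 \<omega> k')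
        else 0)"

end

theory Submission
  imports Defs
begin

text \<open>Fix a direction and call the stages after \<open>t\<^sub>\<eta>\<close>, up to
  \<open>t\<close>, retained. A linear form of \<open>sqrt t\<close> times the estimation error is a sum
  of three parts: the simulation noise of the retained replications around the means at the estimates
  under which they were run; the linear effect \<open>g \<bullet> (theta_hat l - \<theta>c)\<close> of
  the input error, averaged over the retained stages; and the error of that linearization.

  \<^bold>\<open>Input part.\<close> An input sample enters every estimate formed after its arrival.
  Exchanging the sums turns the linear effect into a weighted sum of independent centred variables, in
  which the sample with number \<open>j\<close> has the weight \<open>input_weight\<close>, the sum of
  \<open>m l / N l\<close> over the retained stages \<open>l\<close> with \<open>j \<le> N l\<close>. No
  single weight matters (\<open>input_weight_sup_tendsto\<close>), and the squared weights add up to a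
  multiple of \<open>lambda_I \<eta>\<close> (\<open>sum_input_weight_square_tendsto\<close>). The
  logarithm in \<open>lambda_I\<close> is the limit of the sum of \<open>m l / M l\<close> over the
  retained stages. The central limit theorem for weighted sums then gives
  \<open>input_char_tendsto\<close>.

  \<^bold>\<open>Noise part.\<close> Given the estimates, the replications are independent, so the
  conditional characteristic function of the noise is a product. The estimates converge to
  \<open>\<theta>c\<close> almost surely by a strong law. Convergence of the output laws together with
  convergence of their variances makes the squared outputs uniformly integrable
  (\<open>uniform_lindeberg\<close>), and therefore the product converges almost surely to the constant
  \<open>exp (- \<sigma>\<^sup>2 / 2)\<close> (\<open>noise_prod_tendsto\<close>). Because this limit
  does not depend on the estimates, the noise is asymptotically independent of the input part and the
  two variances add.

  \<^bold>\<open>Linearization error.\<close> At stage \<open>l\<close> it is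
  \<open>o (norm (theta_hat l - \<theta>c))\<close>, and \<open>norm (theta_hat l - \<theta>c)\<close>
  has second moment \<open>O (1 / l)\<close>. Averaging over the stages leaves
  \<open>o (1 / sqrt t)\<close> in probability (\<open>remainder_tendsto\<close>). Within a general set
  \<open>\<Theta>\<close> several vectors may represent the derivative at \<open>\<theta>c\<close>; the
  argument rests on the defining property of the derivative alone, so each of them leads to the same
  limit.

  The three parts give the limit of the characteristic function of every linear form
  (\<open>scalar_char_tendsto\<close>). A vector with this normal law exists because a positive
  semidefinite form is a sum of squares (\<open>multivariate_normal_exists\<close>), and pointwise
  convergence of characteristic functions on a Euclidean space implies convergence in law
  (\<open>levy_continuity_euclidean\<close>).\<close>

section \<open>Averages over the retained stages\<close>

text \<open>Every fixed index loses its weight in the limit, so only indices with small \<open>y\<close>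
  remain, and these carry a bounded total weight.\<close>

lemma toeplitz_null:
  fixes w :: "nat \<Rightarrow> nat \<Rightarrow> real" and y :: "nat \<Rightarrow> real"
  assumes fin: "\<And>t. finite (A t)"
    and nonneg: "\<And>t l. 0 \<le> w t l"
    and bound: "\<forall>\<^sub>F t in sequentially. (\<Sum>l\<in>A t. w t l) \<le> C"
    and null: "\<And>l. (\<lambda>t. w t l) \<longlonglongrightarrow> 0"
    and y: "y \<longlonglongrightarrow> 0"
  shows "(\<lambda>t. \<Sum>l\<in>A t. w t l * y l) \<longlonglongrightarrow> 0"
proof (rule tendstoI)
  fix \<epsilon> :: real assume "\<epsilon> > 0"
  \<comment> \<open>The constant \<open>C\<close> may be 0 or negative, hence the absolute value and the 1.\<close>
  define \<delta> where "\<delta> = \<epsilon> / (2 * (\<bar>C\<bar> + 1))"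
  have "\<delta> > 0" using \<open>\<epsilon> > 0\<close> by (simp add: \<delta>_def add_nonneg_pos)
  then obtain L where L: "\<And>l. l \<ge> L \<Longrightarrow> \<bar>y l\<bar> < \<delta>"
    using y by (auto simp: LIMSEQ_iff)
  have "(\<lambda>t. \<Sum>l<L. w t l * \<bar>y l\<bar>) \<longlonglongrightarrow> (\<Sum>l<L. 0 * \<bar>y l\<bar>)"
    by (intro tendsto_intros null)
  then have "\<forall>\<^sub>F t in sequentially. (\<Sum>l<L. w t l * \<bar>y l\<bar>) < \<epsilon> / 2"
    using \<open>\<epsilon> > 0\<close> by (intro order_tendstoD(2)) auto
  with bound show "\<forall>\<^sub>F t in sequentially. dist (\<Sum>l\<in>A t. w t l * y l) 0 < \<epsilon>"
  proof eventually_elim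
    case (elim t)
    have "\<bar>\<Sum>l\<in>A t. w t l * y l\<bar> \<le> (\<Sum>l\<in>A t. w t l * \<bar>y l\<bar>)"
      by (rule order_trans[OF sum_abs]) (simp add: abs_mult nonneg)
    also have "\<dots> = (\<Sum>l\<in>A t \<inter> {..<L}. w t l * \<bar>y l\<bar>) + (\<Sum>l\<in>A t - {..<L}. w t l * \<bar>y l\<bar>)"
      by (rule sum.Int_Diff) (rule fin)
    also have "(\<Sum>l\<in>A t \<inter> {..<L}. w t l * \<bar>y l\<bar>) \<le> (\<Sum>l<L. w t l * \<bar>y l\<bar>)"
      by (rule sum_mono2) (auto simp: nonneg)
    also have "(\<Sum>l\<in>A t - {..<L}. w t l * \<bar>y l\<bar>) \<le> (\<Sum>l\<in>A t - {..<L}. w t l * \<delta>)"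
      using L by (intro sum_mono mult_left_mono) (auto simp: nonneg less_imp_le)
    also have "\<dots> \<le> (\<Sum>l\<in>A t. w t l * \<delta>)"
      using \<open>\<delta> > 0\<close> by (intro sum_mono2) (auto simp: nonneg fin)
    also have "\<dots> \<le> \<bar>C\<bar> * \<delta>"
      using elim(1) \<open>\<delta> > 0\<close> by (simp flip: sum_distrib_right)
    also have "\<bar>C\<bar> * \<delta> \<le> \<epsilon> / 2"
      using \<open>\<epsilon> > 0\<close> by (simp add: \<delta>_def field_simps)
    finally show ?case using elim(2) by simp
  qed
qed

lemma toeplitz:
  fixes w :: "nat \<Rightarrow> nat \<Rightarrow> real" and y :: "nat \<Rightarrow> real"
  assumes fin: "\<And>t. finite (A t)"
    and nonneg: "\<And>t l. 0 \<le> w t l"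
    and total: "(\<lambda>t. \<Sum>l\<in>A t. w t l) \<longlonglongrightarrow> s"
    and null: "\<And>l. (\<lambda>t. w t l) \<longlonglongrightarrow> 0"
    and y: "y \<longlonglongrightarrow> y0"
  shows "(\<lambda>t. \<Sum>l\<in>A t. w t l * y l) \<longlonglongrightarrow> s * y0"
proof -
  have "\<forall>\<^sub>F t in sequentially. (\<Sum>l\<in>A t. w t l) \<le> s + 1"
    using order_tendstoD(2)[OF total, of "s + 1"] by (auto elim: eventually_mono)
  moreover have "(\<lambda>l. y l - y0) \<longlonglongrightarrow> 0"
    using y by (simp add: LIM_zero)
  ultimately have "(\<lambda>t. \<Sum>l\<in>A t. w t l * (y l - y0)) \<longlonglongrightarrow> 0"
    by (intro toeplitz_null fin nonneg null)
  from tendsto_add[OF this tendsto_mult_right[OF total, of y0]]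
  show ?thesis by (simp add: algebra_simps sum_subtractf flip: sum_distrib_left sum_distrib_right)
qed

definition dropped :: "real \<Rightarrow> nat \<Rightarrow> nat" where
  "dropped \<eta> t = nat \<lfloor>\<eta> * real t\<rfloor>"

lemma dropped_bounds:
  assumes "0 \<le> \<eta>"
  shows "real (dropped \<eta> t) \<le> \<eta> * real t" "\<eta> * real t < real (dropped \<eta> t) + 1"
  using assms unfolding dropped_def by (simp_all add: of_nat_nat)

lemma dropped_le:
  assumes "0 \<le> \<eta>" "\<eta> < 1"
  shows "dropped \<eta> t \<le> t"
proof -
  have "real (dropped \<eta> t) \<le> \<eta> * real t" by (rule dropped_bounds) fact
  also have "\<dots> \<le> 1 * real t" using assms by (intro mult_right_mono) auto
  finally show ?thesis by simp
qed

lemma dropped_div_tendsto: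
  assumes "0 \<le> \<eta>"
  shows "(\<lambda>t. real (dropped \<eta> t) / real t) \<longlonglongrightarrow> \<eta>"
proof (rule tendsto_sandwich)
  show "\<forall>\<^sub>F t in sequentially. \<eta> - 1 / real t \<le> real (dropped \<eta> t) / real t"
    using eventually_gt_at_top[of 0]
  proof eventually_elim
    case (elim t)
    have "\<eta> - 1 / real t = (\<eta> * real t - 1) / real t" using elim by (simp add: field_simps)
    also have "\<dots> \<le> real (dropped \<eta> t) / real t"
      using dropped_bounds(2)[OF assms, of t] by (intro divide_right_mono) auto
    finally show ?case .
  qed
  show "\<forall>\<^sub>F t in sequentially. real (dropped \<eta> t) / real t \<le> \<eta>"
    using eventually_gt_at_top[of 0]
  proof eventually_elim
    case (elim t)
    then show ?case using dropped_bounds(1)[OF assms, of t] by (simp add: field_simps)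
  qed
  show "(\<lambda>t. \<eta> - 1 / real t) \<longlonglongrightarrow> \<eta>"
    using tendsto_diff[OF tendsto_const lim_1_over_n, of \<eta>] by simp
qed simp

lemma dropped_at_top:
  assumes "0 < \<eta>"
  shows "filterlim (dropped \<eta>) at_top sequentially"
proof -
  have "filterlim (\<lambda>t. \<eta> * real t - 1) at_top sequentially"
    using filterlim_tendsto_add_at_top[OF tendsto_const[of "-1"]
      filterlim_tendsto_pos_mult_at_top[OF tendsto_const assms filterlim_real_sequentially]]
    by (simp add: add.commute)
  then have "filterlim (\<lambda>t. real (dropped \<eta> t)) at_top sequentially"
  proof (rule filterlim_at_top_mono)
    show "\<forall>\<^sub>F t in sequentially. \<eta> * real t - 1 \<le> real (dropped \<eta> t)"
      using dropped_bounds(2)[of \<eta>] assms by (intro always_eventually allI) (simp add: less_imp_le algebra_simps)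
  qed
  then show ?thesis
    using filterlim_sequentially_iff_filterlim_real by blast
qed

lemma total_0 [simp]: "total n 0 = 0"
  by (simp add: total_def)

lemma total_Suc [simp]: "total n (Suc t) = total n t + n (Suc t)"
  by (simp add: total_def)

lemma total_window:
  assumes "p \<le> t"
  shows "(\<Sum>l=p+1..t. real (m l)) = real (total m t) - real (total m p)"
  using assms by (induction t rule: dec_induct) auto

lemma le_total:
  assumes "\<And>t. t \<ge> 1 \<Longrightarrow> n t \<ge> 1"
  shows "t \<le> total n t"
proof (induction t)
  case (Suc t)
  then show ?case using assms[of "Suc t"] by simp
qed simp

lemma total_mono: "s \<le> t \<Longrightarrow> total n s \<le> total n t"
  by (induction t rule: dec_induct) auto

lemma window_average_tendsto:
  assumes lim: "(\<lambda>t. real (total m t) / real t) \<longlonglongrightarrow> mbar" and \<eta>: "0 \<le> \<eta>"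
  shows "(\<lambda>t. real (total m (dropped \<eta> t)) / real t) \<longlonglongrightarrow> mbar * \<eta>"
    and "(\<lambda>t. (real (total m t) - real (total m (dropped \<eta> t))) / real t) \<longlonglongrightarrow> mbar * (1 - \<eta>)"
proof -
  show 1: "(\<lambda>t. real (total m (dropped \<eta> t)) / real t) \<longlonglongrightarrow> mbar * \<eta>"
  proof (cases "\<eta> = 0")
    case True
    then show ?thesis by (simp add: dropped_def)
  next
    case False
    with \<eta> have "filterlim (dropped \<eta>) at_top sequentially" by (intro dropped_at_top) auto
    from tendsto_mult[OF filterlim_compose[OF lim this] dropped_div_tendsto[OF \<eta>]]
    show ?thesis
      by (rule Lim_transform_eventually)
        (use filterlim_at_top[THEN iffD1, OF \<open>filterlim (dropped \<eta>) at_top sequentially\<close>, rule_format, of 1] in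
          \<open>auto elim!: eventually_mono\<close>)
  qed
  from tendsto_diff[OF lim 1]
  show "(\<lambda>t. (real (total m t) - real (total m (dropped \<eta> t))) / real t) \<longlonglongrightarrow> mbar * (1 - \<eta>)"
    by (simp add: algebra_simps diff_divide_distrib)
qed

text \<open>The bounds \<open>m / (M + m) \<le> ln (M + m) - ln M \<le> m / M\<close> for one stage turn
  the sum into a telescoping one. Their gap at the stage after \<open>t\<close> is at most
  \<open>B\<^sup>2 / (t * (t + 1))\<close>, which telescopes as well.\<close>

lemma sum_div_total_bounds:
  fixes m :: "nat \<Rightarrow> nat"
  assumes pos: "\<And>t. t \<ge> 1 \<Longrightarrow> m t \<ge> 1" and bdd: "\<And>t. t \<ge> 1 \<Longrightarrow> m t \<le> B"
    and p: "1 \<le> p" "p \<le> t"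
  shows "(\<Sum>l=p+1..t. real (m l) / real (total m l)) \<le> ln (real (total m t)) - ln (real (total m p))"
    and "ln (real (total m t)) - ln (real (total m p)) - (real B)\<^sup>2 * (1 / real p - 1 / real t)
      \<le> (\<Sum>l=p+1..t. real (m l) / real (total m l))"
proof -
  have "(\<Sum>l=p+1..t. real (m l) / real (total m l)) \<le> ln (real (total m t)) - ln (real (total m p)) \<and>
    ln (real (total m t)) - ln (real (total m p)) - (real B)\<^sup>2 * (1 / real p - 1 / real t)
      \<le> (\<Sum>l=p+1..t. real (m l) / real (total m l))"
    using p(2)
  proof (induction t rule: dec_induct)
    case (step t)
    define x y where "x = real (total m t)" and "y = real (m (Suc t))"
    have t: "1 \<le> t" using p(1) step by simp
    have x: "real t \<le> x" using le_total[of m t, OF pos] by (simp add: x_def)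
    have y: "1 \<le> y" "y \<le> real B" using pos[of "Suc t"] bdd[of "Suc t"] by (simp_all add: y_def)
    have xpos: "x > 0" using x t by simp
    have "ln (x / (x + y)) \<le> x / (x + y) - 1" using xpos y by (intro ln_le_minus_one) auto
    moreover have "x / (x + y) - 1 = - (y / (x + y))" using xpos y by (simp add: field_simps)
    moreover have "ln (x / (x + y)) = ln x - ln (x + y)" using xpos y by (subst ln_div) auto
    ultimately have up: "y / (x + y) \<le> ln (x + y) - ln x" by simp
    have "ln ((x + y) / x) \<le> (x + y) / x - 1" using xpos y by (intro ln_le_minus_one) auto
    moreover have "(x + y) / x - 1 = y / x" using xpos by (simp add: field_simps)
    moreover have "ln ((x + y) / x) = ln (x + y) - ln x" using xpos y by (subst ln_div) auto
    ultimately have lo: "ln (x + y) - ln x \<le> y / x" by simp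
    have "y / x - y / (x + y) = y\<^sup>2 / (x * (x + y))"
      using xpos y by (simp add: field_simps power2_eq_square)
    also have "\<dots> \<le> (real B)\<^sup>2 / (real t * real (Suc t))"
      using xpos y x t by (intro frac_le power_mono mult_mono) auto
    also have "\<dots> = (real B)\<^sup>2 * (1 / real t - 1 / real (Suc t))"
      using t by (simp add: field_simps)
    finally have "y / x - y / (x + y) \<le> (real B)\<^sup>2 * (1 / real t - 1 / real (Suc t))" .
    with up lo step.IH t step.hyps show ?case
      by (simp add: x_def y_def algebra_simps del: of_nat_Suc)
  qed simp
  then show "(\<Sum>l=p+1..t. real (m l) / real (total m l)) \<le> ln (real (total m t)) - ln (real (total m p))"
    "ln (real (total m t)) - ln (real (total m p)) - (real B)\<^sup>2 * (1 / real p - 1 / real t)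
      \<le> (\<Sum>l=p+1..t. real (m l) / real (total m l))" by auto
qed

text \<open>The limit is that of \<open>ln (M t / M t\<^sub>\<eta>)\<close>; this is where the logarithm
  in \<open>lambda_I\<close> comes from.\<close>

lemma window_log_tendsto:
  fixes m :: "nat \<Rightarrow> nat"
  assumes pos: "\<And>t. t \<ge> 1 \<Longrightarrow> m t \<ge> 1" and bdd: "\<And>t. t \<ge> 1 \<Longrightarrow> m t \<le> B"
    and lim: "(\<lambda>t. real (total m t) / real t) \<longlonglongrightarrow> mbar" and mbar: "mbar > 0"
    and \<eta>: "0 < \<eta>" "\<eta> < 1"
  shows "(\<lambda>t. \<Sum>l=dropped \<eta> t + 1..t. real (m l) / real (total m l)) \<longlonglongrightarrow> - ln \<eta>"
proof -
  note dropped = dropped_at_top[OF \<eta>(1)]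
  have c1: "\<forall>\<^sub>F t in sequentially. 1 \<le> dropped \<eta> t"
    using dropped by (simp add: filterlim_at_top)
  have "(\<lambda>t. (real (total m t) / real t) / (real (total m (dropped \<eta> t)) / real t)) \<longlonglongrightarrow> mbar / (mbar * \<eta>)"
    using mbar \<eta> by (intro tendsto_divide lim window_average_tendsto) auto
  from tendsto_ln[OF this]
  have "(\<lambda>t. ln ((real (total m t) / real t) / (real (total m (dropped \<eta> t)) / real t))) \<longlonglongrightarrow> - ln \<eta>"
    using mbar \<eta> by (simp add: ln_div)
  then have ln_lim: "(\<lambda>t. ln (real (total m t)) - ln (real (total m (dropped \<eta> t)))) \<longlonglongrightarrow> - ln \<eta>"
  proof (rule Lim_transform_eventually)
    show "\<forall>\<^sub>F t in sequentially. ln ((real (total m t) / real t) / (real (total m (dropped \<eta> t)) / real t))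
        = ln (real (total m t)) - ln (real (total m (dropped \<eta> t)))"
      using c1
    proof eventually_elim
      case (elim t)
      have "t \<ge> 1" using elim dropped_le[of \<eta> t] \<eta> by simp
      moreover have "total m t > 0" "total m (dropped \<eta> t) > 0"
        using le_total[of m t, OF pos] le_total[of m "dropped \<eta> t", OF pos] elim \<open>t \<ge> 1\<close> by simp_all
      ultimately show ?case by (simp add: ln_div)
    qed
  qed
  have "(\<lambda>t. (real B)\<^sup>2 * (1 / real (dropped \<eta> t) - 1 / real t)) \<longlonglongrightarrow> (real B)\<^sup>2 * (0 - 0)"
    by (intro tendsto_intros filterlim_compose[OF lim_1_over_n dropped] lim_1_over_n)
  from tendsto_diff[OF ln_lim this]
  have low: "(\<lambda>t. ln (real (total m t)) - ln (real (total m (dropped \<eta> t)))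
       - (real B)\<^sup>2 * (1 / real (dropped \<eta> t) - 1 / real t)) \<longlonglongrightarrow> - ln \<eta>" by simp
  show ?thesis
  proof (rule tendsto_sandwich[OF _ _ low ln_lim])
    show "\<forall>\<^sub>F t in sequentially. ln (real (total m t)) - ln (real (total m (dropped \<eta> t)))
       - (real B)\<^sup>2 * (1 / real (dropped \<eta> t) - 1 / real t)
       \<le> (\<Sum>l=dropped \<eta> t + 1..t. real (m l) / real (total m l))"
      using c1
    proof eventually_elim
      case (elim t)
      show ?case by (rule sum_div_total_bounds(2)[OF pos bdd elim dropped_le]) (use \<eta> in auto)
    qed
    show "\<forall>\<^sub>F t in sequentially. (\<Sum>l=dropped \<eta> t + 1..t. real (m l) / real (total m l))
       \<le> ln (real (total m t)) - ln (real (total m (dropped \<eta> t)))"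
      using c1
    proof eventually_elim
      case (elim t)
      show ?case by (rule sum_div_total_bounds(1)[OF pos bdd elim dropped_le]) (use \<eta> in auto)
    qed
  qed
qed

text \<open>Writing \<open>N\<close> for \<open>total n\<close>, this is the coefficient of the input
  sample with number \<open>j\<close> when the averages of the first \<open>N l\<close> samples, for the
  stages \<open>l = p + 1, \<dots>, t\<close>, are added with the multiplicities
  \<open>m l\<close>.\<close>

definition input_weight :: "(nat \<Rightarrow> nat) \<Rightarrow> (nat \<Rightarrow> nat) \<Rightarrow> nat \<Rightarrow> nat \<Rightarrow> nat \<Rightarrow> real" where
  "input_weight m n p t j =
     (\<Sum>l=p+1..t. if j \<le> total n l then real (m l) / real (total n l) else 0)"

lemma input_weight_Suc:
  "p \<le> t \<Longrightarrow> input_weight m n p (Suc t) j = input_weight m n p t j +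
     (if j \<le> total n (Suc t) then real (m (Suc t)) / real (total n (Suc t)) else 0)"
  by (simp add: input_weight_def)

lemma input_weight_eq_0:
  assumes "total n t < j"
  shows "input_weight m n p t j = 0"
proof -
  have "\<not> j \<le> total n l" if "l \<le> t" for l
    using total_mono[OF that, of n] assms by simp
  then show ?thesis unfolding input_weight_def by (intro sum.neutral) auto
qed

lemma input_weight_nonneg: "0 \<le> input_weight m n p t j"
  unfolding input_weight_def by (intro sum_nonneg) auto

lemma input_weight_le: "input_weight m n p t j \<le> (\<Sum>l=p+1..t. real (m l) / real (total n l))"
  unfolding input_weight_def by (intro sum_mono) auto

text \<open>The averages of two stages \<open>l' < l\<close> share the first \<open>N l'\<close>
  samples, so their inner product, as vectors of weights, is \<open>1 / N l\<close>. The double sum over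
  pairs of stages collapses to a single sum over the later stage of the pair. The induction adds the
  last stage, whose weight is spread evenly over all samples; hence it needs the sum of the weights
  along with the sum of their squares.\<close>

lemma sum_input_weight:
  assumes pos: "\<And>t. t \<ge> 1 \<Longrightarrow> n t \<ge> 1" and p: "p \<le> t"
  shows "(\<Sum>j=1..total n t. input_weight m n p t j) = real (total m t) - real (total m p)"
    and "(\<Sum>j=1..total n t. (input_weight m n p t j)\<^sup>2) =
      (\<Sum>l=p+1..t. real (m l) / real (total n l) * (2 * (real (total m l) - real (total m p)) - real (m l)))"
proof -
  have "(\<Sum>j=1..total n t. input_weight m n p t j) = real (total m t) - real (total m p) \<and>
    (\<Sum>j=1..total n t. (input_weight m n p t j)\<^sup>2) =
      (\<Sum>l=p+1..t. real (m l) / real (total n l) * (2 * (real (total m l) - real (total m p)) - real (m l)))"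
    using p
  proof (induction t rule: dec_induct)
    case base
    show ?case by (simp add: input_weight_def)
  next
    case (step t)
    define x where "x = real (m (Suc t)) / real (total n (Suc t))"
    have Npos: "total n (Suc t) > 0" using pos[of "Suc t"] by simp
    \<comment> \<open>Samples that arrive at the last stage carry no weight before it.\<close>
    have ext: "(\<Sum>j=1..total n (Suc t). f (input_weight m n p t j)) = (\<Sum>j=1..total n t. f (input_weight m n p t j))"
      if "f 0 = 0" for f :: "real \<Rightarrow> real"
      using that total_mono[of t "Suc t" n]
      by (intro sum.mono_neutral_right) (auto simp: input_weight_eq_0)
    have w: "input_weight m n p (Suc t) j = input_weight m n p t j + x" if "j \<in> {1..total n (Suc t)}" for j
      using that step.hyps by (subst input_weight_Suc) (auto simp: x_def)
    have xN: "x * real (total n (Suc t)) = real (m (Suc t))"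
      using Npos by (simp add: x_def del: total_Suc)
    have 1: "(\<Sum>j=1..total n (Suc t). input_weight m n p (Suc t) j) = real (total m (Suc t)) - real (total m p)"
      using step.IH xN ext[of "\<lambda>x. x"] by (simp add: w sum.distrib algebra_simps del: total_Suc) simp
    have "(\<Sum>j=1..total n (Suc t). (input_weight m n p (Suc t) j)\<^sup>2) =
        (\<Sum>j=1..total n (Suc t). (input_weight m n p t j)\<^sup>2) +
        2 * x * (\<Sum>j=1..total n (Suc t). input_weight m n p t j) + x * (x * real (total n (Suc t)))"
      by (simp add: w sum.distrib power2_sum sum_distrib_left power2_eq_square algebra_simps del: total_Suc)
    also have "\<dots> = (\<Sum>l=p+1..t. real (m l) / real (total n l) * (2 * (real (total m l) - real (total m p)) - real (m l)))
        + 2 * x * (real (total m t) - real (total m p)) + x * real (m (Suc t))"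
      using step.IH ext[of "\<lambda>x. x"] ext[of "\<lambda>x. x\<^sup>2"] xN by simp
    also have "\<dots> = (\<Sum>l=p+1..t. real (m l) / real (total n l) * (2 * (real (total m l) - real (total m p)) - real (m l)))
        + x * (2 * (real (total m (Suc t)) - real (total m p)) - real (m (Suc t)))"
      by (simp add: algebra_simps)
    also have "\<dots> = (\<Sum>l=p+1..Suc t. real (m l) / real (total n l) * (2 * (real (total m l) - real (total m p)) - real (m l)))"
      using step.hyps by (simp add: x_def del: total_Suc)
    finally show ?case using 1 by blast
  qed
  then show "(\<Sum>j=1..total n t. input_weight m n p t j) = real (total m t) - real (total m p)"
    "(\<Sum>j=1..total n t. (input_weight m n p t j)\<^sup>2) =
      (\<Sum>l=p+1..t. real (m l) / real (total n l) * (2 * (real (total m l) - real (total m p)) - real (m l)))"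
    by auto
qed

lemma sum_inv_sqrt_le: "(\<Sum>l=1..t. 1 / sqrt (real l)) \<le> 2 * sqrt (real t)"
proof (induction t)
  case (Suc t)
  have "1 / sqrt (real (Suc t)) \<le> 2 * (sqrt (real (Suc t)) - sqrt (real t))"
  proof -
    have "1 = (sqrt (real (Suc t)))\<^sup>2 - (sqrt (real t))\<^sup>2" by simp
    also have "\<dots> = (sqrt (real (Suc t)) - sqrt (real t)) * (sqrt (real (Suc t)) + sqrt (real t))"
      by (simp add: power2_eq_square algebra_simps del: real_sqrt_mult_self of_nat_Suc)
    also have "\<dots> \<le> (sqrt (real (Suc t)) - sqrt (real t)) * (2 * sqrt (real (Suc t)))"
      by (intro mult_left_mono) auto
    finally show ?thesis by (simp add: field_simps del: of_nat_Suc)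
  qed
  with Suc show ?case by (simp add: algebra_simps)
qed simp

lemma inv_sqrt_tendsto: "(\<lambda>l. 1 / sqrt (real l)) \<longlonglongrightarrow> 0"
  using tendsto_real_sqrt[OF lim_1_over_n] by (simp add: real_sqrt_divide)

text \<open>The weights \<open>1 / sqrt (l * t)\<close> add up to at most 2.\<close>

lemma sqrt_average_null:
  assumes "y \<longlonglongrightarrow> 0"
  shows "(\<lambda>t. (\<Sum>l=1..t. y l / sqrt (real l)) / sqrt (real t)) \<longlonglongrightarrow> 0"
proof -
  have "(\<lambda>t. \<Sum>l\<in>{1..t}. (1 / sqrt (real l) * (1 / sqrt (real t))) * y l) \<longlonglongrightarrow> 0"
  proof (rule toeplitz_null[where C=2])
    show "\<forall>\<^sub>F t in sequentially. (\<Sum>l=1..t. 1 / sqrt (real l) * (1 / sqrt (real t))) \<le> 2"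
      using eventually_gt_at_top[of 0]
    proof eventually_elim
      case (elim t)
      have "(\<Sum>l=1..t. 1 / sqrt (real l) * (1 / sqrt (real t))) = (\<Sum>l=1..t. 1 / sqrt (real l)) * (1 / sqrt (real t))"
        by (rule sum_distrib_right[symmetric])
      also have "\<dots> \<le> 2 * sqrt (real t) * (1 / sqrt (real t))"
        by (intro mult_right_mono sum_inv_sqrt_le) auto
      finally show ?case using elim by simp
    qed
    show "(\<lambda>t. 1 / sqrt (real l) * (1 / sqrt (real t))) \<longlonglongrightarrow> 0" for l
      by (rule tendsto_mult_right_zero[OF inv_sqrt_tendsto])
  qed (use assms in auto)
  then show ?thesis by (simp add: sum_divide_distrib field_simps)
qed

lemma div_total_le:
  fixes n :: "nat \<Rightarrow> nat"
  assumes pos: "\<And>t. t \<ge> 1 \<Longrightarrow> n t \<ge> 1" and bdd: "\<And>t. t \<ge> 1 \<Longrightarrow> m t \<le> B" and l: "l \<ge> 1"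
  shows "real (m l) / real (total n l) \<le> real B / real l"
  using le_total[of n l, OF pos] bdd[OF l] l by (intro frac_le) auto

text \<open>The sum of \<open>m l / N l\<close> over all stages dominates every single input weight. It
  is of order \<open>ln t\<close> and hence \<open>o (sqrt t)\<close>.\<close>

lemma input_weight_sup_tendsto:
  fixes m n :: "nat \<Rightarrow> nat"
  assumes n_pos: "\<And>t. t \<ge> 1 \<Longrightarrow> n t \<ge> 1" and m_bdd: "\<And>t. t \<ge> 1 \<Longrightarrow> m t \<le> B"
    and m_lim: "(\<lambda>t. real (total m t) / real t) \<longlonglongrightarrow> mbar" and mbar: "mbar > 0"
    and \<eta>: "0 \<le> \<eta>" "\<eta> < 1"
  shows "(\<lambda>t. sqrt (real t) / (real (total m t) - real (total m (dropped \<eta> t))) *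
     (\<Sum>l=1..t. real (m l) / real (total n l))) \<longlonglongrightarrow> 0"
proof (rule Lim_null_comparison)
  let ?W = "\<lambda>t. real (total m t) - real (total m (dropped \<eta> t))"
  have W: "(\<lambda>t. ?W t / real t) \<longlonglongrightarrow> mbar * (1 - \<eta>)"
    by (rule window_average_tendsto(2)[OF m_lim \<eta>(1)])
  have "(\<lambda>t. (1 / (?W t / real t)) * (real B * ((\<Sum>l=1..t. (1 / sqrt (real l)) / sqrt (real l)) / sqrt (real t))))
     \<longlonglongrightarrow> 1 / (mbar * (1 - \<eta>)) * (real B * 0)"
    by (intro tendsto_intros W sqrt_average_null inv_sqrt_tendsto) (use mbar \<eta> in auto)
  then show "(\<lambda>t. (1 / (?W t / real t)) * (real B * ((\<Sum>l=1..t. (1 / sqrt (real l)) / sqrt (real l)) / sqrt (real t))))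
     \<longlonglongrightarrow> 0" by simp
  show "\<forall>\<^sub>F t in sequentially. norm (sqrt (real t) / ?W t * (\<Sum>l=1..t. real (m l) / real (total n l)))
     \<le> (1 / (?W t / real t)) * (real B * ((\<Sum>l=1..t. (1 / sqrt (real l)) / sqrt (real l)) / sqrt (real t)))"
    using eventually_gt_at_top[of 0]
  proof eventually_elim
    case (elim t)
    have "(\<Sum>l=1..t. real (m l) / real (total n l)) \<le> (\<Sum>l=1..t. real B / real l)"
      by (intro sum_mono div_total_le[of n m B] n_pos m_bdd) auto
    also have "\<dots> = real B * (\<Sum>l=1..t. (1 / sqrt (real l)) / sqrt (real l))"
      by (simp add: sum_distrib_left)
    finally have S: "(\<Sum>l=1..t. real (m l) / real (total n l)) \<le> real B * (\<Sum>l=1..t. (1 / sqrt (real l)) / sqrt (real l))" .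
    have W0: "?W t \<ge> 0" using total_mono[OF dropped_le[OF \<eta>], of m t] by simp
    have "norm (sqrt (real t) / ?W t * (\<Sum>l=1..t. real (m l) / real (total n l))) =
       sqrt (real t) / ?W t * (\<Sum>l=1..t. real (m l) / real (total n l))"
      unfolding real_norm_def by (intro abs_of_nonneg mult_nonneg_nonneg sum_nonneg) (use W0 in auto)
    also have "\<dots> \<le> sqrt (real t) / ?W t * (real B * (\<Sum>l=1..t. (1 / sqrt (real l)) / sqrt (real l)))"
      by (intro mult_left_mono S) (use W0 in auto)
    also have "\<dots> = real t / sqrt (real t) / ?W t * (real B * (\<Sum>l=1..t. (1 / sqrt (real l)) / sqrt (real l)))"
      by (simp only: real_div_sqrt of_nat_0_le_iff)
    also have "\<dots> = (1 / (?W t / real t)) * (real B * ((\<Sum>l=1..t. (1 / sqrt (real l)) / sqrt (real l)) / sqrt (real t)))"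
      by (simp only: times_divide_eq_left times_divide_eq_right divide_divide_eq_left divide_divide_eq_right mult_1 mult.commute mult.left_commute)
    finally show ?case .
  qed
qed

text \<open>After division by \<open>t\<close>, the closed form of the sum of squares has three parts.
  Those of \<open>m l * (M l / N l)\<close> and of \<open>m l * (m l / N l)\<close> are averages of
  convergent sequences. The part with the dropped total \<open>M t\<^sub>\<eta>\<close> produces the
  logarithm, and vanishes for \<open>\<eta> = 0\<close>.\<close>

lemma sum_input_weight_square_tendsto:
  fixes m n :: "nat \<Rightarrow> nat"
  assumes m_pos: "\<And>t. t \<ge> 1 \<Longrightarrow> m t \<ge> 1" and m_bdd: "\<And>t. t \<ge> 1 \<Longrightarrow> m t \<le> B"
    and n_pos: "\<And>t. t \<ge> 1 \<Longrightarrow> n t \<ge> 1"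
    and m_lim: "(\<lambda>t. real (total m t) / real t) \<longlonglongrightarrow> mbar" and mbar: "mbar > 0"
    and n_lim: "(\<lambda>t. real (total n t) / real t) \<longlonglongrightarrow> nbar" and nbar: "nbar > 0"
    and \<eta>: "0 \<le> \<eta>" "\<eta> < 1"
  shows "(\<lambda>t. \<Sum>j=1..total n t. (sqrt (real t) / (real (total m t) - real (total m (dropped \<eta> t)))
     * input_weight m n (dropped \<eta> t) t j)\<^sup>2) \<longlonglongrightarrow> lambda_I \<eta> / nbar"
proof -
  let ?M = "\<lambda>t. real (total m t)" and ?N = "\<lambda>t. real (total n t)"
  let ?W = "\<lambda>t. real (total m t) - real (total m (dropped \<eta> t))"
  have W: "(\<lambda>t. ?W t / real t) \<longlonglongrightarrow> mbar * (1 - \<eta>)"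
    by (rule window_average_tendsto(2)[OF m_lim \<eta>(1)])
  have window: "(\<lambda>t. \<Sum>l=dropped \<eta> t + 1..t. real (m l) / real t * y l) \<longlonglongrightarrow> mbar * (1 - \<eta>) * y0"
    if "y \<longlonglongrightarrow> y0" for y y0
  proof (rule toeplitz)
    show "(\<lambda>t. \<Sum>l=dropped \<eta> t + 1..t. real (m l) / real t) \<longlonglongrightarrow> mbar * (1 - \<eta>)"
      using W by (subst sum_divide_distrib[symmetric], subst total_window) (use dropped_le[OF \<eta>] in auto)
    show "(\<lambda>t. real (m l) / real t) \<longlonglongrightarrow> 0" for l
      using tendsto_mult[OF tendsto_const lim_1_over_n, of "real (m l)"] by simp
  qed (use that in auto)
  have MN: "(\<lambda>l. ?M l / ?N l) \<longlonglongrightarrow> mbar / nbar"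
  proof (rule Lim_transform_eventually)
    show "(\<lambda>l. (?M l / real l) / (?N l / real l)) \<longlonglongrightarrow> mbar / nbar"
      by (intro tendsto_divide m_lim n_lim) (use nbar in auto)
    show "\<forall>\<^sub>F l in sequentially. (?M l / real l) / (?N l / real l) = ?M l / ?N l"
      using eventually_gt_at_top[of 0] by eventually_elim auto
  qed
  have 1: "(\<lambda>t. \<Sum>l=dropped \<eta> t + 1..t. real (m l) / real t * (?M l / ?N l)) \<longlonglongrightarrow> mbar * (1 - \<eta>) * (mbar / nbar)"
    by (rule window[OF MN])
  have "(\<lambda>l. real (m l) / ?N l) \<longlonglongrightarrow> 0"
  proof (rule Lim_null_comparison)
    show "(\<lambda>l. real B / real l) \<longlonglongrightarrow> 0"
      using tendsto_mult[OF tendsto_const lim_1_over_n, of "real B"] by simp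
    show "\<forall>\<^sub>F l in sequentially. norm (real (m l) / ?N l) \<le> real B / real l"
      using eventually_ge_at_top[of 1]
      by eventually_elim (use div_total_le[of n m B] n_pos m_bdd in auto)
  qed
  from window[OF this]
  have 2: "(\<lambda>t. \<Sum>l=dropped \<eta> t + 1..t. real (m l) / real t * (real (m l) / ?N l)) \<longlonglongrightarrow> 0" by simp
  have 3: "(\<lambda>t. ?M (dropped \<eta> t) / real t * (\<Sum>l=dropped \<eta> t + 1..t. real (m l) / ?N l))
      \<longlonglongrightarrow> mbar * \<eta> * (- ln \<eta> * (mbar / nbar))"
  proof (cases "\<eta> = 0")
    case True
    then show ?thesis by (simp add: dropped_def)
  next
    case False
    with \<eta> have "\<eta> > 0" by simp
    have "(\<lambda>t. \<Sum>l=dropped \<eta> t + 1..t. (if dropped \<eta> t < l then real (m l) / ?M l else 0) * (?M l / ?N l))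
        \<longlonglongrightarrow> - ln \<eta> * (mbar / nbar)"
    proof (rule toeplitz)
      show "(\<lambda>t. \<Sum>l=dropped \<eta> t + 1..t. if dropped \<eta> t < l then real (m l) / ?M l else 0) \<longlonglongrightarrow> - ln \<eta>"
        using window_log_tendsto[OF m_pos m_bdd m_lim mbar \<open>\<eta> > 0\<close> \<eta>(2)] by simp
      show "(\<lambda>t. if dropped \<eta> t < l then real (m l) / ?M l else 0) \<longlonglongrightarrow> 0" for l
      proof (rule tendsto_eventually)
        show "\<forall>\<^sub>F t in sequentially. (if dropped \<eta> t < l then real (m l) / ?M l else 0) = 0"
          using filterlim_at_top[THEN iffD1, OF dropped_at_top[OF \<open>\<eta> > 0\<close>], rule_format, of l]
          by eventually_elim auto
      qed
    qed (use MN in auto)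
    moreover have "(\<Sum>l=dropped \<eta> t + 1..t. (if dropped \<eta> t < l then real (m l) / ?M l else 0) * (?M l / ?N l))
        = (\<Sum>l=dropped \<eta> t + 1..t. real (m l) / ?N l)" for t
    proof (rule sum.cong[OF refl])
      fix l assume "l \<in> {dropped \<eta> t + 1..t}"
      then show "(if dropped \<eta> t < l then real (m l) / ?M l else 0) * (?M l / ?N l) = real (m l) / ?N l"
        using le_total[of m l, OF m_pos] by auto
    qed
    ultimately have "(\<lambda>t. \<Sum>l=dropped \<eta> t + 1..t. real (m l) / ?N l) \<longlonglongrightarrow> - ln \<eta> * (mbar / nbar)"
      by (simp only:)
    then show ?thesis by (intro tendsto_mult window_average_tendsto(1)[OF m_lim \<eta>(1)])
  qed
  have eq: "(\<Sum>j=1..total n t. (sqrt (real t) / ?W t * input_weight m n (dropped \<eta> t) t j)\<^sup>2) =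
    (1 / (?W t / real t))\<^sup>2 * (2 * (\<Sum>l=dropped \<eta> t + 1..t. real (m l) / real t * (?M l / ?N l))
      - 2 * (?M (dropped \<eta> t) / real t * (\<Sum>l=dropped \<eta> t + 1..t. real (m l) / ?N l))
      - (\<Sum>l=dropped \<eta> t + 1..t. real (m l) / real t * (real (m l) / ?N l)))" for t
  proof (cases "t = 0")
    case False
    have "(\<Sum>j=1..total n t. (sqrt (real t) / ?W t * input_weight m n (dropped \<eta> t) t j)\<^sup>2) =
       real t / (?W t)\<^sup>2 * (\<Sum>j=1..total n t. (input_weight m n (dropped \<eta> t) t j)\<^sup>2)"
      by (simp add: power_mult_distrib power_divide sum_distrib_left)
    also have "\<dots> = real t / (?W t)\<^sup>2 * (\<Sum>l=dropped \<eta> t + 1..t. real (m l) / ?N l * (2 * (?M l - ?M (dropped \<eta> t)) - real (m l)))"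
      by (subst sum_input_weight(2)[OF n_pos dropped_le[OF \<eta>]]) auto
    also have "real t / (?W t)\<^sup>2 = (1 / (?W t / real t))\<^sup>2 * (1 / real t)"
      using False by (simp add: power_divide power2_eq_square)
    also have "(1 / (?W t / real t))\<^sup>2 * (1 / real t) *
        (\<Sum>l=dropped \<eta> t + 1..t. real (m l) / ?N l * (2 * (?M l - ?M (dropped \<eta> t)) - real (m l))) =
      (1 / (?W t / real t))\<^sup>2 * (\<Sum>l=dropped \<eta> t + 1..t. 2 * (real (m l) / real t * (?M l / ?N l))
        - 2 * (?M (dropped \<eta> t) / real t * (real (m l) / ?N l)) - real (m l) / real t * (real (m l) / ?N l))"
      unfolding mult.assoc sum_distrib_left[of "1 / real t"]
      by (intro arg_cong2[where f="(*)"] refl sum.cong) (simp add: algebra_simps diff_divide_distrib)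
    finally show ?thesis by (simp add: sum_subtractf sum_distrib_left)
  qed simp
  have "(\<lambda>t. (1 / (?W t / real t))\<^sup>2 * (2 * (\<Sum>l=dropped \<eta> t + 1..t. real (m l) / real t * (?M l / ?N l))
      - 2 * (?M (dropped \<eta> t) / real t * (\<Sum>l=dropped \<eta> t + 1..t. real (m l) / ?N l))
      - (\<Sum>l=dropped \<eta> t + 1..t. real (m l) / real t * (real (m l) / ?N l))))
    \<longlonglongrightarrow> (1 / (mbar * (1 - \<eta>)))\<^sup>2 * (2 * (mbar * (1 - \<eta>) * (mbar / nbar))
      - 2 * (mbar * \<eta> * (- ln \<eta> * (mbar / nbar))) - 0)"
    by (intro tendsto_intros W 1 2 3) (use mbar \<eta> in auto)
  also have "(1 / (mbar * (1 - \<eta>)))\<^sup>2 * (2 * (mbar * (1 - \<eta>) * (mbar / nbar))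
      - 2 * (mbar * \<eta> * (- ln \<eta> * (mbar / nbar))) - 0) = lambda_I \<eta> / nbar"
  proof -
    have "(1 / (mbar * q))\<^sup>2 * (2 * (mbar * q * (mbar / nbar)) - 2 * (mbar * \<eta> * (- ln \<eta> * (mbar / nbar))) - 0)
      = (2 / q + 2 * \<eta> * ln \<eta> / q\<^sup>2) / nbar" if "q > 0" for q
    proof -
      have "(1 / (mbar * q))\<^sup>2 * (2 * (mbar * q * (mbar / nbar)) - 2 * (mbar * \<eta> * (- ln \<eta> * (mbar / nbar))) - 0)
          = (mbar / mbar)\<^sup>2 * (2 * (q / q\<^sup>2) + 2 * \<eta> * ln \<eta> / q\<^sup>2) / nbar"
        by (simp add: power2_eq_square algebra_simps add_divide_distrib)
      then show ?thesis using that mbar by (simp add: power2_eq_square)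
    qed
    from this[of "1 - \<eta>"] \<eta> show ?thesis by (simp add: lambda_I_def)
  qed
  finally show ?thesis unfolding eq .
qed

lemma lambda_I_nonneg:
  assumes "0 \<le> \<eta>" "\<eta> < 1"
  shows "0 \<le> lambda_I \<eta>"
proof (cases "\<eta> = 0")
  case False
  with assms have \<eta>: "0 < \<eta>" by simp
  have "ln (1 / \<eta>) \<le> 1 / \<eta> - 1" using \<eta> by (intro ln_le_minus_one) auto
  then have "\<eta> * (1 - 1 / \<eta>) \<le> \<eta> * ln \<eta>"
    using \<eta> by (intro mult_left_mono) (auto simp: ln_div)
  then have "0 \<le> 2 * ((1 - \<eta>) + \<eta> * ln \<eta>) / (1 - \<eta>)\<^sup>2"
    using \<eta> by (intro divide_nonneg_nonneg) (auto simp: algebra_simps)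
  also have "\<dots> = lambda_I \<eta>"
  proof -
    have "2 * (q + r) / q\<^sup>2 = 2 / q + 2 * r / q\<^sup>2" if "q > 0" for q r :: real
      using that by (simp add: power2_eq_square field_simps)
    from this[of "1 - \<eta>" "\<eta> * ln \<eta>"] assms(2) show ?thesis by (simp add: lambda_I_def mult.assoc)
  qed
  finally show ?thesis .
qed (simp add: lambda_I_def)

section \<open>Products of characteristic functions near one\<close>

lemma exp_minus_bounds:
  fixes x :: real assumes "0 \<le> x"
  shows "\<bar>exp (- x) - (1 - x)\<bar> \<le> x\<^sup>2"
proof -
  have "1 - x \<le> exp (- x)" using exp_ge_add_one_self[of "- x"] by simp
  moreover have "exp (- x) \<le> 1 / (1 + x)"
    using exp_ge_add_one_self[of x] assms by (simp add: exp_minus inverse_eq_divide frac_le)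
  moreover have "1 / (1 + x) \<le> 1 - x + x\<^sup>2"
  proof -
    have "(1 - x + x\<^sup>2) * (1 + x) = 1 + x ^ 3" by (simp add: algebra_simps power2_eq_square power3_eq_cube)
    moreover have "0 \<le> x ^ 3" using assms by simp
    ultimately show ?thesis using assms by (simp add: divide_le_eq)
  qed
  ultimately show ?thesis by simp
qed

text \<open>Replacing the factors \<open>z i\<close> by \<open>exp (- a i / 2)\<close> one at a time
  costs at most the sum of the differences, since no factor exceeds 1 in modulus. The squares account
  for the second-order difference between \<open>exp (- a i / 2)\<close> and
  \<open>1 - a i / 2\<close>.\<close>

lemma norm_prod_minus_exp_le:
  fixes z :: "'i \<Rightarrow> complex" and a :: "'i \<Rightarrow> real"
  assumes z: "\<And>i. i \<in> I \<Longrightarrow> norm (z i) \<le> 1" and a: "\<And>i. i \<in> I \<Longrightarrow> 0 \<le> a i"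
  shows "norm ((\<Prod>i\<in>I. z i) - of_real (exp (- (\<Sum>i\<in>I. a i) / 2)))
    \<le> (\<Sum>i\<in>I. norm (z i - of_real (1 - a i / 2))) + (\<Sum>i\<in>I. (a i)\<^sup>2)"
proof (cases "finite I")
  case True
  have "of_real (exp (- (\<Sum>i\<in>I. a i) / 2)) = (\<Prod>i\<in>I. complex_of_real (exp (- (a i / 2))))"
    using True by (simp add: exp_sum[symmetric] sum_negf sum_divide_distrib flip: of_real_prod)
  moreover have "norm ((\<Prod>i\<in>I. z i) - (\<Prod>i\<in>I. complex_of_real (exp (- (a i / 2)))))
      \<le> (\<Sum>i\<in>I. norm (z i - complex_of_real (exp (- (a i / 2)))))"
    by (rule norm_prod_diff) (auto simp: z a)
  moreover have "norm (z i - complex_of_real (exp (- (a i / 2)))) \<le> norm (z i - of_real (1 - a i / 2)) + (a i)\<^sup>2"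
    if "i \<in> I" for i
  proof -
    have "norm (z i - complex_of_real (exp (- (a i / 2)))) \<le> norm (z i - of_real (1 - a i / 2))
        + norm (complex_of_real (1 - a i / 2) - complex_of_real (exp (- (a i / 2))))"
      by (rule norm_diff_triangle_ineq[THEN order_trans[rotated]]) simp
    also have "norm (complex_of_real (1 - a i / 2) - complex_of_real (exp (- (a i / 2)))) \<le> (a i / 2)\<^sup>2"
      using exp_minus_bounds[of "a i / 2"] a[OF that]
      by (simp only: of_real_diff[symmetric] norm_of_real) (simp add: abs_minus_commute)
    also have "\<dots> \<le> (a i)\<^sup>2" by (simp add: power_divide)
    finally show ?thesis by simp
  qed
  then have "(\<Sum>i\<in>I. norm (z i - complex_of_real (exp (- (a i / 2)))))
      \<le> (\<Sum>i\<in>I. norm (z i - of_real (1 - a i / 2))) + (\<Sum>i\<in>I. (a i)\<^sup>2)"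
    unfolding sum.distrib[symmetric] by (rule sum_mono)
  ultimately show ?thesis by simp
qed simp

lemma integrable_truncated_cube:
  fixes X :: "'a \<Rightarrow> real"
  assumes "X \<in> borel_measurable M" "integrable M (\<lambda>x. (X x)\<^sup>2)"
  shows "integrable M (\<lambda>x. min (6 * (X x)\<^sup>2) (\<bar>t\<bar> * \<bar>X x\<bar> ^ 3))"
proof (rule Bochner_Integration.integrable_bound)
  show "integrable M (\<lambda>x. 6 * (X x)\<^sup>2)" using assms by simp
  show "AE x in M. norm (min (6 * (X x)\<^sup>2) (\<bar>t\<bar> * \<bar>X x\<bar> ^ 3)) \<le> norm (6 * (X x)\<^sup>2)"
    by (intro AE_I2) (auto simp: min_def)
qed (use assms in measurable)

text \<open>This truncated third moment is the error term in the second-order expansion of a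
  characteristic function; for a fixed square integrable variable it vanishes by dominated
  convergence.\<close>

lemma truncated_cube_tendsto:
  fixes X :: "'a \<Rightarrow> real"
  assumes X: "X \<in> borel_measurable M" "integrable M (\<lambda>x. (X x)\<^sup>2)" and d: "d \<longlonglongrightarrow> 0"
  shows "(\<lambda>t. \<integral>x. min (6 * (X x)\<^sup>2) (\<bar>d t\<bar> * \<bar>X x\<bar> ^ 3) \<partial>M) \<longlonglongrightarrow> 0"
proof -
  have "(\<lambda>t. \<integral>x. min (6 * (X x)\<^sup>2) (\<bar>d t\<bar> * \<bar>X x\<bar> ^ 3) \<partial>M) \<longlonglongrightarrow> (\<integral>x. 0 \<partial>M)"
  proof (rule integral_dominated_convergence)
    show "integrable M (\<lambda>x. 6 * (X x)\<^sup>2)" using X by simp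
    show "AE x in M. (\<lambda>t. min (6 * (X x)\<^sup>2) (\<bar>d t\<bar> * \<bar>X x\<bar> ^ 3)) \<longlonglongrightarrow> 0"
    proof (intro AE_I2)
      fix x
      have "(\<lambda>t. min (6 * (X x)\<^sup>2) (\<bar>d t\<bar> * \<bar>X x\<bar> ^ 3)) \<longlonglongrightarrow> min (6 * (X x)\<^sup>2) (\<bar>0\<bar> * \<bar>X x\<bar> ^ 3)"
        by (intro tendsto_intros d)
      then show "(\<lambda>t. min (6 * (X x)\<^sup>2) (\<bar>d t\<bar> * \<bar>X x\<bar> ^ 3)) \<longlonglongrightarrow> 0" by simp
    qed
    show "AE x in M. norm (min (6 * (X x)\<^sup>2) (\<bar>d t\<bar> * \<bar>X x\<bar> ^ 3)) \<le> 6 * (X x)\<^sup>2" for t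
      by (intro AE_I2) (auto simp: min_def)
  qed (use X in measurable)
  then show ?thesis by simp
qed

text \<open>The central limit theorem for weighted sums of independent copies of one variable with law
  \<open>\<mu>\<close>. Since the weights are uniformly small, the variance is the only property of
  \<open>\<mu>\<close> that survives.\<close>

lemma prod_char_tendsto:
  fixes \<mu> :: "real measure" and c :: "nat \<Rightarrow> 'i \<Rightarrow> real"
  assumes \<mu>: "real_distribution \<mu>"
    and mean: "integrable \<mu> (\<lambda>x. x)" "(\<integral>x. x \<partial>\<mu>) = 0"
    and var: "integrable \<mu> (\<lambda>x. x\<^sup>2)" "(\<integral>x. x\<^sup>2 \<partial>\<mu>) = \<sigma>2"
    and c_le: "\<And>t i. i \<in> I t \<Longrightarrow> \<bar>c t i\<bar> \<le> d t" and d: "d \<longlonglongrightarrow> 0"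
    and c_sq: "(\<lambda>t. \<Sum>i\<in>I t. (c t i)\<^sup>2) \<longlonglongrightarrow> q"
  shows "(\<lambda>t. \<Prod>i\<in>I t. char \<mu> (c t i)) \<longlonglongrightarrow> of_real (exp (- (\<sigma>2 * q) / 2))"
proof -
  interpret real_distribution \<mu> by fact
  define \<rho> where "\<rho> s = (\<integral>x. min (6 * x\<^sup>2) (\<bar>s\<bar> * \<bar>x\<bar> ^ 3) \<partial>\<mu>)" for s
  have \<sigma>2: "0 \<le> \<sigma>2" unfolding var(2)[symmetric] by simp
  have \<rho>_lim: "(\<lambda>t. \<rho> (d t)) \<longlonglongrightarrow> 0"
    unfolding \<rho>_def by (rule truncated_cube_tendsto) (use var d in auto)
  have \<rho>_mono: "\<rho> s \<le> \<rho> r" if "\<bar>s\<bar> \<le> r" for s r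
    unfolding \<rho>_def
  proof (intro integral_mono integrable_truncated_cube)
    fix x show "min (6 * x\<^sup>2) (\<bar>s\<bar> * \<bar>x\<bar> ^ 3) \<le> min (6 * x\<^sup>2) (\<bar>r\<bar> * \<bar>x\<bar> ^ 3)"
      using that by (intro min.mono order_refl mult_right_mono) auto
  qed (use var in auto)
  have \<rho>_nonneg: "0 \<le> \<rho> s" for s unfolding \<rho>_def by (intro Bochner_Integration.integral_nonneg) auto
  have err: "norm (char \<mu> (c t i) - of_real (1 - (c t i)\<^sup>2 * \<sigma>2 / 2)) \<le> (c t i)\<^sup>2 * \<rho> (d t)" if "i \<in> I t" for t i
  proof -
    have "norm (char \<mu> (c t i) - of_real (1 - (c t i)\<^sup>2 * \<sigma>2 / 2)) \<le> ((c t i)\<^sup>2 / 6) * \<rho> (c t i)"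
      using char_approx3[of \<sigma>2 "c t i"] mean var unfolding \<rho>_def by simp
    also have "\<dots> \<le> (c t i)\<^sup>2 * \<rho> (d t)"
      using \<rho>_mono[OF c_le[OF that]] \<rho>_nonneg[of "c t i"] by (intro mult_mono) auto
    finally show ?thesis .
  qed
  have bound: "norm ((\<Prod>i\<in>I t. char \<mu> (c t i)) - of_real (exp (- (\<sigma>2 * (\<Sum>i\<in>I t. (c t i)\<^sup>2)) / 2)))
      \<le> (\<Sum>i\<in>I t. (c t i)\<^sup>2) * \<rho> (d t) + (\<sigma>2\<^sup>2 * (d t)\<^sup>2) * (\<Sum>i\<in>I t. (c t i)\<^sup>2)" for t
  proof -
    have "norm ((\<Prod>i\<in>I t. char \<mu> (c t i)) - of_real (exp (- (\<Sum>i\<in>I t. (c t i)\<^sup>2 * \<sigma>2) / 2)))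
      \<le> (\<Sum>i\<in>I t. norm (char \<mu> (c t i) - of_real (1 - (c t i)\<^sup>2 * \<sigma>2 / 2))) + (\<Sum>i\<in>I t. ((c t i)\<^sup>2 * \<sigma>2)\<^sup>2)"
      by (rule norm_prod_minus_exp_le) (auto simp: cmod_char_le_1 \<sigma>2)
    also have "(\<Sum>i\<in>I t. norm (char \<mu> (c t i) - of_real (1 - (c t i)\<^sup>2 * \<sigma>2 / 2))) \<le> (\<Sum>i\<in>I t. (c t i)\<^sup>2 * \<rho> (d t))"
      by (rule sum_mono) (rule err)
    also have "(\<Sum>i\<in>I t. ((c t i)\<^sup>2 * \<sigma>2)\<^sup>2) \<le> (\<Sum>i\<in>I t. (\<sigma>2\<^sup>2 * (d t)\<^sup>2) * (c t i)\<^sup>2)"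
    proof (rule sum_mono)
      fix i assume "i \<in> I t"
      have "(c t i)\<^sup>2 \<le> (d t)\<^sup>2"
        using c_le[OF \<open>i \<in> I t\<close>] by (intro abs_le_square_iff[THEN iffD1]) auto
      then have "\<sigma>2\<^sup>2 * (c t i)\<^sup>2 * (c t i)\<^sup>2 \<le> \<sigma>2\<^sup>2 * (d t)\<^sup>2 * (c t i)\<^sup>2"
        by (intro mult_mono) auto
      then show "((c t i)\<^sup>2 * \<sigma>2)\<^sup>2 \<le> (\<sigma>2\<^sup>2 * (d t)\<^sup>2) * (c t i)\<^sup>2"
        by (simp add: power2_eq_square algebra_simps)
    qed
    finally show ?thesis by (simp add: sum_distrib_left sum_distrib_right mult.commute)
  qed
  have "(\<lambda>t. (\<Sum>i\<in>I t. (c t i)\<^sup>2) * \<rho> (d t) + (\<sigma>2\<^sup>2 * (d t)\<^sup>2) * (\<Sum>i\<in>I t. (c t i)\<^sup>2)) \<longlonglongrightarrow> q * 0 + (\<sigma>2\<^sup>2 * 0\<^sup>2) * q"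
    by (intro tendsto_intros c_sq \<rho>_lim d)
  then have "(\<lambda>t. (\<Sum>i\<in>I t. (c t i)\<^sup>2) * \<rho> (d t) + (\<sigma>2\<^sup>2 * (d t)\<^sup>2) * (\<Sum>i\<in>I t. (c t i)\<^sup>2)) \<longlonglongrightarrow> 0"
    by simp
  then have "(\<lambda>t. (\<Prod>i\<in>I t. char \<mu> (c t i)) - of_real (exp (- (\<sigma>2 * (\<Sum>i\<in>I t. (c t i)\<^sup>2)) / 2))) \<longlonglongrightarrow> 0"
    by (rule Lim_null_comparison[OF always_eventually, rotated]) (use bound in blast)
  moreover have "(\<lambda>t. complex_of_real (exp (- (\<sigma>2 * (\<Sum>i\<in>I t. (c t i)\<^sup>2)) / 2))) \<longlonglongrightarrow> of_real (exp (- (\<sigma>2 * q) / 2))"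
    by (intro tendsto_intros c_sq) auto
  ultimately show ?thesis using tendsto_add by fastforce
qed

section \<open>A strong law for uncorrelated variables\<close>

lemma (in prob_space) second_moment_sum_uncorrelated:
  fixes x :: "'i \<Rightarrow> 'a \<Rightarrow> real"
  assumes J: "finite J"
    and prod: "\<And>i j. i \<in> J \<Longrightarrow> j \<in> J \<Longrightarrow> integrable M (\<lambda>\<omega>. x i \<omega> * x j \<omega>)"
    and uncorr: "\<And>i j. i \<in> J \<Longrightarrow> j \<in> J \<Longrightarrow> i \<noteq> j \<Longrightarrow> (\<integral>\<omega>. x i \<omega> * x j \<omega> \<partial>M) = 0"
    and sq: "\<And>i. i \<in> J \<Longrightarrow> (\<integral>\<omega>. (x i \<omega>)\<^sup>2 \<partial>M) = v"
  shows "integrable M (\<lambda>\<omega>. (\<Sum>i\<in>J. x i \<omega>)\<^sup>2)" "(\<integral>\<omega>. (\<Sum>i\<in>J. x i \<omega>)\<^sup>2 \<partial>M) = real (card J) * v"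
proof -
  have eq: "(\<Sum>i\<in>J. x i \<omega>)\<^sup>2 = (\<Sum>i\<in>J. \<Sum>j\<in>J. x i \<omega> * x j \<omega>)" for \<omega>
    by (simp add: power2_eq_square sum_product)
  show "integrable M (\<lambda>\<omega>. (\<Sum>i\<in>J. x i \<omega>)\<^sup>2)" unfolding eq using prod by auto
  have "(\<integral>\<omega>. (\<Sum>i\<in>J. x i \<omega>)\<^sup>2 \<partial>M) = (\<Sum>i\<in>J. \<Sum>j\<in>J. \<integral>\<omega>. x i \<omega> * x j \<omega> \<partial>M)"
    unfolding eq using prod by (simp add: Bochner_Integration.integral_sum)
  also have "\<dots> = (\<Sum>i\<in>J. \<Sum>j\<in>J. if i = j then v else 0)"
    using uncorr sq by (intro sum.cong refl) (auto simp: power2_eq_square)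
  also have "\<dots> = real (card J) * v" using J by (simp add: sum.delta)
  finally show "(\<integral>\<omega>. (\<Sum>i\<in>J. x i \<omega>)\<^sup>2 \<partial>M) = real (card J) * v" .
qed

text \<open>By monotone convergence the series of the \<open>V k\<close> is almost surely
  finite.\<close>

lemma (in prob_space) AE_tendsto_0_of_summable_expectation:
  fixes V :: "nat \<Rightarrow> 'a \<Rightarrow> real"
  assumes V: "\<And>k. integrable M (V k)" "\<And>k \<omega>. \<omega> \<in> space M \<Longrightarrow> 0 \<le> V k \<omega>"
    and summable: "summable (\<lambda>k. \<integral>\<omega>. V k \<omega> \<partial>M)"
  shows "AE \<omega> in M. (\<lambda>k. V k \<omega>) \<longlonglongrightarrow> 0"
proof -
  have [measurable]: "V k \<in> borel_measurable M" for k using V(1) by auto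
  have "(\<integral>\<^sup>+\<omega>. (\<Sum>k. ennreal (V k \<omega>)) \<partial>M) = (\<Sum>k. \<integral>\<^sup>+\<omega>. ennreal (V k \<omega>) \<partial>M)"
    by (rule nn_integral_suminf) measurable
  also have "\<dots> = (\<Sum>k. ennreal (\<integral>\<omega>. V k \<omega> \<partial>M))"
    using V by (intro suminf_cong nn_integral_eq_integral AE_I2) auto
  also have "\<dots> = ennreal (\<Sum>k. \<integral>\<omega>. V k \<omega> \<partial>M)"
    using V summable by (intro suminf_ennreal2 integral_nonneg_AE AE_I2) auto
  finally have "(\<integral>\<^sup>+\<omega>. (\<Sum>k. ennreal (V k \<omega>)) \<partial>M) \<noteq> \<infinity>" by simp
  then have "AE \<omega> in M. (\<Sum>k. ennreal (V k \<omega>)) \<noteq> \<infinity>"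
    by (intro nn_integral_PInf_AE) auto
  with AE_space show ?thesis
  proof eventually_elim
    case (elim \<omega>)
    then show ?case using V(2) by (intro summable_LIMSEQ_zero summable_suminf_not_top) auto
  qed
qed

text \<open>The second moments of the averages over the first \<open>k\<^sup>2\<close> variables are
  summable in \<open>k\<close>. The increments of the partial sums between \<open>k\<^sup>2\<close> and
  \<open>(k + 1)\<^sup>2\<close> are so few that even the sum of all their second moments, divided by
  \<open>k\<^sup>4\<close>, is of order \<open>1 / k\<^sup>2\<close>.\<close>

lemma (in prob_space) strong_law_uncorrelated:
  fixes x :: "nat \<Rightarrow> 'a \<Rightarrow> real"
  assumes meas: "\<And>i. i \<ge> 1 \<Longrightarrow> x i \<in> borel_measurable M"
    and prod: "\<And>i j. i \<ge> 1 \<Longrightarrow> j \<ge> 1 \<Longrightarrow> integrable M (\<lambda>\<omega>. x i \<omega> * x j \<omega>)"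
    and uncorr: "\<And>i j. i \<ge> 1 \<Longrightarrow> j \<ge> 1 \<Longrightarrow> i \<noteq> j \<Longrightarrow> (\<integral>\<omega>. x i \<omega> * x j \<omega> \<partial>M) = 0"
    and sq: "\<And>i. i \<ge> 1 \<Longrightarrow> (\<integral>\<omega>. (x i \<omega>)\<^sup>2 \<partial>M) = v"
  shows "AE \<omega> in M. (\<lambda>n. (\<Sum>i=1..n. x i \<omega>) / real n) \<longlonglongrightarrow> 0"
proof -
  define S where "S J \<omega> = (\<Sum>i\<in>J. x i \<omega>)" for J \<omega>
  have S: "integrable M (\<lambda>\<omega>. (S {a+1..b} \<omega>)\<^sup>2)" "(\<integral>\<omega>. (S {a+1..b} \<omega>)\<^sup>2 \<partial>M) = real (b - a) * v" for a b
    using second_moment_sum_uncorrelated[of "{a+1..b}" x v] prod uncorr sq by (auto simp: S_def)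
  have v: "0 \<le> v" unfolding sq[OF order_refl, symmetric] by simp
  \<comment> \<open>This bounds the squared average of every number of variables from \<open>k\<^sup>2\<close> to below \<open>(k + 1)\<^sup>2\<close>, apart from a factor 4.\<close>
  define V where "V k \<omega> = ((S {0+1..k\<^sup>2} \<omega>)\<^sup>2 + (\<Sum>n\<in>{k\<^sup>2..<(k+1)\<^sup>2}. (S {k\<^sup>2+1..n} \<omega>)\<^sup>2)) / real k ^ 4" for k \<omega>
  have int: "integrable M (V k)" for k
    unfolding V_def by (intro integrable_divide Bochner_Integration.integrable_add Bochner_Integration.integrable_sum S)
  have V_le: "(\<integral>\<omega>. V k \<omega> \<partial>M) \<le> 10 * v / real k ^ 2" for k
  proof (cases "k = 0")
    case False
    have "(\<integral>\<omega>. V k \<omega> \<partial>M) = (real (k\<^sup>2) * v + (\<Sum>n\<in>{k\<^sup>2..<(k+1)\<^sup>2}. real (n - k\<^sup>2) * v)) / real k ^ 4"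
      unfolding V_def integral_divide_zero
      by (subst Bochner_Integration.integral_add)
        (auto intro!: Bochner_Integration.integrable_sum S[simplified] simp: Bochner_Integration.integral_sum S[simplified] S(2)[of 0, simplified])
    also have "(\<Sum>n\<in>{k\<^sup>2..<(k+1)\<^sup>2}. real (n - k\<^sup>2) * v) \<le> (\<Sum>n\<in>{k\<^sup>2..<(k+1)\<^sup>2}. (3 * real k) * v)"
    proof (intro sum_mono mult_right_mono v)
      fix n assume "n \<in> {k\<^sup>2..<(k+1)\<^sup>2}"
      then have "n < k\<^sup>2 + (2 * k + 1)" by (simp add: power2_eq_square algebra_simps)
      then have "n - k\<^sup>2 \<le> 3 * k" using False by linarith
      then show "real (n - k\<^sup>2) \<le> 3 * real k" by simp
    qed
    also have "(\<Sum>n\<in>{k\<^sup>2..<(k+1)\<^sup>2}. (3 * real k) * v) = real (2 * k + 1) * (3 * real k) * v"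
      by (simp add: power2_eq_square algebra_simps)
    also have "\<dots> \<le> (3 * real k) * (3 * real k) * v"
      using False v by (intro mult_right_mono) auto
    finally have "(\<integral>\<omega>. V k \<omega> \<partial>M) \<le> (real (k\<^sup>2) * v + (3 * real k) * (3 * real k) * v) / real k ^ 4"
      by (simp add: divide_right_mono)
    also have "\<dots> = 10 * v / real k ^ 2"
      using False by (simp add: field_simps power2_eq_square eval_nat_numeral)
    finally show ?thesis .
  qed (simp add: V_def)
  have "summable (\<lambda>k. 10 * v * (1 / real k ^ 2))"
    by (intro summable_mult) (use inverse_power_summable[of 2, where 'a=real] in \<open>simp add: inverse_eq_divide\<close>)
  then have "summable (\<lambda>k. \<integral>\<omega>. V k \<omega> \<partial>M)"
    by (rule summable_comparison_test'[where N=0]) (use V_le in \<open>auto simp: V_def sum_nonneg\<close>)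
  then have "AE \<omega> in M. (\<lambda>k. V k \<omega>) \<longlonglongrightarrow> 0"
    by (intro AE_tendsto_0_of_summable_expectation int) (auto simp: V_def sum_nonneg)
  then show ?thesis
  proof eventually_elim
    case (elim \<omega>)
    have root: "filterlim floor_sqrt at_top sequentially"
      unfolding filterlim_at_top
    proof
      fix Z
      show "\<forall>\<^sub>F n in sequentially. Z \<le> floor_sqrt n"
        using eventually_ge_at_top[of "Z\<^sup>2"] by eventually_elim (simp add: le_floor_sqrt_iff)
    qed
    have "(\<lambda>k. 2 * sqrt (V k \<omega>)) \<longlonglongrightarrow> 2 * sqrt 0"
      by (intro tendsto_intros elim)
    then have "(\<lambda>n. 2 * sqrt (V (floor_sqrt n) \<omega>)) \<longlonglongrightarrow> 0"
      using filterlim_compose[OF _ root] by simp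
    then show ?case
    proof (rule Lim_null_comparison[rotated])
      show "\<forall>\<^sub>F n in sequentially. norm ((\<Sum>i=1..n. x i \<omega>) / real n) \<le> 2 * sqrt (V (floor_sqrt n) \<omega>)"
        using eventually_ge_at_top[of 1]
      proof eventually_elim
        case (elim n)
        define k where "k = floor_sqrt n"
        have k: "k\<^sup>2 \<le> n" "n < (k+1)\<^sup>2" "1 \<le> k"
          using floor_sqrt_power2_le[of n] Suc_floor_sqrt_power2_gt[of n] elim
          by (auto simp: k_def Suc_le_eq)
        have k2: "real k ^ 2 \<le> real n" using k(1) by (metis of_nat_le_iff of_nat_power)
        have part: "\<bar>y\<bar> / real k ^ 2 \<le> sqrt (V k \<omega>)"
          if "y\<^sup>2 \<le> (S {0+1..k\<^sup>2} \<omega>)\<^sup>2 + (\<Sum>n\<in>{k\<^sup>2..<(k+1)\<^sup>2}. (S {k\<^sup>2+1..n} \<omega>)\<^sup>2)" for y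
        proof (rule real_le_rsqrt)
          have "(\<bar>y\<bar> / real k ^ 2)\<^sup>2 = y\<^sup>2 / real k ^ 4" by (simp add: power_divide)
          also have "\<dots> \<le> V k \<omega>" unfolding V_def by (intro divide_right_mono that) auto
          finally show "(\<bar>y\<bar> / real k ^ 2)\<^sup>2 \<le> V k \<omega>" .
        qed
        have "{1..n} = {0+1..k\<^sup>2} \<union> {k\<^sup>2+1..n}" using k by auto
        then have "(\<Sum>i=1..n. x i \<omega>) = S {0+1..k\<^sup>2} \<omega> + S {k\<^sup>2+1..n} \<omega>"
          unfolding S_def by (simp add: sum.union_disjoint)
        then have "norm ((\<Sum>i=1..n. x i \<omega>) / real n) \<le> (\<bar>S {0+1..k\<^sup>2} \<omega>\<bar> + \<bar>S {k\<^sup>2+1..n} \<omega>\<bar>) / real k ^ 2"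
          using k2 k(3) by (auto intro!: frac_le)
        also have "\<dots> = \<bar>S {0+1..k\<^sup>2} \<omega>\<bar> / real k ^ 2 + \<bar>S {k\<^sup>2+1..n} \<omega>\<bar> / real k ^ 2"
          by (rule add_divide_distrib)
        also have "\<bar>S {0+1..k\<^sup>2} \<omega>\<bar> / real k ^ 2 \<le> sqrt (V k \<omega>)"
          by (rule part) (auto intro: sum_nonneg)
        also have "\<bar>S {k\<^sup>2+1..n} \<omega>\<bar> / real k ^ 2 \<le> sqrt (V k \<omega>)"
        proof (rule part)
          have "(S {k\<^sup>2+1..n} \<omega>)\<^sup>2 \<le> (\<Sum>n\<in>{k\<^sup>2..<(k+1)\<^sup>2}. (S {k\<^sup>2+1..n} \<omega>)\<^sup>2)"
            using k by (intro member_le_sum) auto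
          then show "(S {k\<^sup>2+1..n} \<omega>)\<^sup>2 \<le> (S {0+1..k\<^sup>2} \<omega>)\<^sup>2 + (\<Sum>n\<in>{k\<^sup>2..<(k+1)\<^sup>2}. (S {k\<^sup>2+1..n} \<omega>)\<^sup>2)"
            by (simp add: add_increasing)
        qed
        finally show ?case by (simp add: k_def)
      qed
    qed
  qed
qed

section \<open>Noise drawn under a drifting parameter\<close>

text \<open>A large value is paid for by the part of the square lost to truncation: beyond
  \<open>2 * B\<close> this part is at least three quarters of \<open>x\<^sup>2\<close>. A small value
  is paid for by the small factor \<open>\<tau>\<close>.\<close>

lemma truncated_cube_le:
  fixes x :: real assumes "0 < B"
  shows "min (6 * x\<^sup>2) (\<bar>\<tau>\<bar> * \<bar>x\<bar> ^ 3) \<le> 8 * (x\<^sup>2 - (min \<bar>x\<bar> B)\<^sup>2) + 2 * B * \<bar>\<tau>\<bar> * x\<^sup>2"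
proof (cases "\<bar>x\<bar> \<ge> 2 * B")
  case True
  then have "(2 * B)\<^sup>2 \<le> x\<^sup>2" using assms by (subst abs_le_square_iff[symmetric]) auto
  moreover have "min \<bar>x\<bar> B = B" using True assms by simp
  moreover have "0 \<le> 2 * B * \<bar>\<tau>\<bar> * x\<^sup>2" using assms by simp
  ultimately show ?thesis by (auto simp: power_mult_distrib min_le_iff_disj)
next
  case False
  have "(min \<bar>x\<bar> B)\<^sup>2 \<le> \<bar>x\<bar>\<^sup>2" using assms by (intro power_mono) auto
  moreover have "\<bar>\<tau>\<bar> * \<bar>x\<bar> ^ 3 \<le> 2 * B * \<bar>\<tau>\<bar> * x\<^sup>2"
  proof -
    have "\<bar>\<tau>\<bar> * \<bar>x\<bar> ^ 3 = (\<bar>\<tau>\<bar> * x\<^sup>2) * \<bar>x\<bar>" by (simp add: power3_eq_cube power2_eq_square)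
    also have "\<dots> \<le> (\<bar>\<tau>\<bar> * x\<^sup>2) * (2 * B)" using False by (intro mult_left_mono) auto
    finally show ?thesis by (simp add: mult_ac)
  qed
  ultimately show ?thesis by (simp add: min_le_iff_disj)
qed

lemma truncated_square_lipschitz:
  fixes x y :: real assumes "0 \<le> B"
  shows "\<bar>(min \<bar>x\<bar> B)\<^sup>2 - (min \<bar>y\<bar> B)\<^sup>2\<bar> \<le> 2 * B * \<bar>x - y\<bar>"
proof -
  have "(min \<bar>x\<bar> B)\<^sup>2 - (min \<bar>y\<bar> B)\<^sup>2 = (min \<bar>x\<bar> B + min \<bar>y\<bar> B) * (min \<bar>x\<bar> B - min \<bar>y\<bar> B)"
    by (simp add: power2_eq_square algebra_simps)
  then have "\<bar>(min \<bar>x\<bar> B)\<^sup>2 - (min \<bar>y\<bar> B)\<^sup>2\<bar> = \<bar>min \<bar>x\<bar> B + min \<bar>y\<bar> B\<bar> * \<bar>min \<bar>x\<bar> B - min \<bar>y\<bar> B\<bar>"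
    by (simp add: abs_mult)
  also have "\<dots> \<le> (2 * B) * \<bar>x - y\<bar>" using assms by (intro mult_mono) (auto simp: min_def)
  finally show ?thesis .
qed

text \<open>Truncated squares are bounded continuous functions, so weak convergence carries over to
  their expectations; as the full second moments converge too, the truncated-off parts converge. These
  are small for the limit law, hence uniformly small for large \<open>l\<close>. The centring constants
  \<open>a l\<close> vary with \<open>l\<close>, which the Lipschitz bound for truncated squares
  absorbs.\<close>

lemma uniform_lindeberg:
  fixes P :: "nat \<Rightarrow> 'z measure" and V :: "nat \<Rightarrow> 'z \<Rightarrow> real" and a :: "nat \<Rightarrow> real"
  assumes P: "\<And>l. prob_space (P l)" and V: "\<And>l. V l \<in> borel_measurable (P l)"
    and sq: "\<And>l. integrable (P l) (\<lambda>z. (V l z - a l)\<^sup>2)"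
    and P0: "prob_space P0" "V0 \<in> borel_measurable P0" "integrable P0 (\<lambda>z. (V0 z - a0)\<^sup>2)"
    and weak: "\<And>f::real\<Rightarrow>real. continuous_on UNIV f \<Longrightarrow> bounded (range f) \<Longrightarrow>
      (\<lambda>l. \<integral>z. f (V l z) \<partial>P l) \<longlonglongrightarrow> (\<integral>z. f (V0 z) \<partial>P0)"
    and a: "a \<longlonglongrightarrow> a0"
    and var: "(\<lambda>l. \<integral>z. (V l z - a l)\<^sup>2 \<partial>P l) \<longlonglongrightarrow> (\<integral>z. (V0 z - a0)\<^sup>2 \<partial>P0)"
    and \<epsilon>: "\<epsilon> > 0"
  shows "\<exists>\<tau>0>0. \<exists>L. \<forall>l\<ge>L. \<forall>\<tau>. \<bar>\<tau>\<bar> \<le> \<tau>0 \<longrightarrow>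
    (\<integral>z. min (6 * (V l z - a l)\<^sup>2) (\<bar>\<tau>\<bar> * \<bar>V l z - a l\<bar> ^ 3) \<partial>P l) \<le> \<epsilon>"
proof -
  define s s0 where "s l = (\<integral>z. (V l z - a l)\<^sup>2 \<partial>P l)" and "s0 = (\<integral>z. (V0 z - a0)\<^sup>2 \<partial>P0)" for l
  define T T0 where "T B l = (\<integral>z. (min \<bar>V l z - a l\<bar> B)\<^sup>2 \<partial>P l)" and "T0 B = (\<integral>z. (min \<bar>V0 z - a0\<bar> B)\<^sup>2 \<partial>P0)" for B l
  interpret P0: prob_space P0 by (rule P0)
  note [measurable] = V P0(2)
  have trunc_int: "integrable (P l) (\<lambda>z. (min \<bar>V l z - c\<bar> B)\<^sup>2)" if "0 \<le> B" for l c B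
  proof -
    interpret prob_space "P l" by (rule P)
    show ?thesis
      by (rule integrable_const_bound[of _ "B\<^sup>2"]) (use that in \<open>auto intro!: AE_I2 power_mono\<close>)
  qed
  have T_lim: "T B \<longlonglongrightarrow> T0 B" if B: "0 \<le> B" for B
  proof -
    let ?f = "\<lambda>x. (min \<bar>x - a0\<bar> B)\<^sup>2"
    have "(\<lambda>l. \<integral>z. ?f (V l z) \<partial>P l) \<longlonglongrightarrow> T0 B"
      unfolding T0_def
    proof (rule weak)
      show "continuous_on UNIV ?f" by (intro continuous_intros)
      show "bounded (range ?f)" unfolding bounded_iff
        by (rule exI[of _ "B\<^sup>2"]) (use B in \<open>auto intro!: power_mono\<close>)
    qed
    moreover have "(\<lambda>l. T B l - (\<integral>z. ?f (V l z) \<partial>P l)) \<longlonglongrightarrow> 0"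
    proof (rule Lim_null_comparison[OF always_eventually])
      have "(\<lambda>l. 2 * B * \<bar>a0 - a l\<bar>) \<longlonglongrightarrow> 2 * B * \<bar>a0 - a0\<bar>" by (intro tendsto_intros a)
      then show "(\<lambda>l. 2 * B * \<bar>a0 - a l\<bar>) \<longlonglongrightarrow> 0" by simp
      show "\<forall>l. norm (T B l - (\<integral>z. ?f (V l z) \<partial>P l)) \<le> 2 * B * \<bar>a0 - a l\<bar>"
      proof
        fix l
        interpret prob_space "P l" by (rule P)
        have "norm (T B l - (\<integral>z. ?f (V l z) \<partial>P l)) = norm (\<integral>z. (min \<bar>V l z - a l\<bar> B)\<^sup>2 - ?f (V l z) \<partial>P l)"
          unfolding T_def using trunc_int[OF B] by simp
        also have "\<dots> \<le> (\<integral>z. norm ((min \<bar>V l z - a l\<bar> B)\<^sup>2 - ?f (V l z)) \<partial>P l)"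
          by (rule integral_norm_bound)
        also have "\<dots> \<le> (\<integral>z. 2 * B * \<bar>a0 - a l\<bar> \<partial>P l)"
        proof (rule integral_mono)
          fix z
          show "norm ((min \<bar>V l z - a l\<bar> B)\<^sup>2 - ?f (V l z)) \<le> 2 * B * \<bar>a0 - a l\<bar>"
            using truncated_square_lipschitz[OF B, of "V l z - a l" "V l z - a0"] by simp
        qed (use trunc_int[OF B] in auto)
        finally show "norm (T B l - (\<integral>z. ?f (V l z) \<partial>P l)) \<le> 2 * B * \<bar>a0 - a l\<bar>"
          by (simp add: prob_space)
      qed
    qed
    ultimately show ?thesis using tendsto_add by fastforce
  qed
  have "(\<lambda>k. T0 (real k)) \<longlonglongrightarrow> s0"
    unfolding T0_def s0_def
  proof (rule integral_dominated_convergence[where w="\<lambda>z. (V0 z - a0)\<^sup>2"])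
    show "AE z in P0. (\<lambda>k. (min \<bar>V0 z - a0\<bar> (real k))\<^sup>2) \<longlonglongrightarrow> (V0 z - a0)\<^sup>2"
    proof (intro AE_I2 tendsto_eventually)
      fix z
      obtain K where "\<bar>V0 z - a0\<bar> \<le> real K" using real_arch_simple by blast
      then show "\<forall>\<^sub>F k in sequentially. (min \<bar>V0 z - a0\<bar> (real k))\<^sup>2 = (V0 z - a0)\<^sup>2"
        by (intro eventually_sequentiallyI[of K]) (auto simp: min_def)
    qed
    show "AE z in P0. norm ((min \<bar>V0 z - a0\<bar> (real k))\<^sup>2) \<le> (V0 z - a0)\<^sup>2" for k
    proof (intro AE_I2)
      fix z
      have "(min \<bar>V0 z - a0\<bar> (real k))\<^sup>2 \<le> \<bar>V0 z - a0\<bar>\<^sup>2" by (intro power_mono) auto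
      then show "norm ((min \<bar>V0 z - a0\<bar> (real k))\<^sup>2) \<le> (V0 z - a0)\<^sup>2" by simp
    qed
  qed (use P0(3) in auto)
  then have "\<forall>\<^sub>F k in sequentially. s0 - \<epsilon> / 32 < T0 (real k)"
    by (rule order_tendstoD(1)) (use \<epsilon> in auto)
  from eventually_happens[OF eventually_conj[OF this eventually_ge_at_top[of 1]]]
  obtain k where k: "s0 - \<epsilon> / 32 < T0 (real k)" "k \<ge> 1" by auto
  define B where "B = real k"
  have B: "B > 0" using k(2) by (simp add: B_def)
  have "(\<lambda>l. s l - T B l) \<longlonglongrightarrow> s0 - T0 B"
    using var T_lim[of B] B unfolding s_def s0_def by (intro tendsto_diff) auto
  moreover have "s0 - T0 B < \<epsilon> / 16" using k(1) \<epsilon> by (simp add: B_def)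
  ultimately have ev1: "\<forall>\<^sub>F l in sequentially. s l - T B l < \<epsilon> / 16" by (rule order_tendstoD(2))
  have ev2: "\<forall>\<^sub>F l in sequentially. s l < s0 + 1"
    using var unfolding s_def[symmetric] s0_def[symmetric] by (rule order_tendstoD(2)) simp
  from eventually_conj[OF ev1 ev2] obtain L where L: "\<And>l. l \<ge> L \<Longrightarrow> s l - T B l < \<epsilon> / 16" "\<And>l. l \<ge> L \<Longrightarrow> s l < s0 + 1"
    unfolding eventually_sequentially by blast
  have s0: "0 \<le> s0" unfolding s0_def by simp
  define \<tau>0 where "\<tau>0 = \<epsilon> / (4 * B * (s0 + 1))"
  have \<tau>0: "\<tau>0 > 0" using \<epsilon> B s0 by (simp add: \<tau>0_def)
  show ?thesis
  proof (intro exI[of _ \<tau>0] conjI exI[of _ L] allI impI \<tau>0)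
    fix l \<tau> assume l: "l \<ge> L" and \<tau>: "\<bar>\<tau>\<bar> \<le> \<tau>0"
    interpret prob_space "P l" by (rule P)
    have "(\<integral>z. min (6 * (V l z - a l)\<^sup>2) (\<bar>\<tau>\<bar> * \<bar>V l z - a l\<bar> ^ 3) \<partial>P l) \<le>
       (\<integral>z. 8 * ((V l z - a l)\<^sup>2 - (min \<bar>V l z - a l\<bar> B)\<^sup>2) + 2 * B * \<bar>\<tau>\<bar> * (V l z - a l)\<^sup>2 \<partial>P l)"
      using trunc_int[of B l] B sq
      by (intro integral_mono integrable_truncated_cube truncated_cube_le) auto
    also have "\<dots> = 8 * (s l - T B l) + 2 * B * \<bar>\<tau>\<bar> * s l"
      using trunc_int[of B l] B sq by (simp add: s_def T_def)
    also have "2 * B * \<bar>\<tau>\<bar> * s l \<le> 2 * B * \<tau>0 * (s0 + 1)"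
      using L(2)[OF l] \<tau> B \<tau>0 by (intro mult_mono) (auto simp: s_def)
    also have "2 * B * \<tau>0 * c = \<epsilon> / 2" if "c = s0 + 1" for c
    proof -
      have "c > 0" using that s0 by simp
      then show ?thesis unfolding \<tau>0_def that[symmetric] using B by simp
    qed
    from this[OF refl] have "2 * B * \<tau>0 * (s0 + 1) = \<epsilon> / 2" .
    finally show "(\<integral>z. min (6 * (V l z - a l)\<^sup>2) (\<bar>\<tau>\<bar> * \<bar>V l z - a l\<bar> ^ 3) \<partial>P l) \<le> \<epsilon>"
      using L(1)[OF l] by simp
  qed
qed

definition window_scale :: "(nat \<Rightarrow> nat) \<Rightarrow> real \<Rightarrow> nat \<Rightarrow> real" where
  "window_scale m \<eta> t = sqrt (real t) / (real (total m t) - real (total m (dropped \<eta> t)))"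

lemma window_scale_nonneg:
  assumes "0 \<le> \<eta>" "\<eta> < 1"
  shows "0 \<le> window_scale m \<eta> t"
  using total_mono[OF dropped_le[OF assms], of m t] by (simp add: window_scale_def)

lemma window_scale_tendsto:
  assumes m_lim: "(\<lambda>t. real (total m t) / real t) \<longlonglongrightarrow> mbar" and mbar: "mbar > 0"
    and \<eta>: "0 \<le> \<eta>" "\<eta> < 1"
  shows "(\<lambda>t. window_scale m \<eta> t * sqrt (real t)) \<longlonglongrightarrow> lambda_S \<eta> / mbar"
    and "window_scale m \<eta> \<longlonglongrightarrow> 0"
    and "(\<lambda>t. \<Sum>l=dropped \<eta> t + 1..t. real (m l) * (window_scale m \<eta> t)\<^sup>2) \<longlonglongrightarrow> lambda_S \<eta> / mbar"
proof -
  let ?W = "\<lambda>t. real (total m t) - real (total m (dropped \<eta> t))"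
  have W: "(\<lambda>t. ?W t / real t) \<longlonglongrightarrow> mbar * (1 - \<eta>)"
    by (rule window_average_tendsto(2)[OF m_lim \<eta>(1)])
  have "(\<lambda>t. 1 / (?W t / real t)) \<longlonglongrightarrow> 1 / (mbar * (1 - \<eta>))"
    using mbar \<eta> by (intro tendsto_intros W) auto
  then have W': "(\<lambda>t. real t / ?W t) \<longlonglongrightarrow> lambda_S \<eta> / mbar"
    by (simp add: lambda_S_def mult.commute)
  then show 1: "(\<lambda>t. window_scale m \<eta> t * sqrt (real t)) \<longlonglongrightarrow> lambda_S \<eta> / mbar" by (simp add: window_scale_def)
  have "(\<lambda>t. window_scale m \<eta> t * sqrt (real t) * (1 / sqrt (real t))) \<longlonglongrightarrow> lambda_S \<eta> / mbar * 0"
    by (intro tendsto_mult 1 inv_sqrt_tendsto)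
  moreover have "window_scale m \<eta> t * sqrt (real t) * (1 / sqrt (real t)) = window_scale m \<eta> t" for t
    unfolding mult.assoc by (cases "t = 0") (simp_all, simp add: window_scale_def)
  ultimately show "window_scale m \<eta> \<longlonglongrightarrow> 0" by simp
  have "(\<Sum>l=dropped \<eta> t + 1..t. real (m l) * (window_scale m \<eta> t)\<^sup>2) = real t / ?W t" for t
  proof -
    have "(\<Sum>l=dropped \<eta> t + 1..t. real (m l) * (window_scale m \<eta> t)\<^sup>2) = (\<Sum>l=dropped \<eta> t + 1..t. real (m l)) * (window_scale m \<eta> t)\<^sup>2"
      by (rule sum_distrib_right[symmetric])
    also have "\<dots> = ?W t * (window_scale m \<eta> t)\<^sup>2" by (subst total_window[OF dropped_le[OF \<eta>]]) (rule refl)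
    finally show ?thesis by (simp add: window_scale_def power_divide power2_eq_square)
  qed
  with W' show "(\<lambda>t. \<Sum>l=dropped \<eta> t + 1..t. real (m l) * (window_scale m \<eta> t)\<^sup>2) \<longlonglongrightarrow> lambda_S \<eta> / mbar"
    by simp
qed

text \<open>All retained replications share the scale, so this is a central limit theorem for a
  triangular array. For \<open>\<eta> = 0\<close> the window contains early stages, whose laws may be
  far from the limit. Their number is bounded and their weight vanishes, so it suffices that the
  Lindeberg bound holds from some stage on.\<close>

lemma prod_noise_char_tendsto:
  fixes P :: "nat \<Rightarrow> 'z measure" and Z :: "nat \<Rightarrow> 'z \<Rightarrow> real"
  assumes m_lim: "(\<lambda>t. real (total m t) / real t) \<longlonglongrightarrow> mbar" and mbar: "mbar > 0"
    and \<eta>: "0 \<le> \<eta>" "\<eta> < 1"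
    and P: "\<And>l. prob_space (P l)" and Z: "\<And>l. Z l \<in> borel_measurable (P l)"
    and int: "\<And>l. integrable (P l) (Z l)" and mean: "\<And>l. (\<integral>z. Z l z \<partial>P l) = 0"
    and sq: "\<And>l. integrable (P l) (\<lambda>z. (Z l z)\<^sup>2)"
    and var: "(\<lambda>l. \<integral>z. (Z l z)\<^sup>2 \<partial>P l) \<longlonglongrightarrow> s"
    and lindeberg: "\<And>\<epsilon>. \<epsilon> > 0 \<Longrightarrow> \<exists>\<tau>0>0. \<exists>L. \<forall>l\<ge>L. \<forall>\<tau>. \<bar>\<tau>\<bar> \<le> \<tau>0 \<longrightarrow>
        (\<integral>z. min (6 * (Z l z)\<^sup>2) (\<bar>\<tau>\<bar> * \<bar>Z l z\<bar> ^ 3) \<partial>P l) \<le> \<epsilon>"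
  shows "(\<lambda>t. \<Prod>(l, r)\<in>(SIGMA l:{dropped \<eta> t + 1..t}. {1..m l}). \<integral>z. cis (window_scale m \<eta> t * Z l z) \<partial>P l)
    \<longlonglongrightarrow> of_real (exp (- (lambda_S \<eta> / mbar * s) / 2))"
proof -
  define v where "v l = (\<integral>z. (Z l z)\<^sup>2 \<partial>P l)" for l
  define e where "e l \<tau> = (\<integral>z. min (6 * (Z l z)\<^sup>2) (\<bar>\<tau>\<bar> * \<bar>Z l z\<bar> ^ 3) \<partial>P l)" for l \<tau>
  define \<phi> where "\<phi> l \<tau> = (\<integral>z. cis (\<tau> * Z l z) \<partial>P l)" for l \<tau>
  let ?\<tau> = "window_scale m \<eta>" and ?A = "\<lambda>t. {dropped \<eta> t + 1..t}"
  let ?J = "\<lambda>t. SIGMA l:?A t. {1..m l}"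
  note \<tau>_lim = window_scale_tendsto[OF m_lim mbar \<eta>]
  have v_nonneg: "0 \<le> v l" for l by (simp add: v_def)
  have e_nonneg: "0 \<le> e l \<tau>" for l \<tau>
    unfolding e_def by (intro Bochner_Integration.integral_nonneg) auto
  have e_le: "e l \<tau> \<le> 6 * v l" for l \<tau>
  proof -
    have "e l \<tau> \<le> (\<integral>z. 6 * (Z l z)\<^sup>2 \<partial>P l)"
      unfolding e_def using sq by (intro integral_mono integrable_truncated_cube Z) auto
    then show ?thesis by (simp add: v_def)
  qed
  have \<phi>_err: "norm (\<phi> l \<tau> - of_real (1 - \<tau>\<^sup>2 * v l / 2)) \<le> \<tau>\<^sup>2 * e l \<tau>" for l \<tau>
  proof -
    interpret prob_space "P l" by (rule P)
    have "\<phi> l \<tau> = char (distr (P l) borel (Z l)) \<tau>"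
      unfolding \<phi>_def char_def using Z by (subst integral_distr) (auto simp: cis_conv_exp)
    then have "norm (\<phi> l \<tau> - of_real (1 - \<tau>\<^sup>2 * v l / 2)) \<le> \<tau>\<^sup>2 / 6 * e l \<tau>"
      unfolding e_def using char_approx3'[OF Z int sq mean _ refl, of "v l" \<tau>] mean by (simp add: v_def)
    also have "\<dots> \<le> \<tau>\<^sup>2 * e l \<tau>" using e_nonneg by (intro mult_right_mono) auto
    finally show ?thesis .
  qed
  have \<phi>_le: "norm (\<phi> l \<tau>) \<le> 1" for l \<tau>
  proof -
    interpret prob_space "P l" by (rule P)
    have "norm (\<phi> l \<tau>) \<le> (\<integral>z. norm (cis (\<tau> * Z l z)) \<partial>P l)" unfolding \<phi>_def by (rule integral_norm_bound)
    then show ?thesis by (simp add: prob_space)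
  qed
  have toep: "(\<lambda>t. \<Sum>l\<in>?A t. real (m l) * (?\<tau> t)\<^sup>2 * y l) \<longlonglongrightarrow> lambda_S \<eta> / mbar * y0" if "y \<longlonglongrightarrow> y0" for y y0
  proof (rule toeplitz[OF _ _ _ _ that])
    show "(\<lambda>t. real (m l) * (?\<tau> t)\<^sup>2) \<longlonglongrightarrow> 0" for l
      using tendsto_mult[OF tendsto_const tendsto_power[OF \<tau>_lim(2), of 2], of "real (m l)"] by simp
  qed (use \<tau>_lim(3) in auto)
  have Sv: "(\<lambda>t. \<Sum>l\<in>?A t. real (m l) * (?\<tau> t)\<^sup>2 * v l) \<longlonglongrightarrow> lambda_S \<eta> / mbar * s"
    by (rule toep) (use var in \<open>simp add: v_def\<close>)
  have Sv2: "(\<lambda>t. \<Sum>l\<in>?A t. real (m l) * (?\<tau> t)\<^sup>2 * (v l)\<^sup>2) \<longlonglongrightarrow> lambda_S \<eta> / mbar * s\<^sup>2"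
    by (rule toep) (use var in \<open>auto simp: v_def intro!: tendsto_intros\<close>)
  have Se: "(\<lambda>t. \<Sum>l\<in>?A t. real (m l) * (?\<tau> t)\<^sup>2 * e l (?\<tau> t)) \<longlonglongrightarrow> 0"
  proof (rule tendstoI)
    fix \<epsilon> :: real assume \<epsilon>: "\<epsilon> > 0"
    have c: "lambda_S \<eta> / mbar > 0" using mbar \<eta> by (simp add: lambda_S_def)
    define \<delta> where "\<delta> = \<epsilon> / (2 * (lambda_S \<eta> / mbar))"
    have "c' * (\<epsilon> / (2 * c')) < \<epsilon>" if "c' > 0" for c' using that \<epsilon> by simp
    from this[OF c] have \<delta>2: "lambda_S \<eta> / mbar * \<delta> < \<epsilon>" unfolding \<delta>_def .
    have \<delta>1: "\<delta> > 0" unfolding \<delta>_def by (intro divide_pos_pos \<epsilon> mult_pos_pos c) simp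
    note \<delta> = \<delta>1 \<delta>2
    from lindeberg[OF \<delta>(1)] obtain \<tau>0 L where L: "\<tau>0 > 0" "\<And>l \<tau>. l \<ge> L \<Longrightarrow> \<bar>\<tau>\<bar> \<le> \<tau>0 \<Longrightarrow> e l \<tau> \<le> \<delta>"
      unfolding e_def by blast
    \<comment> \<open>Before stage \<open>L\<close> only the trivial bound by the variance is available.\<close>
    define y where "y l = (if l < L then 6 * v l else \<delta>)" for l
    have "\<forall>\<^sub>F l in sequentially. y l = \<delta>"
      using eventually_ge_at_top[of L] by eventually_elim (simp add: y_def)
    then have "y \<longlonglongrightarrow> \<delta>" by (rule tendsto_eventually)
    from order_tendstoD(2)[OF toep[OF this] \<delta>(2)]
    have "\<forall>\<^sub>F t in sequentially. (\<Sum>l\<in>?A t. real (m l) * (?\<tau> t)\<^sup>2 * y l) < \<epsilon>" .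
    moreover have "\<forall>\<^sub>F t in sequentially. ?\<tau> t < \<tau>0" by (rule order_tendstoD(2)[OF \<tau>_lim(2) L(1)])
    ultimately show "\<forall>\<^sub>F t in sequentially. dist (\<Sum>l\<in>?A t. real (m l) * (?\<tau> t)\<^sup>2 * e l (?\<tau> t)) 0 < \<epsilon>"
    proof eventually_elim
      case (elim t)
      have "(\<Sum>l\<in>?A t. real (m l) * (?\<tau> t)\<^sup>2 * e l (?\<tau> t)) \<le> (\<Sum>l\<in>?A t. real (m l) * (?\<tau> t)\<^sup>2 * y l)"
        using e_le L(2) elim(2) window_scale_nonneg[OF \<eta>, of m t] by (intro sum_mono mult_left_mono) (auto simp: y_def)
      moreover have "0 \<le> (\<Sum>l\<in>?A t. real (m l) * (?\<tau> t)\<^sup>2 * e l (?\<tau> t))"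
        using e_nonneg by (intro sum_nonneg) auto
      ultimately show ?case using elim(1) by simp
    qed
  qed
  have sumJ: "(\<Sum>(l, r)\<in>?J t. f l) = (\<Sum>l\<in>?A t. real (m l) * f l)" for f :: "nat \<Rightarrow> real" and t
    by (subst sum.Sigma[symmetric]) auto
  have bound: "norm ((\<Prod>(l, r)\<in>?J t. \<phi> l (?\<tau> t)) - of_real (exp (- (\<Sum>l\<in>?A t. real (m l) * (?\<tau> t)\<^sup>2 * v l) / 2)))
     \<le> (\<Sum>l\<in>?A t. real (m l) * (?\<tau> t)\<^sup>2 * e l (?\<tau> t)) + (?\<tau> t)\<^sup>2 * (\<Sum>l\<in>?A t. real (m l) * (?\<tau> t)\<^sup>2 * (v l)\<^sup>2)" for t
  proof -
    have "norm ((\<Prod>x\<in>?J t. \<phi> (fst x) (?\<tau> t)) - of_real (exp (- (\<Sum>x\<in>?J t. (?\<tau> t)\<^sup>2 * v (fst x)) / 2)))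
      \<le> (\<Sum>x\<in>?J t. norm (\<phi> (fst x) (?\<tau> t) - of_real (1 - (?\<tau> t)\<^sup>2 * v (fst x) / 2))) + (\<Sum>x\<in>?J t. ((?\<tau> t)\<^sup>2 * v (fst x))\<^sup>2)"
      by (rule norm_prod_minus_exp_le) (auto simp: \<phi>_le v_nonneg)
    also have "(\<Sum>x\<in>?J t. norm (\<phi> (fst x) (?\<tau> t) - of_real (1 - (?\<tau> t)\<^sup>2 * v (fst x) / 2)))
      \<le> (\<Sum>x\<in>?J t. (?\<tau> t)\<^sup>2 * e (fst x) (?\<tau> t))"
      by (rule sum_mono) (rule \<phi>_err)
    finally show ?thesis
      using sumJ[of "\<lambda>l. (?\<tau> t)\<^sup>2 * v l" t] sumJ[of "\<lambda>l. (?\<tau> t)\<^sup>2 * e l (?\<tau> t)" t] sumJ[of "\<lambda>l. ((?\<tau> t)\<^sup>2 * v l)\<^sup>2" t]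
      by (simp add: case_prod_unfold sum_distrib_left power2_eq_square mult_ac)
  qed
  have "(\<lambda>t. (\<Sum>l\<in>?A t. real (m l) * (?\<tau> t)\<^sup>2 * e l (?\<tau> t)) + (?\<tau> t)\<^sup>2 * (\<Sum>l\<in>?A t. real (m l) * (?\<tau> t)\<^sup>2 * (v l)\<^sup>2))
      \<longlonglongrightarrow> 0 + 0\<^sup>2 * (lambda_S \<eta> / mbar * s\<^sup>2)"
    by (intro tendsto_intros Se Sv2 \<tau>_lim(2))
  then have "(\<lambda>t. (\<Prod>(l, r)\<in>?J t. \<phi> l (?\<tau> t)) - of_real (exp (- (\<Sum>l\<in>?A t. real (m l) * (?\<tau> t)\<^sup>2 * v l) / 2))) \<longlonglongrightarrow> 0"
    by (intro Lim_null_comparison[OF always_eventually[OF allI[OF bound]]]) simp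
  moreover have "(\<lambda>t. complex_of_real (exp (- (\<Sum>l\<in>?A t. real (m l) * (?\<tau> t)\<^sup>2 * v l) / 2)))
      \<longlonglongrightarrow> of_real (exp (- (lambda_S \<eta> / mbar * s) / 2))"
    by (intro tendsto_intros Sv) auto
  ultimately have "(\<lambda>t. \<Prod>(l, r)\<in>?J t. \<phi> l (?\<tau> t)) \<longlonglongrightarrow> of_real (exp (- (lambda_S \<eta> / mbar * s) / 2))"
    using tendsto_add by fastforce
  then show ?thesis by (simp add: \<phi>_def)
qed

section \<open>Levy continuity in Euclidean space\<close>

text \<open>Convergence is required for all shifts \<open>u\<close>, and not only for
  \<open>u = 0\<close>, so that the class is closed under multiplication by characters and hence by
  trigonometric polynomials.\<close>

definition fourier_convergent ::
    "(nat \<Rightarrow> 'a::euclidean_space measure) \<Rightarrow> 'a measure \<Rightarrow> ('a \<Rightarrow> complex) \<Rightarrow> bool" where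
  "fourier_convergent \<mu> \<nu> \<phi> \<longleftrightarrow> \<phi> \<in> borel_measurable borel \<and> bounded (range \<phi>) \<and>
     (\<forall>u. (\<lambda>t. \<integral>x. \<phi> x * cis (u \<bullet> x) \<partial>\<mu> t) \<longlonglongrightarrow> (\<integral>x. \<phi> x * cis (u \<bullet> x) \<partial>\<nu>))"

lemma cis_inner_measurable [measurable]: "(\<lambda>x::'a::euclidean_space. cis (u \<bullet> x)) \<in> borel_measurable borel"
  unfolding cis_conv_exp by measurable

lemma bounded_range_mult:
  fixes f g :: "'a \<Rightarrow> complex"
  assumes "bounded (range f)" "bounded (range g)"
  shows "bounded (range (\<lambda>x. f x * g x))"
proof -
  from assms obtain A B where "\<And>x. norm (f x) \<le> A" "\<And>x. norm (g x) \<le> B"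
    by (auto simp: bounded_iff)
  then have "norm (f x * g x) \<le> A * B" for x
    unfolding norm_mult by (intro mult_mono') auto
  then show ?thesis by (auto simp: bounded_iff)
qed

lemma bounded_range_cis: "bounded (range (\<lambda>x. cis (f x)))"
  by (auto simp: bounded_iff intro!: exI[of _ 1])

lemma integrable_bounded:
  fixes f :: "'a \<Rightarrow> 'b::{banach, second_countable_topology}"
  assumes "finite_measure M" "f \<in> borel_measurable M" "bounded (range f)"
  shows "integrable M f"
proof -
  interpret finite_measure M by fact
  from assms(3) obtain B where "\<And>x. norm (f x) \<le> B" by (auto simp: bounded_iff)
  then show ?thesis by (intro integrable_const_bound[of _ B] assms) auto
qed

lemma fourier_convergent_cmult:
  assumes "fourier_convergent \<mu> \<nu> \<phi>"
  shows "fourier_convergent \<mu> \<nu> (\<lambda>x. c * \<phi> x)"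
proof -
  have "bounded (range (\<lambda>x. c * \<phi> x))"
    using assms by (intro bounded_range_mult) (auto simp: fourier_convergent_def image_constant_conv)
  then show ?thesis
    using assms by (auto simp: fourier_convergent_def mult.assoc intro!: tendsto_intros)
qed

lemma fourier_convergent_cis:
  assumes "fourier_convergent \<mu> \<nu> \<phi>"
  shows "fourier_convergent \<mu> \<nu> (\<lambda>x. cis (v \<bullet> x) * \<phi> x)"
proof -
  have [measurable]: "\<phi> \<in> borel_measurable borel" using assms by (simp add: fourier_convergent_def)
  have eq: "cis (v \<bullet> x) * \<phi> x * cis (u \<bullet> x) = \<phi> x * cis ((u + v) \<bullet> x)" for u x
    by (simp add: cis_mult[symmetric] inner_add_left algebra_simps)
  have "(\<lambda>x. cis (v \<bullet> x) * \<phi> x) \<in> borel_measurable borel" by measurable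
  then show ?thesis
    using assms unfolding fourier_convergent_def eq
    by (auto intro!: bounded_range_mult bounded_range_cis)
qed

text \<open>The function \<open>f\<close> of the \<open>L * arcsin (y \<bullet> b)\<close> is continuous
  on the cube of side 2, so it is uniformly close to a polynomial there. Substituting
  \<open>sin (x \<bullet> b / L)\<close> for the coordinates of \<open>y\<close> recovers
  \<open>f\<close> on the box of half-width \<open>L\<close>, where the sine is inverted by the arcsine,
  while the approximation stays bounded everywhere.\<close>

lemma trigonometric_approximation:
  fixes f :: "'b::euclidean_space \<Rightarrow> real"
  assumes f: "continuous_on UNIV f" "\<And>x. \<bar>f x\<bar> \<le> B" and L: "L > 0" and \<epsilon>: "\<epsilon> > 0"
  obtains p where "real_polynomial_function p"
    "\<And>x. (\<And>b. b \<in> Basis \<Longrightarrow> \<bar>x \<bullet> b\<bar> \<le> L) \<Longrightarrow> \<bar>p (\<Sum>b\<in>Basis. sin (x \<bullet> b / L) *\<^sub>R b) - f x\<bar> < \<epsilon>"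
    "\<And>x. \<bar>p (\<Sum>b\<in>Basis. sin (x \<bullet> b / L) *\<^sub>R b)\<bar> \<le> B + \<epsilon>"
proof -
  let ?K = "cbox (- (\<Sum>b\<in>Basis. b)) (\<Sum>b\<in>Basis. b) :: 'b set"
  let ?h = "\<lambda>y::'b. \<Sum>b\<in>Basis. (L * arcsin (y \<bullet> b)) *\<^sub>R b"
  have inK: "y \<in> ?K \<longleftrightarrow> (\<forall>b\<in>Basis. -1 \<le> y \<bullet> b \<and> y \<bullet> b \<le> 1)" for y :: 'b
    by (simp add: mem_box inner_sum_left inner_Basis sum.delta)
  have "continuous_on ?K ?h"
    using inK by (intro continuous_intros) auto
  then have "continuous_on ?K (\<lambda>y. f (?h y))"
    by (rule continuous_on_compose2[OF f(1)]) auto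
  then obtain p where p: "real_polynomial_function p" "\<And>y. y \<in> ?K \<Longrightarrow> \<bar>f (?h y) - p y\<bar> < \<epsilon>"
    using Stone_Weierstrass_real_polynomial_function[of ?K "\<lambda>y. f (?h y)" \<epsilon>] \<epsilon> by auto
  let ?s = "\<lambda>x::'b. \<Sum>b\<in>Basis. sin (x \<bullet> b / L) *\<^sub>R b"
  have coord: "?s x \<bullet> b = sin (x \<bullet> b / L)" if "b \<in> Basis" for x b
    using that by (simp add: inner_sum_left inner_Basis if_distrib sum.delta cong: if_cong)
  have s: "?s x \<in> ?K" for x using coord by (auto simp: inK)
  show thesis
  proof (rule that[OF p(1)])
    fix x :: 'b assume x: "\<And>b. b \<in> Basis \<Longrightarrow> \<bar>x \<bullet> b\<bar> \<le> L"
    have "?h (?s x) = (\<Sum>b\<in>Basis. (x \<bullet> b) *\<^sub>R b)"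
    proof (rule sum.cong[OF refl])
      fix b :: 'b assume b: "b \<in> Basis"
      have "\<bar>x \<bullet> b / L\<bar> \<le> 1" using x[OF b] L by (simp add: field_simps)
      then have "- (pi / 2) \<le> x \<bullet> b / L" "x \<bullet> b / L \<le> pi / 2" using pi_ge_two by linarith+
      then have "arcsin (sin (x \<bullet> b / L)) = x \<bullet> b / L" by (rule arcsin_sin)
      then show "(L * arcsin (?s x \<bullet> b)) *\<^sub>R b = (x \<bullet> b) *\<^sub>R b"
        using L coord[OF b, of x] by simp
    qed
    also have "\<dots> = x" by (rule euclidean_representation)
    finally show "\<bar>p (?s x) - f x\<bar> < \<epsilon>" using p(2)[OF s[of x]] by (simp add: abs_minus_commute)
  next
    fix x :: 'b
    show "\<bar>p (?s x)\<bar> \<le> B + \<epsilon>" using p(2)[OF s[of x]] f(2)[of "?h (?s x)"] by linarith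
  qed
qed

context
  fixes \<mu> :: "nat \<Rightarrow> 'a::euclidean_space measure" and \<nu> :: "'a measure"
  assumes \<mu>: "\<And>t. prob_space (\<mu> t)" "\<And>t. sets (\<mu> t) = sets borel"
    and \<nu>: "prob_space \<nu>" "sets \<nu> = sets borel"
begin

lemma fourier_convergent_integrable:
  assumes "fourier_convergent \<mu> \<nu> \<phi>"
  shows "integrable (\<mu> t) (\<lambda>x. \<phi> x * cis (u \<bullet> x))" "integrable \<nu> (\<lambda>x. \<phi> x * cis (u \<bullet> x))"
proof -
  have [measurable]: "\<phi> \<in> borel_measurable borel" and b: "bounded (range (\<lambda>x. \<phi> x * cis (u \<bullet> x)))"
    using assms by (auto simp: fourier_convergent_def intro!: bounded_range_mult bounded_range_cis)
  have [measurable_cong]: "sets (\<mu> t) = sets borel" "sets \<nu> = sets borel" for t using \<mu> \<nu> by auto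
  show "integrable (\<mu> t) (\<lambda>x. \<phi> x * cis (u \<bullet> x))"
    by (intro integrable_bounded prob_space.finite_measure[OF \<mu>(1)] b) measurable
  show "integrable \<nu> (\<lambda>x. \<phi> x * cis (u \<bullet> x))"
    by (intro integrable_bounded prob_space.finite_measure[OF \<nu>(1)] b) measurable
qed

lemma fourier_convergent_add:
  assumes "fourier_convergent \<mu> \<nu> \<phi>" "fourier_convergent \<mu> \<nu> \<psi>"
  shows "fourier_convergent \<mu> \<nu> (\<lambda>x. \<phi> x + \<psi> x)"
  using assms fourier_convergent_integrable[OF assms(1)] fourier_convergent_integrable[OF assms(2)]
  by (auto simp: fourier_convergent_def distrib_right intro!: tendsto_intros bounded_plus_comp)

lemma fourier_convergent_sum:
  assumes "finite I" "\<And>i. i \<in> I \<Longrightarrow> fourier_convergent \<mu> \<nu> (\<phi> i)"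
  shows "fourier_convergent \<mu> \<nu> (\<lambda>x. \<Sum>i\<in>I. \<phi> i x)"
  using assms
proof (induction I rule: finite_induct)
  case empty
  then show ?case by (simp add: fourier_convergent_def image_constant_conv)
next
  case (insert i I)
  then show ?case by (simp add: fourier_convergent_add)
qed

text \<open>A sine is a difference of two characters. Since the claim quantifies over all
  \<open>\<phi>\<close>, a product of polynomials is handled by applying the induction hypotheses in
  turn.\<close>

lemma fourier_convergent_polynomial_sin:
  assumes "real_polynomial_function p" "fourier_convergent \<mu> \<nu> \<phi>"
  shows "fourier_convergent \<mu> \<nu> (\<lambda>x. of_real (p (\<Sum>b\<in>Basis. sin (x \<bullet> b / L) *\<^sub>R b)) * \<phi> x)"
  using assms
proof (induction p arbitrary: \<phi> rule: real_polynomial_function.induct)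
  case (linear f)
  have sin: "complex_of_real (sin y) = (cis y - cis (- y)) / (2 * \<i>)" for y
    by (simp add: complex_eq_iff Re_divide Im_divide power2_eq_square)
  have eq: "of_real (f (\<Sum>b\<in>Basis. sin (x \<bullet> b / L) *\<^sub>R b)) * \<phi> x =
      (\<Sum>b\<in>Basis. (of_real (f b) / (2 * \<i>)) * (cis ((b /\<^sub>R L) \<bullet> x) * \<phi> x)
        + (- of_real (f b) / (2 * \<i>)) * (cis ((- b /\<^sub>R L) \<bullet> x) * \<phi> x))" for x
  proof -
    have "f (\<Sum>b\<in>Basis. sin (x \<bullet> b / L) *\<^sub>R b) = (\<Sum>b\<in>Basis. sin (x \<bullet> b / L) * f b)"
      using linear(1) by (simp add: bounded_linear.linear linear_sum linear_cmul)
    then show ?thesis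
      by (simp add: sin sum_distrib_right) (auto simp: field_simps inner_commute intro!: sum.cong)
  qed
  show ?case unfolding eq
    by (intro fourier_convergent_sum fourier_convergent_add fourier_convergent_cmult fourier_convergent_cis linear) auto
next
  case (const c)
  then show ?case by (rule fourier_convergent_cmult)
next
  case (add p q)
  from fourier_convergent_add[OF add.IH(1)[OF add.prems] add.IH(2)[OF add.prems]]
  show ?case by (simp add: distrib_right)
next
  case (mult p q)
  from mult.IH(1)[OF mult.IH(2)[OF mult.prems]] show ?case by (simp add: mult.assoc)
qed

text \<open>The one-dimensional continuity theorem applies to the marginals along \<open>b\<close>, and
  gives convergence of the expectation of a continuous function that lies between the indicators of
  \<open>{y. \<bar>y\<bar> > k + 1}\<close> and \<open>{y. \<bar>y\<bar> > k}\<close>.\<close>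

lemma tight_coordinate:
  assumes char: "\<And>u. (\<lambda>t. \<integral>x. cis (u \<bullet> x) \<partial>\<mu> t) \<longlonglongrightarrow> (\<integral>x. cis (u \<bullet> x) \<partial>\<nu>)" and \<epsilon>: "\<epsilon> > 0"
  obtains L where "L > 0" "\<forall>\<^sub>F t in sequentially. measure (\<mu> t) {x. \<bar>x \<bullet> b\<bar> > L} < \<epsilon>"
    "measure \<nu> {x. \<bar>x \<bullet> b\<bar> > L} < \<epsilon>"
proof -
  have [measurable_cong]: "sets (\<mu> t) = sets borel" "sets \<nu> = sets borel" for t using \<mu> \<nu> by auto
  have rd: "real_distribution (distr (\<mu> t) borel (\<lambda>x. x \<bullet> b))" for t
    using prob_space.real_distribution_distr[OF \<mu>(1), of "\<lambda>x. x \<bullet> b" t] by simp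
  have rd': "real_distribution (distr \<nu> borel (\<lambda>x. x \<bullet> b))"
    using prob_space.real_distribution_distr[OF \<nu>(1), of "\<lambda>x. x \<bullet> b"] by simp
  interpret \<nu>: prob_space \<nu> by (rule \<nu>(1))
  have "weak_conv_m (\<lambda>t. distr (\<mu> t) borel (\<lambda>x. x \<bullet> b)) (distr \<nu> borel (\<lambda>x. x \<bullet> b))"
  proof (rule levy_continuity[OF rd rd'])
    fix s :: real
    show "(\<lambda>t. char (distr (\<mu> t) borel (\<lambda>x. x \<bullet> b)) s) \<longlonglongrightarrow> char (distr \<nu> borel (\<lambda>x. x \<bullet> b)) s"
      using char[of "s *\<^sub>R b"] by (simp add: char_def integral_distr cis_conv_exp inner_commute)
  qed
  note wc = this
  have lim: "(\<lambda>t. \<integral>x. f (x \<bullet> b) \<partial>\<mu> t) \<longlonglongrightarrow> (\<integral>x. f (x \<bullet> b) \<partial>\<nu>)"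
    if "\<And>y. isCont f y" "\<And>y. \<bar>f y\<bar> \<le> 1" "f \<in> borel_measurable borel" for f :: "real \<Rightarrow> real"
    using weak_conv_imp_integral_bdd_continuous_conv[OF rd rd' wc, of f 1] that by (simp add: integral_distr)
  define g where "g k y = min 1 (max 0 (\<bar>y\<bar> - real k))" for k and y :: real
  have g: "isCont (g k) y" "\<bar>g k y\<bar> \<le> 1" "g k \<in> borel_measurable borel" for k y
    unfolding g_def by (auto intro!: continuous_intros)
  have "(\<lambda>k. \<integral>x. g k (x \<bullet> b) \<partial>\<nu>) \<longlonglongrightarrow> (\<integral>x. 0 \<partial>\<nu>)"
  proof (rule integral_dominated_convergence)
    show "integrable \<nu> (\<lambda>x. 1::real)" by simp
    show "AE x in \<nu>. (\<lambda>k. g k (x \<bullet> b)) \<longlonglongrightarrow> 0"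
    proof (intro AE_I2 tendsto_eventually)
      fix x
      obtain K where "\<bar>x \<bullet> b\<bar> \<le> real K" using real_arch_simple by blast
      then show "\<forall>\<^sub>F k in sequentially. g k (x \<bullet> b) = 0"
        by (intro eventually_sequentiallyI[of K]) (auto simp: g_def)
    qed
    show "AE x in \<nu>. norm (g k (x \<bullet> b)) \<le> 1" for k using g(2) by auto
  qed (use g(3) in measurable)
  then have "\<forall>\<^sub>F k in sequentially. (\<integral>x. g k (x \<bullet> b) \<partial>\<nu>) < \<epsilon>"
    using \<epsilon> by (intro order_tendstoD(2)) auto
  then obtain k where k: "(\<integral>x. g k (x \<bullet> b) \<partial>\<nu>) < \<epsilon>" by (auto simp: eventually_sequentially)
  have markov: "measure P {x. \<bar>x \<bullet> b\<bar> > real (k + 1)} \<le> (\<integral>x. g k (x \<bullet> b) \<partial>P)"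
    if P: "prob_space P" "sets P = sets borel" for P :: "'a measure"
  proof -
    interpret P: prob_space P by fact
    have [measurable_cong]: "sets P = sets borel" by fact
    have sp: "space P = UNIV" using sets_eq_imp_space_eq[OF P(2)] by simp
    have "measure P {x. \<bar>x \<bullet> b\<bar> > real (k + 1)} = (\<integral>x. indicator {x. \<bar>x \<bullet> b\<bar> > real (k + 1)} x \<partial>P)"
      by (simp add: sp)
    also have "\<dots> \<le> (\<integral>x. g k (x \<bullet> b) \<partial>P)"
    proof (intro integral_mono)
      show "integrable P (\<lambda>x. g k (x \<bullet> b))"
        using g(2,3) by (intro P.integrable_const_bound[of _ 1]) auto
      show "integrable P (indicator {x. \<bar>x \<bullet> b\<bar> > real (k + 1)} :: 'a \<Rightarrow> real)"
        by (intro P.integrable_const_bound[of _ 1]) auto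
    qed (auto simp: g_def indicator_def)
    finally show ?thesis .
  qed
  show thesis
  proof (rule that[of "real (k + 1)"])
    have "\<forall>\<^sub>F t in sequentially. (\<integral>x. g k (x \<bullet> b) \<partial>\<mu> t) < \<epsilon>"
      using k by (intro order_tendstoD(2)[OF lim] g)
    then show "\<forall>\<^sub>F t in sequentially. measure (\<mu> t) {x. \<bar>x \<bullet> b\<bar> > real (k + 1)} < \<epsilon>"
      by eventually_elim (rule le_less_trans[OF markov[OF \<mu>]])
    show "measure \<nu> {x. \<bar>x \<bullet> b\<bar> > real (k + 1)} < \<epsilon>"
      using markov[OF \<nu>] k by simp
  qed simp
qed

lemma tight_box:
  assumes char: "\<And>u. (\<lambda>t. \<integral>x. cis (u \<bullet> x) \<partial>\<mu> t) \<longlonglongrightarrow> (\<integral>x. cis (u \<bullet> x) \<partial>\<nu>)" and \<epsilon>: "\<epsilon> > 0"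
  obtains L where "L > 0" "\<forall>\<^sub>F t in sequentially. measure (\<mu> t) {x. \<exists>b\<in>Basis. \<bar>x \<bullet> b\<bar> > L} < \<epsilon>"
    "measure \<nu> {x. \<exists>b\<in>Basis. \<bar>x \<bullet> b\<bar> > L} < \<epsilon>"
proof -
  define \<delta> where "\<delta> = \<epsilon> / DIM('a)"
  have "\<delta> > 0" using \<epsilon> by (simp add: \<delta>_def)
  then have "\<exists>L. L > 0 \<and> (\<forall>\<^sub>F t in sequentially. measure (\<mu> t) {x. \<bar>x \<bullet> b\<bar> > L} < \<delta>) \<and> measure \<nu> {x. \<bar>x \<bullet> b\<bar> > L} < \<delta>" for b
    using tight_coordinate[OF char] by metis
  then obtain L where L: "\<And>b. L b > 0" "\<And>b. \<forall>\<^sub>F t in sequentially. measure (\<mu> t) {x. \<bar>x \<bullet> b\<bar> > L b} < \<delta>"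
      "\<And>b. measure \<nu> {x. \<bar>x \<bullet> b\<bar> > L b} < \<delta>" by metis
  define L0 where "L0 = Max (L ` Basis)"
  have L0: "L b \<le> L0" if "b \<in> Basis" for b unfolding L0_def using that by (intro Max_ge) auto
  have box: "measure P {x. \<exists>b\<in>Basis. \<bar>x \<bullet> b\<bar> > L0} < \<epsilon>"
    if P: "prob_space P" "sets P = sets borel" and le: "\<And>b. b \<in> Basis \<Longrightarrow> measure P {x. \<bar>x \<bullet> b\<bar> > L b} < \<delta>"
    for P :: "'a measure"
  proof -
    interpret P: prob_space P by fact
    have [measurable_cong]: "sets P = sets borel" by fact
    have sets: "{x. \<bar>x \<bullet> b\<bar> > c} \<in> sets P" for b c unfolding P(2) by measurable
    have "measure P {x. \<exists>b\<in>Basis. \<bar>x \<bullet> b\<bar> > L0} \<le> measure P (\<Union>b\<in>Basis. {x. \<bar>x \<bullet> b\<bar> > L b})"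
      using L0 sets by (intro P.finite_measure_mono) (fastforce, auto)
    also have "\<dots> \<le> (\<Sum>b\<in>Basis. measure P {x. \<bar>x \<bullet> b\<bar> > L b})"
      by (rule P.finite_measure_subadditive_finite) (use sets in auto)
    also have "\<dots> < (\<Sum>b\<in>(Basis::'a set). \<delta>)"
      by (rule sum_strict_mono) (use le in auto)
    also have "\<dots> = \<epsilon>" by (simp add: \<delta>_def)
    finally show ?thesis .
  qed
  obtain b0 :: 'a where "b0 \<in> Basis" using nonempty_Basis by blast
  show thesis
  proof (rule that[of L0])
    show "L0 > 0" using L(1)[of b0] L0[OF \<open>b0 \<in> Basis\<close>] by simp
    have "\<forall>\<^sub>F t in sequentially. \<forall>b\<in>Basis. measure (\<mu> t) {x. \<bar>x \<bullet> b\<bar> > L b} < \<delta>"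
      using L(2) by (intro eventually_ball_finite) auto
    then show "\<forall>\<^sub>F t in sequentially. measure (\<mu> t) {x. \<exists>b\<in>Basis. \<bar>x \<bullet> b\<bar> > L0} < \<epsilon>"
      by eventually_elim (rule box[OF \<mu>], auto)
    show "measure \<nu> {x. \<exists>b\<in>Basis. \<bar>x \<bullet> b\<bar> > L0} < \<epsilon>" by (rule box[OF \<nu>]) (use L in auto)
  qed
qed

text \<open>A bounded continuous function is replaced by a bounded trigonometric polynomial that is
  close to it on a large box; tightness makes the complement of the box negligible.\<close>

theorem levy_continuity_euclidean:
  assumes char: "\<And>u. (\<lambda>t. \<integral>x. cis (u \<bullet> x) \<partial>\<mu> t) \<longlonglongrightarrow> (\<integral>x. cis (u \<bullet> x) \<partial>\<nu>)"
  shows "converges_in_law \<mu> \<nu> sequentially"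
  unfolding converges_in_law_def
proof (intro allI impI)
  fix f :: "'a \<Rightarrow> real" assume f: "continuous_on UNIV f \<and> bounded (range f)"
  then obtain B0 where "\<And>x. \<bar>f x\<bar> \<le> B0" by (auto simp: bounded_iff)
  note B0 = this
  define B where "B = \<bar>B0\<bar>"
  have B: "\<bar>f x\<bar> \<le> B" "B \<ge> 0" for x
    using B0[of x] by (auto simp: B_def)
  have fm: "f \<in> borel_measurable borel" using f by (intro borel_measurable_continuous_onI) auto
  show "(\<lambda>t. \<integral>x. f x \<partial>\<mu> t) \<longlonglongrightarrow> (\<integral>x. f x \<partial>\<nu>)"
  proof (rule tendstoI)
    fix \<epsilon> :: real assume \<epsilon>: "\<epsilon> > 0"
    \<comment> \<open>Three errors of size \<open>\<delta>\<close>, and two boxes missed with probability \<open>\<delta>\<close> each.\<close>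
    define \<delta> where "\<delta> = min 1 (\<epsilon> / (3 + 2 * (2 * B + 1)))"
    have \<delta>: "\<delta> > 0" using \<epsilon> B by (simp add: \<delta>_def add_pos_nonneg)
    have "\<delta> \<le> \<epsilon> / (3 + 2 * (2 * B + 1))" by (simp add: \<delta>_def)
    then have \<delta>\<epsilon>: "(3 + 2 * (2 * B + 1)) * \<delta> \<le> \<epsilon>" using B by (simp add: field_simps)
    have \<delta>1: "\<delta> \<le> 1" by (simp add: \<delta>_def)
    obtain L where L: "L > 0" "\<forall>\<^sub>F t in sequentially. measure (\<mu> t) {x. \<exists>b\<in>Basis. \<bar>x \<bullet> b\<bar> > L} < \<delta>"
        "measure \<nu> {x. \<exists>b\<in>Basis. \<bar>x \<bullet> b\<bar> > L} < \<delta>"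
      by (rule tight_box[OF char \<delta>])
    obtain p where p: "real_polynomial_function p"
      "\<And>x. (\<And>b. b \<in> Basis \<Longrightarrow> \<bar>x \<bullet> b\<bar> \<le> L) \<Longrightarrow> \<bar>p (\<Sum>b\<in>Basis. sin (x \<bullet> b / L) *\<^sub>R b) - f x\<bar> < \<delta>"
      "\<And>x. \<bar>p (\<Sum>b\<in>Basis. sin (x \<bullet> b / L) *\<^sub>R b)\<bar> \<le> B + \<delta>"
      by (rule trigonometric_approximation[of f B L \<delta>]) (use f B L(1) \<delta> in auto)
    define q where "q x = p (\<Sum>b\<in>Basis. sin (x \<bullet> b / L) *\<^sub>R b)" for x
    have "continuous_on UNIV q" unfolding q_def
      by (intro continuous_on_compose2[OF continuous_on_polymonial_function[OF p(1)[unfolded real_polynomial_function_eq]]] continuous_intros) (use L(1) in auto)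
    then have qm: "q \<in> borel_measurable borel" by (rule borel_measurable_continuous_onI)
    have "fourier_convergent \<mu> \<nu> (\<lambda>x. of_real (q x) * 1)"
      unfolding q_def
      by (rule fourier_convergent_polynomial_sin[OF p(1)])
        (simp add: fourier_convergent_def char image_constant_conv)
    from this[unfolded fourier_convergent_def, THEN conjunct2, THEN conjunct2, rule_format, of 0]
    have "(\<lambda>t. complex_of_real (\<integral>x. q x \<partial>\<mu> t)) \<longlonglongrightarrow> complex_of_real (\<integral>x. q x \<partial>\<nu>)"
      by simp
    then have "(\<lambda>t. \<integral>x. q x \<partial>\<mu> t) \<longlonglongrightarrow> (\<integral>x. q x \<partial>\<nu>)"
      by (simp only: tendsto_of_real_iff)
    then have "\<forall>\<^sub>F t in sequentially. dist (\<integral>x. q x \<partial>\<mu> t) (\<integral>x. q x \<partial>\<nu>) < \<delta>"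
      by (rule tendstoD) (rule \<delta>)
    have close: "\<bar>(\<integral>x. q x \<partial>P) - (\<integral>x. f x \<partial>P)\<bar> \<le> \<delta> + (2 * B + 1) * \<delta>"
      if P: "prob_space P" "sets P = sets borel" and out: "measure P {x. \<exists>b\<in>Basis. \<bar>x \<bullet> b\<bar> > L} < \<delta>"
      for P :: "'a measure"
    proof -
      interpret P: prob_space P by fact
      have [measurable_cong]: "sets P = sets borel" by fact
      have sp: "space P = UNIV" using sets_eq_imp_space_eq[OF P(2)] by simp
      note [measurable] = fm qm
      let ?O = "{x. \<exists>b\<in>Basis. \<bar>x \<bullet> b\<bar> > L}"
      have [measurable]: "?O \<in> sets borel" by measurable
      have intf: "integrable P f" by (rule P.integrable_const_bound[of _ B]) (use B in auto)
      have iq: "integrable P q" by (rule P.integrable_const_bound[of _ "B + \<delta>"]) (use p(3) in \<open>auto simp: q_def\<close>)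
      have io: "integrable P (\<lambda>x. indicator ?O x :: real)" by (rule P.integrable_const_bound[of _ 1]) auto
      have "\<bar>(\<integral>x. q x \<partial>P) - (\<integral>x. f x \<partial>P)\<bar> = \<bar>\<integral>x. q x - f x \<partial>P\<bar>" using intf iq by simp
      also have "\<dots> \<le> (\<integral>x. \<bar>q x - f x\<bar> \<partial>P)" using integral_norm_bound[of P "\<lambda>x. q x - f x"] by simp
      also have "\<dots> \<le> (\<integral>x. \<delta> + (2 * B + 1) * indicator ?O x \<partial>P)"
      proof (rule integral_mono)
        fix x
        show "\<bar>q x - f x\<bar> \<le> \<delta> + (2 * B + 1) * indicator ?O x"
        proof (cases "x \<in> ?O")
          case True
          then show ?thesis using p(3)[of x] B(1)[of x] \<delta> \<delta>1 by (simp add: q_def)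
        next
          case False
          then have "\<And>b. b \<in> Basis \<Longrightarrow> \<bar>x \<bullet> b\<bar> \<le> L" by (auto simp: not_less)
          from p(2)[OF this] False show ?thesis by (simp add: q_def)
        qed
      qed (use intf iq io in auto)
      also have "\<dots> = \<delta> + (2 * B + 1) * measure P ?O"
        using io P.prob_space by (simp add: sp)
      also have "\<dots> \<le> \<delta> + (2 * B + 1) * \<delta>"
        using out B by (intro add_left_mono mult_left_mono) auto
      finally show ?thesis .
    qed
    from L(2) \<open>\<forall>\<^sub>F t in sequentially. dist (\<integral>x. q x \<partial>\<mu> t) (\<integral>x. q x \<partial>\<nu>) < \<delta>\<close>
    show "\<forall>\<^sub>F t in sequentially. dist (\<integral>x. f x \<partial>\<mu> t) (\<integral>x. f x \<partial>\<nu>) < \<epsilon>"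
    proof eventually_elim
      case (elim t)
      have "\<delta> + (2 * B + 1) * \<delta> + \<delta> + (\<delta> + (2 * B + 1) * \<delta>) = (3 + 2 * (2 * B + 1)) * \<delta>"
        by (simp add: algebra_simps)
      then show ?case
        using close[OF \<mu> elim(1)] close[OF \<nu> L(3)] elim(2) \<delta>\<epsilon> unfolding dist_real_def by linarith
    qed
  qed
qed

end

section \<open>Existence of the multivariate normal law\<close>

lemma matrix_quadratic_form:
  fixes C :: "real^'n^'n"
  shows "u \<bullet> (C *v u) = (\<Sum>a\<in>UNIV. \<Sum>a'\<in>UNIV. u $ a * u $ a' * C $ a $ a')"
  by (simp add: inner_vec_def matrix_vector_mult_def sum_distrib_left mult_ac)

text \<open>Completing the square in one coordinate \<open>p\<close> with \<open>C $ p $ p > 0\<close>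
  splits off one square and leaves a positive semidefinite form, the Schur complement, that does not
  involve this coordinate. If \<open>C $ p $ p = 0\<close>, semidefiniteness forces the whole row to
  vanish.\<close>

lemma quadratic_form_eq_sum_squares_aux:
  fixes C :: "real^'n^'n"
  assumes "finite S" "transpose C = C" "\<And>u. 0 \<le> u \<bullet> (C *v u)" "\<And>a b. a \<notin> S \<Longrightarrow> C $ a $ b = 0"
  shows "\<exists>w :: 'n \<Rightarrow> real^'n. \<forall>u. u \<bullet> (C *v u) = (\<Sum>p\<in>S. (w p \<bullet> u)\<^sup>2)"
  using assms
proof (induction S arbitrary: C rule: finite_induct)
  case empty
  then have "C = 0" by (simp add: vec_eq_iff)
  then show ?case by simp
next
  case (insert p S)
  note sym = insert.prems(1) and psd = insert.prems(2) and supp = insert.prems(3)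
  let ?e = "axis p 1 :: real^'n"
  define c where "c = C *v ?e"
  have symm: "C $ a $ b = C $ b $ a" for a b using sym by (metis transpose_def vec_lambda_beta)
  have swap: "x \<bullet> (C *v y) = y \<bullet> (C *v x)" for x y
    by (metis dot_lmul_matrix inner_commute sym transpose_matrix_vector)
  have c: "c $ a = C $ p $ a" for a
    using symm by (simp add: c_def matrix_vector_mult_def axis_def if_distrib sum.delta cong: if_cong)
  have shift: "(u - t *\<^sub>R ?e) \<bullet> (C *v (u - t *\<^sub>R ?e)) = u \<bullet> (C *v u) - 2 * t * (c \<bullet> u) + t\<^sup>2 * C $ p $ p" for u t
    using swap[of ?e u] c[of p]
    by (simp add: matrix_vector_mult_diff_distrib matrix_vector_mult_scaleR inner_diff_left inner_diff_right
        inner_axis' c_def[symmetric] power2_eq_square inner_commute[of u c] algebra_simps)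
  show ?case
  proof (cases "C $ p $ p = 0")
    case True
    have "c \<bullet> u = 0" for u
    proof (rule ccontr)
      assume ne: "c \<bullet> u \<noteq> 0"
      \<comment> \<open>The form is affine in \<open>t\<close> along this line, so a non-zero slope would make it negative, here \<open>-1\<close>.\<close>
      define t where "t = (u \<bullet> (C *v u) + 1) / (2 * (c \<bullet> u))"
      have "0 \<le> u \<bullet> (C *v u) - 2 * t * (c \<bullet> u)" using psd[of "u - t *\<^sub>R ?e"] shift[of u t] True by simp
      moreover have "2 * t * (c \<bullet> u) = u \<bullet> (C *v u) + 1" using ne by (simp add: t_def)
      ultimately show False by simp
    qed
    then have "c = 0" by (metis inner_eq_zero_iff)
    then have "C $ p $ b = 0" for b using c[of b] by simp
    then have "C $ a $ b = 0" if "a \<notin> S" for a b using supp that by (cases "a = p") auto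
    from insert.IH[OF sym psd this] obtain w :: "'n \<Rightarrow> real^'n" where w: "\<forall>u. u \<bullet> (C *v u) = (\<Sum>p\<in>S. (w p \<bullet> u)\<^sup>2)"
      by blast
    have "\<forall>u. u \<bullet> (C *v u) = (\<Sum>q\<in>insert p S. ((w(p := 0)) q \<bullet> u)\<^sup>2)"
      using w insert.hyps by (auto intro!: sum.cong)
    then show ?thesis by blast
  next
    case False
    have "?e \<bullet> (C *v ?e) = C $ p $ p" using c[of p] by (simp add: inner_axis' c_def[symmetric])
    then have pos: "C $ p $ p > 0" using psd[of ?e] False by simp
    define C' where "C' = (\<chi> a b. C $ a $ b - c $ a * c $ b / C $ p $ p)"
    have C': "u \<bullet> (C' *v u) = u \<bullet> (C *v u) - (c \<bullet> u)\<^sup>2 / C $ p $ p" for u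
      by (simp add: C'_def inner_vec_def matrix_vector_mult_def power2_eq_square left_diff_distrib right_diff_distrib
          sum_subtractf sum_product sum_divide_distrib sum_distrib_left mult_ac)
    have sym': "transpose C' = C'" using symm by (simp add: C'_def transpose_def vec_eq_iff mult.commute)
    have psd': "0 \<le> u \<bullet> (C' *v u)" for u
    proof -
      have "0 \<le> u \<bullet> (C *v u) - 2 * ((c \<bullet> u) / C $ p $ p) * (c \<bullet> u) + ((c \<bullet> u) / C $ p $ p)\<^sup>2 * C $ p $ p"
        using psd[of "u - ((c \<bullet> u) / C $ p $ p) *\<^sub>R ?e"] unfolding shift .
      also have "\<dots> = u \<bullet> (C' *v u)" using pos by (simp add: C' power2_eq_square field_simps)
      finally show ?thesis .
    qed
    have "C' $ a $ b = 0" if "a \<notin> S" for a b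
    proof (cases "a = p")
      case True
      then show ?thesis using pos by (simp add: C'_def c)
    next
      case False
      then show ?thesis using that supp[of a] symm[of p a] by (simp add: C'_def c)
    qed
    from insert.IH[OF sym' psd' this] obtain w :: "'n \<Rightarrow> real^'n" where w: "\<forall>u. u \<bullet> (C' *v u) = (\<Sum>p\<in>S. (w p \<bullet> u)\<^sup>2)"
      by blast
    have "u \<bullet> (C *v u) = (\<Sum>q\<in>insert p S. ((w(p := c /\<^sub>R sqrt (C $ p $ p))) q \<bullet> u)\<^sup>2)" for u
    proof -
      have "(\<Sum>q\<in>insert p S. ((w(p := c /\<^sub>R sqrt (C $ p $ p))) q \<bullet> u)\<^sup>2) =
          ((c /\<^sub>R sqrt (C $ p $ p)) \<bullet> u)\<^sup>2 + (\<Sum>q\<in>S. (w q \<bullet> u)\<^sup>2)"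
        using insert.hyps by (auto intro!: sum.cong)
      also have "((c /\<^sub>R sqrt (C $ p $ p)) \<bullet> u)\<^sup>2 = (c \<bullet> u)\<^sup>2 / C $ p $ p"
        using pos by (simp add: power_mult_distrib field_simps)
      also have "(\<Sum>q\<in>S. (w q \<bullet> u)\<^sup>2) = u \<bullet> (C *v u) - (c \<bullet> u)\<^sup>2 / C $ p $ p"
        using w by (simp add: C'[symmetric])
      finally show ?thesis by simp
    qed
    then show ?thesis by blast
  qed
qed

lemma quadratic_form_eq_sum_squares:
  fixes C :: "real^'n^'n"
  assumes "transpose C = C" "\<And>u. 0 \<le> u \<bullet> (C *v u)"
  obtains w :: "'n \<Rightarrow> real^'n" where "\<And>u. u \<bullet> (C *v u) = (\<Sum>p\<in>UNIV. (w p \<bullet> u)\<^sup>2)"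
  using quadratic_form_eq_sum_squares_aux[OF finite[of UNIV] assms] by auto

lemma
  assumes v: "0 \<le> v"
  shows real_distribution_normal_law: "real_distribution (normal_law 0 v)"
    and char_normal_law: "char (normal_law 0 v) s = of_real (exp (- (v * s\<^sup>2) / 2))"
proof -
  interpret N: real_distribution std_normal_distribution by (rule real_dist_normal_dist)
  have eq: "normal_law 0 v = distr std_normal_distribution borel (\<lambda>x. sqrt v * x)"
  proof (cases "v = 0")
    case True
    then show ?thesis by (simp add: normal_law_def)
  next
    case False
    have "distributed std_normal_distribution lborel (\<lambda>x. x) std_normal_density"
      by (auto simp: distributed_def distr_id2)
    from N.normal_density_affine[OF this, of "sqrt v" 0]
    have "distributed std_normal_distribution lborel (\<lambda>x. sqrt v * x) (normal_density 0 (sqrt v))"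
      using v False by simp
    then have "distr std_normal_distribution lborel (\<lambda>x. sqrt v * x) = density lborel (normal_density 0 (sqrt v))"
      by (rule distributed_distr_eq_density)
    moreover have "distr std_normal_distribution lborel (\<lambda>x. sqrt v * x) = distr std_normal_distribution borel (\<lambda>x. sqrt v * x)"
      by (rule distr_cong) auto
    ultimately show ?thesis using False by (simp add: normal_law_def)
  qed
  show "real_distribution (normal_law 0 v)"
    unfolding eq by (intro N.real_distribution_distr) simp
  have "char (normal_law 0 v) s = char std_normal_distribution (s * sqrt v)"
    unfolding eq char_def by (subst integral_distr) (auto simp: mult.assoc)
  then show "char (normal_law 0 v) s = of_real (exp (- (v * s\<^sup>2) / 2))"
    using v by (simp add: char_std_normal_distribution power_mult_distrib mult.commute)
qed

text \<open>If the form is \<open>\<Sum>p. (w p \<bullet> u)\<^sup>2\<close>, the law of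
  \<open>\<Sum>p. z p *\<^sub>R w p\<close> for independent standard normal \<open>z p\<close> has the
  required linear forms.\<close>

lemma multivariate_normal_exists:
  fixes C :: "real^'n^'n"
  assumes sym: "transpose C = C" and psd: "\<And>u. 0 \<le> u \<bullet> (C *v u)"
  obtains \<nu> where "is_multivariate_normal 0 C \<nu>"
    "\<And>u. (\<integral>x. cis (u \<bullet> x) \<partial>\<nu>) = of_real (exp (- (u \<bullet> (C *v u)) / 2))"
proof -
  obtain w :: "'n \<Rightarrow> real^'n" where w: "\<And>u. u \<bullet> (C *v u) = (\<Sum>p\<in>UNIV. (w p \<bullet> u)\<^sup>2)"
    using quadratic_form_eq_sum_squares[OF sym psd] by blast
  interpret N: real_distribution std_normal_distribution by (rule real_dist_normal_dist)
  interpret P: product_sigma_finite "\<lambda>_::'n. std_normal_distribution" ..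
  define P where "P = PiM (UNIV :: 'n set) (\<lambda>_. std_normal_distribution)"
  interpret PP: prob_space P unfolding P_def by (rule prob_space_PiM) (rule N.prob_space_axioms)
  define \<nu> where "\<nu> = distr P borel (\<lambda>z. \<Sum>p\<in>UNIV. z p *\<^sub>R w p)"
  have comp [measurable]: "(\<lambda>z. z p) \<in> borel_measurable P" for p
    using measurable_component_singleton[of p UNIV "\<lambda>_. std_normal_distribution"] by (simp add: P_def measurable_def)
  have T [measurable]: "(\<lambda>z. \<Sum>p\<in>UNIV. z p *\<^sub>R w p) \<in> borel_measurable P" by measurable
  interpret \<nu>: prob_space \<nu> unfolding \<nu>_def by (rule PP.prob_space_distr) (rule T)
  have sets: "sets \<nu> = sets borel" by (simp add: \<nu>_def)
  have char: "(\<integral>x. cis (u \<bullet> x) \<partial>\<nu>) = of_real (exp (- (u \<bullet> (C *v u)) / 2))" for u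
  proof -
    have "(\<integral>x. cis (u \<bullet> x) \<partial>\<nu>) = (\<integral>z. (\<Prod>p\<in>UNIV. iexp ((w p \<bullet> u) * z p)) \<partial>P)"
      unfolding \<nu>_def
      by (subst integral_distr)
        (auto simp: cis_conv_exp inner_sum_right exp_sum[symmetric] sum_distrib_left inner_commute mult.commute
          intro!: Bochner_Integration.integral_cong)
    also have "\<dots> = (\<Prod>p\<in>UNIV. \<integral>z. iexp ((w p \<bullet> u) * z) \<partial>std_normal_distribution)"
      unfolding P_def by (rule P.product_integral_prod) (auto intro!: N.integrable_iexp)
    also have "\<dots> = (\<Prod>p\<in>UNIV. of_real (exp (- (w p \<bullet> u)\<^sup>2 / 2)))"
      using char_std_normal_distribution by (simp add: char_def fun_eq_iff)
    also have "\<dots> = of_real (exp (\<Sum>p\<in>UNIV. - (w p \<bullet> u)\<^sup>2 / 2))"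
      by (simp add: exp_sum flip: of_real_prod)
    also have "(\<Sum>p\<in>UNIV. - (w p \<bullet> u)\<^sup>2 / 2) = - (u \<bullet> (C *v u)) / 2"
      by (simp add: w sum_negf sum_divide_distrib)
    finally show ?thesis .
  qed
  have law: "distr \<nu> borel (\<lambda>x. u \<bullet> x) = normal_law (u \<bullet> 0) (u \<bullet> (C *v u))" for u
  proof -
    have [measurable_cong]: "sets \<nu> = sets borel" by (rule sets)
    have "char (distr \<nu> borel (\<lambda>x. u \<bullet> x)) s = char (normal_law 0 (u \<bullet> (C *v u))) s" for s
    proof -
      have "char (distr \<nu> borel (\<lambda>x. u \<bullet> x)) s = (\<integral>x. cis ((s *\<^sub>R u) \<bullet> x) \<partial>\<nu>)"
        unfolding char_def by (subst integral_distr) (auto simp: cis_conv_exp)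
      also have "\<dots> = of_real (exp (- (u \<bullet> (C *v u) * s\<^sup>2) / 2))"
        unfolding char by (simp add: matrix_vector_mult_scaleR power2_eq_square mult_ac)
      finally show ?thesis by (simp add: char_normal_law[OF psd])
    qed
    then show ?thesis
      by (simp add: Levy_uniqueness[OF \<nu>.real_distribution_distr real_distribution_normal_law[OF psd]] fun_eq_iff)
  qed
  show thesis
    by (rule that[OF _ char])
      (use sym psd law sets \<nu>.prob_space_axioms in \<open>auto simp: is_multivariate_normal_def\<close>)
qed

section \<open>Expectations under conditional independence\<close>

text \<open>By linearity the identity passes from indicators to simple functions, and by dominated
  convergence to bounded \<open>h\<close>. Measurability of the integral in \<open>\<omega>\<close>
  comes out of the same approximation.\<close>

lemma (in prob_space) expectation_kernel_step:
  fixes G G' :: "'a \<Rightarrow> complex" and h :: "'b \<Rightarrow> complex" and \<kappa> :: "'a \<Rightarrow> 'b measure"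
  assumes Z [measurable]: "Z \<in> measurable M N"
    and \<kappa>: "\<And>\<omega>. \<omega> \<in> space M \<Longrightarrow> prob_space (\<kappa> \<omega>)" "\<And>\<omega>. \<omega> \<in> space M \<Longrightarrow> sets (\<kappa> \<omega>) = sets N"
    and \<kappa>_meas: "\<And>A. A \<in> sets N \<Longrightarrow> (\<lambda>\<omega>. measure (\<kappa> \<omega>) A) \<in> borel_measurable M"
    and G [measurable]: "G \<in> borel_measurable M" "\<And>\<omega>. \<omega> \<in> space M \<Longrightarrow> norm (G \<omega>) \<le> 1"
    and G' [measurable]: "G' \<in> borel_measurable M" "\<And>\<omega>. \<omega> \<in> space M \<Longrightarrow> norm (G' \<omega>) \<le> 1"
    and eq: "\<And>A. A \<in> sets N \<Longrightarrow> (\<integral>\<omega>. G \<omega> * indicator A (Z \<omega>) \<partial>M) = (\<integral>\<omega>. G' \<omega> * of_real (measure (\<kappa> \<omega>) A) \<partial>M)"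
    and h [measurable]: "h \<in> borel_measurable N" "\<And>y. y \<in> space N \<Longrightarrow> norm (h y) \<le> 1"
  shows "(\<lambda>\<omega>. \<integral>y. h y \<partial>\<kappa> \<omega>) \<in> borel_measurable M"
    and "(\<integral>\<omega>. G \<omega> * h (Z \<omega>) \<partial>M) = (\<integral>\<omega>. G' \<omega> * (\<integral>y. h y \<partial>\<kappa> \<omega>) \<partial>M)"
proof -
  obtain F where F: "\<And>i. simple_function N (F i)" "\<And>y. y \<in> space N \<Longrightarrow> (\<lambda>i. F i y) \<longlonglongrightarrow> h y"
    "\<And>i y. y \<in> space N \<Longrightarrow> dist (F i y) 0 \<le> 2 * dist (h y) 0"
    using borel_measurable_implies_sequence_metric[OF h(1), of 0] by blast
  have F_meas [measurable]: "F i \<in> borel_measurable N" for i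
    using F(1) by (rule borel_measurable_simple_function)
  have F_bound: "norm (F i y) \<le> 2" if "y \<in> space N" for i y
    using F(3)[OF that, of i] h(2)[OF that] by simp
  have sp: "space (\<kappa> \<omega>) = space N" if "\<omega> \<in> space M" for \<omega>
    using sets_eq_imp_space_eq[OF \<kappa>(2)[OF that]] .
  define A where "A i z = F i -` {z} \<inter> space N" for i z
  have A [measurable]: "A i z \<in> sets N" for i z
    unfolding A_def using F(1)[of i] by (rule simple_functionD(2))
  have fin: "finite (F i ` space N)" for i using F(1)[of i] by (rule simple_functionD(1))
  have rep: "F i y = (\<Sum>z\<in>F i ` space N. z * indicator (A i z) y)" if "y \<in> space N" for i y
  proof -
    have "F i y = (\<Sum>z\<in>F i ` space N. indicator (F i -` {z} \<inter> space N) y *\<^sub>R z)"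
      by (rule simple_function_indicator_representation_banach[OF F(1) that])
    also have "\<dots> = (\<Sum>z\<in>F i ` space N. z * indicator (A i z) y)"
      by (rule sum.cong) (auto simp: A_def indicator_def)
    finally show ?thesis .
  qed
  have \<kappa>F: "(\<integral>y. F i y \<partial>\<kappa> \<omega>) = (\<Sum>z\<in>F i ` space N. z * of_real (measure (\<kappa> \<omega>) (A i z)))" if \<omega>: "\<omega> \<in> space M" for i \<omega>
  proof -
    interpret K: prob_space "\<kappa> \<omega>" by (rule \<kappa>(1)[OF \<omega>])
    have int: "integrable (\<kappa> \<omega>) (indicator (A i z) :: 'b \<Rightarrow> complex)" for z
      using A[of i z] by (intro K.integrable_const_bound[of _ 1] borel_measurable_indicator) (auto simp: \<kappa>(2)[OF \<omega>] indicator_def)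
    have "(\<integral>y. F i y \<partial>\<kappa> \<omega>) = (\<integral>y. (\<Sum>z\<in>F i ` space N. z * indicator (A i z) y) \<partial>\<kappa> \<omega>)"
      by (rule Bochner_Integration.integral_cong) (auto simp: sp[OF \<omega>] intro: rep)
    also have "\<dots> = (\<Sum>z\<in>F i ` space N. z * (\<integral>y. indicator (A i z) y \<partial>\<kappa> \<omega>))"
      using int by (subst Bochner_Integration.integral_sum) auto
    also have "\<dots> = (\<Sum>z\<in>F i ` space N. z * of_real (measure (\<kappa> \<omega>) (A i z)))"
    proof (intro sum.cong refl arg_cong2[where f="(*)"])
      fix z
      have "A i z \<inter> space (\<kappa> \<omega>) = A i z" by (auto simp: sp[OF \<omega>] A_def)
      moreover have "(\<integral>y. indicator (A i z) y \<partial>\<kappa> \<omega>) = (\<integral>y. complex_of_real (indicator (A i z) y) \<partial>\<kappa> \<omega>)"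
        by (intro Bochner_Integration.integral_cong refl) (simp add: indicator_def)
      ultimately show "(\<integral>y. indicator (A i z) y \<partial>\<kappa> \<omega>) = complex_of_real (measure (\<kappa> \<omega>) (A i z))"
        by simp
    qed
    finally show ?thesis .
  qed
  have \<kappa>F_meas [measurable]: "(\<lambda>\<omega>. \<integral>y. F i y \<partial>\<kappa> \<omega>) \<in> borel_measurable M" for i
  proof -
    note [measurable] = \<kappa>_meas[OF A]
    have "(\<lambda>\<omega>. \<Sum>z\<in>F i ` space N. z * complex_of_real (measure (\<kappa> \<omega>) (A i z))) \<in> borel_measurable M"
      by measurable
    then show ?thesis by (subst measurable_cong[OF \<kappa>F])
  qed
  have \<kappa>_lim: "(\<lambda>i. \<integral>y. F i y \<partial>\<kappa> \<omega>) \<longlonglongrightarrow> (\<integral>y. h y \<partial>\<kappa> \<omega>)" if \<omega>: "\<omega> \<in> space M" for \<omega>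
  proof -
    interpret K: prob_space "\<kappa> \<omega>" by (rule \<kappa>(1)[OF \<omega>])
    have [measurable_cong]: "sets (\<kappa> \<omega>) = sets N" by (rule \<kappa>(2)[OF \<omega>])
    show ?thesis
      by (rule integral_dominated_convergence[where w="\<lambda>_. 2"])
        (auto simp: sp[OF \<omega>] F(2) F_bound intro!: AE_I2)
  qed
  show meas: "(\<lambda>\<omega>. \<integral>y. h y \<partial>\<kappa> \<omega>) \<in> borel_measurable M"
    by (rule borel_measurable_LIMSEQ_metric[OF \<kappa>F_meas \<kappa>_lim])
  have \<kappa>F_bound: "norm (\<integral>y. F i y \<partial>\<kappa> \<omega>) \<le> 2" if \<omega>: "\<omega> \<in> space M" for i \<omega>
  proof -
    interpret K: prob_space "\<kappa> \<omega>" by (rule \<kappa>(1)[OF \<omega>])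
    have [measurable_cong]: "sets (\<kappa> \<omega>) = sets N" by (rule \<kappa>(2)[OF \<omega>])
    have "norm (\<integral>y. F i y \<partial>\<kappa> \<omega>) \<le> (\<integral>y. norm (F i y) \<partial>\<kappa> \<omega>)" by (rule integral_norm_bound)
    also have "\<dots> \<le> (\<integral>y. 2 \<partial>\<kappa> \<omega>)"
      by (intro integral_mono K.integrable_const_bound[of _ 2]) (auto simp: sp[OF \<omega>] F_bound intro!: AE_I2)
    finally show ?thesis by (simp add: K.prob_space)
  qed
  have ZN: "Z \<omega> \<in> space N" if "\<omega> \<in> space M" for \<omega> using measurable_space[OF Z that] .
  have step: "(\<integral>\<omega>. G \<omega> * F i (Z \<omega>) \<partial>M) = (\<integral>\<omega>. G' \<omega> * (\<integral>y. F i y \<partial>\<kappa> \<omega>) \<partial>M)" for i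
  proof -
    have i1: "integrable M (\<lambda>\<omega>. z * (G \<omega> * indicator (A i z) (Z \<omega>)))" for z
      by (intro integrable_mult_right integrable_const_bound[of _ 1])
        (auto intro!: AE_I2 simp: norm_mult G(2) indicator_def)
    have i2: "integrable M (\<lambda>\<omega>. z * (G' \<omega> * of_real (measure (\<kappa> \<omega>) (A i z))))" for z
    proof (intro integrable_mult_right integrable_const_bound[of _ 1] AE_I2)
      fix \<omega> assume \<omega>: "\<omega> \<in> space M"
      interpret K: prob_space "\<kappa> \<omega>" by (rule \<kappa>(1)[OF \<omega>])
      show "norm (G' \<omega> * of_real (measure (\<kappa> \<omega>) (A i z))) \<le> 1"
        unfolding norm_mult using G'(2)[OF \<omega>] by (intro mult_le_one) auto
    qed (use \<kappa>_meas[OF A[of i z]] in measurable)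
    have "(\<integral>\<omega>. G \<omega> * F i (Z \<omega>) \<partial>M) = (\<integral>\<omega>. (\<Sum>z\<in>F i ` space N. z * (G \<omega> * indicator (A i z) (Z \<omega>))) \<partial>M)"
      by (rule Bochner_Integration.integral_cong[OF refl])
        (subst rep, auto simp: ZN sum_distrib_left mult_ac)
    also have "\<dots> = (\<Sum>z\<in>F i ` space N. z * (\<integral>\<omega>. G \<omega> * indicator (A i z) (Z \<omega>) \<partial>M))"
      using i1 by (subst Bochner_Integration.integral_sum) auto
    also have "\<dots> = (\<Sum>z\<in>F i ` space N. z * (\<integral>\<omega>. G' \<omega> * of_real (measure (\<kappa> \<omega>) (A i z)) \<partial>M))"
      by (simp add: eq[OF A])
    also have "\<dots> = (\<integral>\<omega>. (\<Sum>z\<in>F i ` space N. z * (G' \<omega> * of_real (measure (\<kappa> \<omega>) (A i z)))) \<partial>M)"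
      using i2 by (subst Bochner_Integration.integral_sum) auto
    also have "\<dots> = (\<integral>\<omega>. G' \<omega> * (\<integral>y. F i y \<partial>\<kappa> \<omega>) \<partial>M)"
      by (rule Bochner_Integration.integral_cong[OF refl]) (simp add: \<kappa>F sum_distrib_left mult_ac)
    finally show ?thesis .
  qed
  have l1: "(\<lambda>i. \<integral>\<omega>. G \<omega> * F i (Z \<omega>) \<partial>M) \<longlonglongrightarrow> (\<integral>\<omega>. G \<omega> * h (Z \<omega>) \<partial>M)"
  proof (rule integral_dominated_convergence[where w="\<lambda>_. 2"])
    show "AE \<omega> in M. norm (G \<omega> * F i (Z \<omega>)) \<le> 2" for i
    proof (intro AE_I2)
      fix \<omega> assume \<omega>: "\<omega> \<in> space M"
      show "norm (G \<omega> * F i (Z \<omega>)) \<le> 2"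
        using mult_mono[OF G(2)[OF \<omega>] F_bound[OF ZN[OF \<omega>], of i]] by (simp add: norm_mult)
    qed
  qed (auto intro!: AE_I2 tendsto_intros F(2) ZN)
  have l2: "(\<lambda>i. \<integral>\<omega>. G' \<omega> * (\<integral>y. F i y \<partial>\<kappa> \<omega>) \<partial>M) \<longlonglongrightarrow> (\<integral>\<omega>. G' \<omega> * (\<integral>y. h y \<partial>\<kappa> \<omega>) \<partial>M)"
  proof (rule integral_dominated_convergence[where w="\<lambda>_. 2"])
    show "AE \<omega> in M. norm (G' \<omega> * (\<integral>y. F i y \<partial>\<kappa> \<omega>)) \<le> 2" for i
    proof (intro AE_I2)
      fix \<omega> assume \<omega>: "\<omega> \<in> space M"
      show "norm (G' \<omega> * (\<integral>y. F i y \<partial>\<kappa> \<omega>)) \<le> 2"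
        using mult_mono[OF G'(2)[OF \<omega>] \<kappa>F_bound[OF \<omega>, of i]] by (simp add: norm_mult)
    qed
  qed (use meas in \<open>auto intro!: AE_I2 tendsto_intros \<kappa>_lim\<close>)
  show "(\<integral>\<omega>. G \<omega> * h (Z \<omega>) \<partial>M) = (\<integral>\<omega>. G' \<omega> * (\<integral>y. h y \<partial>\<kappa> \<omega>) \<partial>M)"
    using l1 l2 unfolding step by (rule LIMSEQ_unique)
qed

text \<open>The hypothesis concerns events. Indicators are exchanged for the functions
  \<open>h j\<close> one index at a time, keeping the remaining factors as weights.\<close>

lemma (in prob_space) expectation_conditionally_independent:
  fixes Z :: "'i \<Rightarrow> 'a \<Rightarrow> 'b" and \<kappa> :: "'i \<Rightarrow> 'a \<Rightarrow> 'b measure" and h :: "'i \<Rightarrow> 'b \<Rightarrow> complex"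
  assumes J: "finite J"
    and Z [measurable]: "\<And>j. j \<in> J \<Longrightarrow> Z j \<in> measurable M N"
    and \<kappa>: "\<And>j \<omega>. j \<in> J \<Longrightarrow> \<omega> \<in> space M \<Longrightarrow> prob_space (\<kappa> j \<omega>)"
      "\<And>j \<omega>. j \<in> J \<Longrightarrow> \<omega> \<in> space M \<Longrightarrow> sets (\<kappa> j \<omega>) = sets N"
    and \<kappa>_meas: "\<And>j A. j \<in> J \<Longrightarrow> A \<in> sets N \<Longrightarrow> (\<lambda>\<omega>. measure (\<kappa> j \<omega>) A) \<in> borel_measurable M"
    and indep: "\<And>A. (\<And>j. j \<in> J \<Longrightarrow> A j \<in> sets N) \<Longrightarrow>
        prob {\<omega> \<in> space M. \<forall>j\<in>J. Z j \<omega> \<in> A j} = (\<integral>\<omega>. (\<Prod>j\<in>J. measure (\<kappa> j \<omega>) (A j)) \<partial>M)"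
    and h [measurable]: "\<And>j. j \<in> J \<Longrightarrow> h j \<in> borel_measurable N"
    and h_le: "\<And>j y. j \<in> J \<Longrightarrow> y \<in> space N \<Longrightarrow> norm (h j y) \<le> 1"
  shows "\<And>j. j \<in> J \<Longrightarrow> (\<lambda>\<omega>. \<integral>y. h j y \<partial>\<kappa> j \<omega>) \<in> borel_measurable M"
    and "(\<integral>\<omega>. (\<Prod>j\<in>J. h j (Z j \<omega>)) \<partial>M) = (\<integral>\<omega>. (\<Prod>j\<in>J. \<integral>y. h j y \<partial>\<kappa> j \<omega>) \<partial>M)"
proof -
  have ZN: "Z j \<omega> \<in> space N" if "j \<in> J" "\<omega> \<in> space M" for j \<omega> using measurable_space[OF Z[OF that(1)] that(2)] .
  have \<kappa>h_meas [measurable]: "(\<lambda>\<omega>. \<integral>y. h j y \<partial>\<kappa> j \<omega>) \<in> borel_measurable M" if "j \<in> J" for j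
    by (rule expectation_kernel_step(1)[where Z="Z j" and G="\<lambda>_. 0" and G'="\<lambda>_. 0" and N=N])
      (use that \<kappa> \<kappa>_meas h h_le Z in auto)
  show "\<And>j. j \<in> J \<Longrightarrow> (\<lambda>\<omega>. \<integral>y. h j y \<partial>\<kappa> j \<omega>) \<in> borel_measurable M" by (rule \<kappa>h_meas)
  have \<kappa>h_le: "norm (\<integral>y. h j y \<partial>\<kappa> j \<omega>) \<le> 1" if "j \<in> J" "\<omega> \<in> space M" for j \<omega>
  proof -
    interpret K: prob_space "\<kappa> j \<omega>" using \<kappa> that by auto
    have [measurable_cong]: "sets (\<kappa> j \<omega>) = sets N" using \<kappa> that by auto
    have sp: "space (\<kappa> j \<omega>) = space N" by (rule sets_eq_imp_space_eq) fact
    note [measurable] = h[OF that(1)]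
    have "norm (\<integral>y. h j y \<partial>\<kappa> j \<omega>) \<le> (\<integral>y. norm (h j y) \<partial>\<kappa> j \<omega>)" by (rule integral_norm_bound)
    also have "\<dots> \<le> (\<integral>y. 1 \<partial>\<kappa> j \<omega>)"
      by (intro integral_mono K.integrable_const_bound[of _ 1]) (auto simp: sp h_le that intro!: AE_I2)
    finally show ?thesis by (simp add: K.prob_space)
  qed
  have "(\<integral>\<omega>. (\<Prod>j\<in>I. h j (Z j \<omega>)) * (\<Prod>j\<in>J - I. indicator (A j) (Z j \<omega>)) \<partial>M) =
      (\<integral>\<omega>. (\<Prod>j\<in>I. \<integral>y. h j y \<partial>\<kappa> j \<omega>) * (\<Prod>j\<in>J - I. of_real (measure (\<kappa> j \<omega>) (A j))) \<partial>M)"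
    if "I \<subseteq> J" "\<And>j. j \<in> J \<Longrightarrow> A j \<in> sets N" for I A
    using finite_subset[OF that(1) J] that
  proof (induction I arbitrary: A rule: finite_induct)
    case empty
    have "(\<integral>\<omega>. (\<Prod>j\<in>J. indicator (A j) (Z j \<omega>)) \<partial>M) = (\<integral>\<omega>. complex_of_real (indicator {\<omega> \<in> space M. \<forall>j\<in>J. Z j \<omega> \<in> A j} \<omega>) \<partial>M)"
      using J by (intro Bochner_Integration.integral_cong refl) (auto simp: indicator_def prod_zero_iff intro!: prod.neutral)
    also have "\<dots> = of_real (prob {\<omega> \<in> space M. \<forall>j\<in>J. Z j \<omega> \<in> A j})"
      by (simp add: Int_def) (metis (no_types, lifting) Collect_cong)
    also have "\<dots> = of_real (\<integral>\<omega>. (\<Prod>j\<in>J. measure (\<kappa> j \<omega>) (A j)) \<partial>M)"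
      using empty by (subst indep) auto
    also have "\<dots> = (\<integral>\<omega>. (\<Prod>j\<in>J. complex_of_real (measure (\<kappa> j \<omega>) (A j))) \<partial>M)"
      by (simp only: integral_complex_of_real[symmetric] of_real_prod)
    finally show ?case by simp
  next
    case (insert k I)
    then have k: "k \<in> J" "k \<notin> I" and IJ: "I \<subseteq> J" and A: "\<And>j. j \<in> J \<Longrightarrow> A j \<in> sets N" by auto
    have J_k: "J - I = insert k (J - insert k I)" using k by auto
    have fin: "finite (J - insert k I)" using J by auto
    define G where "G \<omega> = (\<Prod>j\<in>I. h j (Z j \<omega>)) * (\<Prod>j\<in>J - insert k I. indicator (A j) (Z j \<omega>) :: complex)" for \<omega>
    define G' where "G' \<omega> = (\<Prod>j\<in>I. \<integral>y. h j y \<partial>\<kappa> j \<omega>) * (\<Prod>j\<in>J - insert k I. complex_of_real (measure (\<kappa> j \<omega>) (A j)))" for \<omega>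
    have "(\<integral>\<omega>. G \<omega> * h k (Z k \<omega>) \<partial>M) = (\<integral>\<omega>. G' \<omega> * (\<integral>y. h k y \<partial>\<kappa> k \<omega>) \<partial>M)"
    proof (rule expectation_kernel_step(2)[where N=N])
      show "G \<in> borel_measurable M" unfolding G_def
      proof (intro borel_measurable_times borel_measurable_prod)
        fix j assume "j \<in> I"
        then have "j \<in> J" using IJ by auto
        then show "(\<lambda>\<omega>. h j (Z j \<omega>)) \<in> borel_measurable M" by measurable
      next
        fix j assume "j \<in> J - insert k I"
        then have [simp, measurable]: "j \<in> J" "A j \<in> sets N" using A by auto
        show "(\<lambda>\<omega>. indicator (A j) (Z j \<omega>) :: complex) \<in> borel_measurable M" by measurable
      qed
      show "G' \<in> borel_measurable M" unfolding G'_def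
      proof (intro borel_measurable_times borel_measurable_prod)
        fix j assume "j \<in> I"
        then have "j \<in> J" using IJ by auto
        then show "(\<lambda>\<omega>. \<integral>y. h j y \<partial>\<kappa> j \<omega>) \<in> borel_measurable M" by measurable
      next
        fix j assume "j \<in> J - insert k I"
        then show "(\<lambda>\<omega>. complex_of_real (measure (\<kappa> j \<omega>) (A j))) \<in> borel_measurable M"
          using \<kappa>_meas[of j "A j"] A by auto
      qed
      fix \<omega> assume \<omega>: "\<omega> \<in> space M"
      show "norm (G \<omega>) \<le> 1" unfolding G_def norm_mult prod_norm[symmetric]
        using IJ \<omega> by (intro mult_le_one prod_le_1 prod_nonneg conjI) (auto simp: ZN h_le indicator_def subset_iff)
      show "norm (G' \<omega>) \<le> 1" unfolding G'_def norm_mult prod_norm[symmetric]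
        using IJ \<omega> \<kappa>(1)[OF _ \<omega>] by (intro mult_le_one prod_le_1 prod_nonneg conjI)
          (auto simp: \<kappa>h_le subset_iff prob_space.prob_le_1)
    next
      fix B assume B: "B \<in> sets N"
      have "(\<integral>\<omega>. (\<Prod>j\<in>I. h j (Z j \<omega>)) * (\<Prod>j\<in>J - I. indicator ((A(k := B)) j) (Z j \<omega>)) \<partial>M) =
          (\<integral>\<omega>. (\<Prod>j\<in>I. \<integral>y. h j y \<partial>\<kappa> j \<omega>) * (\<Prod>j\<in>J - I. of_real (measure (\<kappa> j \<omega>) ((A(k := B)) j))) \<partial>M)"
        by (rule insert.IH[OF IJ]) (use A B in auto)
      moreover have "(\<Prod>j\<in>J - I. indicator ((A(k := B)) j) (Z j \<omega>) :: complex) =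
         indicator B (Z k \<omega>) * (\<Prod>j\<in>J - insert k I. indicator (A j) (Z j \<omega>))" for \<omega>
        unfolding J_k by (subst prod.insert) (use fin in \<open>auto intro!: prod.cong\<close>)
      moreover have "(\<Prod>j\<in>J - I. complex_of_real (measure (\<kappa> j \<omega>) ((A(k := B)) j))) =
         of_real (measure (\<kappa> k \<omega>) B) * (\<Prod>j\<in>J - insert k I. of_real (measure (\<kappa> j \<omega>) (A j)))" for \<omega>
        unfolding J_k by (subst prod.insert) (use fin in \<open>auto intro!: prod.cong\<close>)
      ultimately show "(\<integral>\<omega>. G \<omega> * indicator B (Z k \<omega>) \<partial>M) = (\<integral>\<omega>. G' \<omega> * of_real (measure (\<kappa> k \<omega>) B) \<partial>M)"
        by (simp add: G_def G'_def mult_ac)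
    qed (use k \<kappa> \<kappa>_meas h h_le Z in auto)
    then show ?case
      using k insert.hyps by (simp add: G_def G'_def mult_ac)
  qed
  from this[of J "\<lambda>_. space N"] show "(\<integral>\<omega>. (\<Prod>j\<in>J. h j (Z j \<omega>)) \<partial>M) = (\<integral>\<omega>. (\<Prod>j\<in>J. \<integral>y. h j y \<partial>\<kappa> j \<omega>) \<partial>M)"
    by simp
qed

section \<open>The fluctuation of the input estimates\<close>

locale input_data = prob_space M for M :: "'w measure" +
  fixes b :: "'d::finite \<Rightarrow> 's::finite" and D :: "'s \<Rightarrow> nat \<Rightarrow> 'w \<Rightarrow> 'd \<Rightarrow> real"
    and n :: "'s \<Rightarrow> nat \<Rightarrow> nat" and \<theta>c :: "real^'d"
  assumes D_indep: "indep_vars (\<lambda>(s, j). block_space b s) (\<lambda>(s, j). D s j) (UNIV \<times> {1..})"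
    and D_ident: "\<And>s j. j \<ge> 1 \<Longrightarrow> distr M (block_space b s) (D s j) = distr M (block_space b s) (D s 1)"
    and D_mean: "\<And>s k. k \<in> block b s \<Longrightarrow>
      integrable M (\<lambda>\<omega>. D s 1 \<omega> k) \<and> (\<integral>\<omega>. D s 1 \<omega> k \<partial>M) = \<theta>c $ k"
    and D_cov: "\<And>s k k'. k \<in> block b s \<Longrightarrow> k' \<in> block b s \<Longrightarrow>
      covariance_exists M (\<lambda>\<omega>. D s 1 \<omega> k) (\<lambda>\<omega>. D s 1 \<omega> k')"
    and n_pos: "\<And>s t. t \<ge> 1 \<Longrightarrow> n s t \<ge> 1"
begin

text \<open>The contribution of stream \<open>s\<close> to the inner product of \<open>g\<close> with a
  deviation from \<open>\<theta>c\<close>. For a standard basis vector \<open>g\<close> and the stream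
  of its coordinate it is the deviation of that coordinate, so that the coordinates of the estimates
  need no separate moment bounds.\<close>

definition linear_dev :: "real^'d \<Rightarrow> 's \<Rightarrow> ('d \<Rightarrow> real) \<Rightarrow> real" where
  "linear_dev g s x = (\<Sum>k\<in>block b s. g $ k * (x k - \<theta>c $ k))"

abbreviation dev :: "real^'d \<Rightarrow> 's \<Rightarrow> nat \<Rightarrow> 'w \<Rightarrow> real" where
  "dev g s j \<omega> \<equiv> linear_dev g s (D s j \<omega>)"

definition dev_var :: "real^'d \<Rightarrow> 's \<Rightarrow> real" where
  "dev_var g s = (\<Sum>k\<in>block b s. \<Sum>k'\<in>block b s. g $ k * g $ k' * covariance M (\<lambda>\<omega>. D s 1 \<omega> k) (\<lambda>\<omega>. D s 1 \<omega> k'))"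

lemma D_measurable: "j \<ge> 1 \<Longrightarrow> D s j \<in> measurable M (block_space b s)"
  using D_indep unfolding indep_vars_def by (auto dest!: bspec[where x="(s, j)"])

lemma linear_dev_measurable [measurable]: "linear_dev g s \<in> borel_measurable (block_space b s)"
proof -
  have [measurable]: "(\<lambda>x. x k) \<in> borel_measurable (block_space b s)" if "k \<in> block b s" for k
    unfolding block_space_def by (rule measurable_component_singleton[OF that])
  show ?thesis unfolding linear_dev_def by measurable
qed

lemma dev_measurable: "j \<ge> 1 \<Longrightarrow> dev g s j \<in> borel_measurable M"
  by (rule measurable_compose[OF D_measurable linear_dev_measurable])

lemma distr_dev:
  assumes "j \<ge> 1"
  shows "distr M borel (dev g s j) = distr M borel (dev g s 1)"
proof -
  have "distr M borel (dev g s i) = distr (distr M (block_space b s) (D s i)) borel (linear_dev g s)" if "i \<ge> 1" for i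
    by (subst distr_distr[OF linear_dev_measurable D_measurable[OF that]]) (simp add: comp_def)
  from this[OF assms] this[OF order_refl] show ?thesis using D_ident[OF assms] by simp
qed

lemma integral_dev:
  fixes f :: "real \<Rightarrow> real"
  assumes "j \<ge> 1" "f \<in> borel_measurable borel"
  shows "(\<integral>\<omega>. f (dev g s j \<omega>) \<partial>M) = (\<integral>\<omega>. f (dev g s 1 \<omega>) \<partial>M)"
    and "integrable M (\<lambda>\<omega>. f (dev g s j \<omega>)) \<longleftrightarrow> integrable M (\<lambda>\<omega>. f (dev g s 1 \<omega>))"
  using integral_distr[OF dev_measurable[OF assms(1)] assms(2)] integral_distr[OF dev_measurable[OF order_refl] assms(2)]
    integrable_distr_eq[OF dev_measurable[OF assms(1)] assms(2)] integrable_distr_eq[OF dev_measurable[OF order_refl] assms(2)]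
    distr_dev[OF assms(1)]
  by auto

lemma dev_moments_1:
  shows "integrable M (dev g s 1)" "(\<integral>\<omega>. dev g s 1 \<omega> \<partial>M) = 0"
    "integrable M (\<lambda>\<omega>. (dev g s 1 \<omega>)\<^sup>2)" "(\<integral>\<omega>. (dev g s 1 \<omega>)\<^sup>2 \<partial>M) = dev_var g s"
proof -
  show "integrable M (dev g s 1)" unfolding linear_dev_def using D_mean by auto
  show "(\<integral>\<omega>. dev g s 1 \<omega> \<partial>M) = 0"
    unfolding linear_dev_def using D_mean by (simp add: Bochner_Integration.integral_sum prob_space)
  have eq: "(dev g s 1 \<omega>)\<^sup>2 = (\<Sum>k\<in>block b s. \<Sum>k'\<in>block b s. g $ k * g $ k' * ((D s 1 \<omega> k - \<theta>c $ k) * (D s 1 \<omega> k' - \<theta>c $ k')))" for \<omega>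
    unfolding linear_dev_def power2_eq_square sum_product by (intro sum.cong refl) simp
  have int: "integrable M (\<lambda>\<omega>. (D s 1 \<omega> k - \<theta>c $ k) * (D s 1 \<omega> k' - \<theta>c $ k'))" if "k \<in> block b s" "k' \<in> block b s" for k k'
    using D_cov[OF that] D_mean that by (simp add: covariance_exists_def)
  show "integrable M (\<lambda>\<omega>. (dev g s 1 \<omega>)\<^sup>2)" unfolding eq using int by auto
  show "(\<integral>\<omega>. (dev g s 1 \<omega>)\<^sup>2 \<partial>M) = dev_var g s"
    unfolding eq dev_var_def using int D_mean by (simp add: Bochner_Integration.integral_sum covariance_def)
qed

lemma dev_moments:
  assumes j: "j \<ge> 1"
  shows "integrable M (dev g s j)" "(\<integral>\<omega>. dev g s j \<omega> \<partial>M) = 0"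
    "integrable M (\<lambda>\<omega>. (dev g s j \<omega>)\<^sup>2)" "(\<integral>\<omega>. (dev g s j \<omega>)\<^sup>2 \<partial>M) = dev_var g s"
  using integral_dev[OF j, of "\<lambda>x. x" g s] integral_dev[OF j, of "\<lambda>x. x\<^sup>2" g s] dev_moments_1[of g s] by auto

lemma indep_dev: "indep_vars (\<lambda>_. borel) (\<lambda>(s, j). dev g s j) (UNIV \<times> {1..})"
proof -
  have "indep_vars (\<lambda>_. borel) (\<lambda>p \<omega>. linear_dev g (fst p) ((case p of (s, j) \<Rightarrow> D s j) \<omega>)) (UNIV \<times> {1..})"
    by (rule indep_vars_compose2[OF D_indep]) auto
  then show ?thesis by (simp add: case_prod_unfold)
qed

lemma dev_product:
  assumes "i \<ge> 1" "j \<ge> 1"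
  shows "integrable M (\<lambda>\<omega>. dev g s i \<omega> * dev g s j \<omega>)"
    and "i \<noteq> j \<Longrightarrow> (\<integral>\<omega>. dev g s i \<omega> * dev g s j \<omega> \<partial>M) = 0"
proof -
  have *: "integrable M (\<lambda>\<omega>. dev g s i \<omega> * dev g s j \<omega>) \<and> (\<integral>\<omega>. dev g s i \<omega> * dev g s j \<omega> \<partial>M) = 0" if "i \<noteq> j"
  proof -
    have ind: "indep_vars (\<lambda>_. borel) (\<lambda>(s, j). dev g s j) {(s, i), (s, j)}"
      by (rule indep_vars_subset[OF indep_dev]) (use assms in auto)
    have int: "integrable M ((\<lambda>(s, j). dev g s j) p)" if "p \<in> {(s, i), (s, j)}" for p
      using that dev_moments(1) assms by auto
    show ?thesis
      using indep_vars_integrable[OF _ ind int] indep_vars_lebesgue_integral[OF _ ind int] \<open>i \<noteq> j\<close> dev_moments(2) assms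
      by simp
  qed
  then show "i \<noteq> j \<Longrightarrow> (\<integral>\<omega>. dev g s i \<omega> * dev g s j \<omega> \<partial>M) = 0" by blast
  show "integrable M (\<lambda>\<omega>. dev g s i \<omega> * dev g s j \<omega>)"
    using * dev_moments(3)[OF assms(1), of g s] by (cases "i = j") (auto simp: power2_eq_square)
qed

lemma dev_axis: "dev (axis k 1) (b k) j \<omega> = D (b k) j \<omega> k - \<theta>c $ k"
proof -
  have "dev (axis k 1) (b k) j \<omega> = (\<Sum>k'\<in>block b (b k). if k' = k then D (b k) j \<omega> k' - \<theta>c $ k' else 0)"
    unfolding linear_dev_def by (intro sum.cong refl) (simp add: axis_def)
  then show ?thesis by (simp add: block_def sum.delta)
qed

lemma theta_hat_coordinate:
  assumes "l \<ge> 1"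
  shows "theta_hat b n D l \<omega> $ k - \<theta>c $ k =
    (\<Sum>j=1..total (n (b k)) l. D (b k) j \<omega> k - \<theta>c $ k) / real (total (n (b k)) l)"
proof -
  have "total (n (b k)) l > 0" using le_total[of "n (b k)" l, OF n_pos] assms by simp
  then show ?thesis by (simp add: theta_hat_def sum_subtractf diff_divide_distrib)
qed

lemma theta_hat_inner:
  assumes l: "l \<ge> 1"
  shows "g \<bullet> (theta_hat b n D l \<omega> - \<theta>c) = (\<Sum>s\<in>UNIV. (\<Sum>j=1..total (n s) l. dev g s j \<omega>) / real (total (n s) l))"
proof -
  have "g \<bullet> (theta_hat b n D l \<omega> - \<theta>c) = (\<Sum>k\<in>UNIV. g $ k * (theta_hat b n D l \<omega> $ k - \<theta>c $ k))"
    by (simp add: inner_vec_def)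
  also have "\<dots> = (\<Sum>s\<in>UNIV. \<Sum>k\<in>{k\<in>UNIV. b k = s}. g $ k * (theta_hat b n D l \<omega> $ k - \<theta>c $ k))"
    by (rule sum.group[symmetric]) auto
  also have "\<dots> = (\<Sum>s\<in>UNIV. (\<Sum>j=1..total (n s) l. dev g s j \<omega>) / real (total (n s) l))"
  proof (rule sum.cong[OF refl])
    fix s
    have "(\<Sum>k\<in>{k\<in>UNIV. b k = s}. g $ k * (theta_hat b n D l \<omega> $ k - \<theta>c $ k)) =
      (\<Sum>k\<in>block b s. (\<Sum>j=1..total (n s) l. g $ k * (D s j \<omega> k - \<theta>c $ k)) / real (total (n s) l))"
      unfolding block_def
      by (rule sum.cong) (auto simp: theta_hat_coordinate[OF l] sum_distrib_left)
    also have "\<dots> = (\<Sum>j=1..total (n s) l. dev g s j \<omega>) / real (total (n s) l)"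
      unfolding linear_dev_def sum_divide_distrib by (rule sum.swap)
    finally show "(\<Sum>k\<in>{k\<in>UNIV. b k = s}. g $ k * (theta_hat b n D l \<omega> $ k - \<theta>c $ k)) =
      (\<Sum>j=1..total (n s) l. dev g s j \<omega>) / real (total (n s) l)" .
  qed
  finally show ?thesis .
qed

lemma theta_hat_measurable [measurable]: "theta_hat b n D l \<in> borel_measurable M"
proof -
  have D: "(\<lambda>\<omega>. D s j \<omega> k) \<in> borel_measurable M" if "j \<ge> 1" "k \<in> block b s" for s j k
    by (rule measurable_compose[OF D_measurable[OF that(1)]])
      (unfold block_space_def, rule measurable_component_singleton[OF that(2)])
  have "(\<lambda>\<omega>. theta_hat b n D l \<omega> $ k) \<in> borel_measurable M" for k
    unfolding theta_hat_def by (auto intro!: borel_measurable_divide borel_measurable_sum D simp: block_def)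
  then show ?thesis
    by (subst borel_measurable_euclidean_space) (auto simp: Basis_vec_def inner_axis)
qed

lemma theta_hat_AE_tendsto:
  "AE \<omega> in M. (\<lambda>l. theta_hat b n D l \<omega>) \<longlonglongrightarrow> \<theta>c"
proof -
  have "AE \<omega> in M. (\<lambda>N. (\<Sum>j=1..N. dev (axis k 1) (b k) j \<omega>) / real N) \<longlonglongrightarrow> 0" for k
    by (rule strong_law_uncorrelated[where v="dev_var (axis k 1) (b k)"])
      (auto intro: dev_measurable dev_product dev_moments)
  then have "AE \<omega> in M. \<forall>k. (\<lambda>N. (\<Sum>j=1..N. dev (axis k 1) (b k) j \<omega>) / real N) \<longlonglongrightarrow> 0"
    by (simp add: AE_all_countable)
  then show ?thesis
  proof eventually_elim
    case (elim \<omega>)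
    have "(\<lambda>l. theta_hat b n D l \<omega> $ k) \<longlonglongrightarrow> \<theta>c $ k" for k
    proof -
      have "filterlim (total (n (b k))) at_top sequentially"
        by (rule filterlim_at_top_mono[OF filterlim_ident]) (auto intro!: always_eventually le_total n_pos)
      from filterlim_compose[OF elim[rule_format, of k] this]
      have "(\<lambda>l. theta_hat b n D l \<omega> $ k - \<theta>c $ k) \<longlonglongrightarrow> 0"
      proof (rule Lim_transform_eventually)
        show "\<forall>\<^sub>F l in sequentially. (\<Sum>j=1..total (n (b k)) l. dev (axis k 1) (b k) j \<omega>) / real (total (n (b k)) l)
            = theta_hat b n D l \<omega> $ k - \<theta>c $ k"
          using eventually_ge_at_top[of 1]
          by eventually_elim (simp add: theta_hat_coordinate dev_axis)
      qed
      then show ?thesis by (simp add: LIM_zero_iff)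
    qed
    then show ?case by (rule vec_tendstoI)
  qed
qed

text \<open>Each coordinate is an average of \<open>N l \<ge> l\<close> uncorrelated variables.\<close>

lemma theta_hat_second_moment:
  obtains C where "C \<ge> 0" "\<And>l. l \<ge> 1 \<Longrightarrow> integrable M (\<lambda>\<omega>. (norm (theta_hat b n D l \<omega> - \<theta>c))\<^sup>2)"
    "\<And>l. l \<ge> 1 \<Longrightarrow> (\<integral>\<omega>. (norm (theta_hat b n D l \<omega> - \<theta>c))\<^sup>2 \<partial>M) \<le> C / real l"
proof -
  define v where "v k = dev_var (axis k 1) (b k)" for k
  have v: "0 \<le> v k" for k
    unfolding v_def using dev_moments_1(4)[of "axis k 1" "b k"] by (metis Bochner_Integration.integral_nonneg zero_le_power2)
  have coord: "integrable M (\<lambda>\<omega>. (theta_hat b n D l \<omega> $ k - \<theta>c $ k)\<^sup>2)"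
    "(\<integral>\<omega>. (theta_hat b n D l \<omega> $ k - \<theta>c $ k)\<^sup>2 \<partial>M) \<le> v k / real l" if l: "l \<ge> 1" for l k
  proof -
    define N where "N = total (n (b k)) l"
    have N: "l \<le> N" unfolding N_def by (rule le_total) (rule n_pos)
    have eq: "(theta_hat b n D l \<omega> $ k - \<theta>c $ k)\<^sup>2 = (\<Sum>j\<in>{1..N}. dev (axis k 1) (b k) j \<omega>)\<^sup>2 / (real N)\<^sup>2" for \<omega>
      by (simp add: theta_hat_coordinate[OF l] dev_axis N_def power_divide)
    have S: "integrable M (\<lambda>\<omega>. (\<Sum>j\<in>{1..N}. dev (axis k 1) (b k) j \<omega>)\<^sup>2)"
      "(\<integral>\<omega>. (\<Sum>j\<in>{1..N}. dev (axis k 1) (b k) j \<omega>)\<^sup>2 \<partial>M) = real (card {1..N}) * v k"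
      using second_moment_sum_uncorrelated[of "{1..N}" "dev (axis k 1) (b k)" "v k"] dev_product dev_moments(4)
      by (auto simp: v_def)
    show "integrable M (\<lambda>\<omega>. (theta_hat b n D l \<omega> $ k - \<theta>c $ k)\<^sup>2)" unfolding eq using S by simp
    have "(\<integral>\<omega>. (theta_hat b n D l \<omega> $ k - \<theta>c $ k)\<^sup>2 \<partial>M) = v k / real N"
      unfolding eq using S N l by (simp add: power2_eq_square)
    also have "\<dots> \<le> v k / real l" using N l v by (intro divide_left_mono) auto
    finally show "(\<integral>\<omega>. (theta_hat b n D l \<omega> $ k - \<theta>c $ k)\<^sup>2 \<partial>M) \<le> v k / real l" .
  qed
  have norm: "(norm (theta_hat b n D l \<omega> - \<theta>c))\<^sup>2 = (\<Sum>k\<in>UNIV. (theta_hat b n D l \<omega> $ k - \<theta>c $ k)\<^sup>2)" for l \<omega>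
    unfolding power2_norm_eq_inner inner_vec_def by (simp add: power2_eq_square)
  show thesis
  proof (rule that[of "\<Sum>k\<in>UNIV. v k"])
    show "0 \<le> (\<Sum>k\<in>UNIV. v k)" by (intro sum_nonneg v)
    fix l :: nat assume l: "l \<ge> 1"
    show "integrable M (\<lambda>\<omega>. (norm (theta_hat b n D l \<omega> - \<theta>c))\<^sup>2)" unfolding norm using coord[OF l] by auto
    have "(\<integral>\<omega>. (norm (theta_hat b n D l \<omega> - \<theta>c))\<^sup>2 \<partial>M) = (\<Sum>k\<in>UNIV. \<integral>\<omega>. (theta_hat b n D l \<omega> $ k - \<theta>c $ k)\<^sup>2 \<partial>M)"
      unfolding norm using coord[OF l] by (simp add: Bochner_Integration.integral_sum)
    also have "\<dots> \<le> (\<Sum>k\<in>UNIV. v k / real l)" by (intro sum_mono coord l)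
    finally show "(\<integral>\<omega>. (norm (theta_hat b n D l \<omega> - \<theta>c))\<^sup>2 \<partial>M) \<le> (\<Sum>k\<in>UNIV. v k) / real l"
      by (simp add: sum_divide_distrib)
  qed
qed

text \<open>Exchanging the sums over stages and samples exhibits the input part as a weighted sum of
  independent variables.\<close>

lemma weighted_theta_hat_sum:
  "(\<Sum>l=p+1..t. real (m l) * (g \<bullet> (theta_hat b n D l \<omega> - \<theta>c))) =
    (\<Sum>(s, j)\<in>(SIGMA s:UNIV. {1..total (n s) t}). input_weight m (n s) p t j * dev g s j \<omega>)"
proof -
  have "(\<Sum>l=p+1..t. real (m l) * (g \<bullet> (theta_hat b n D l \<omega> - \<theta>c))) =
      (\<Sum>l=p+1..t. \<Sum>s\<in>UNIV. \<Sum>j=1..total (n s) t. (if j \<le> total (n s) l then real (m l) / real (total (n s) l) else 0) * dev g s j \<omega>)"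
  proof (rule sum.cong[OF refl])
    fix l assume l: "l \<in> {p+1..t}"
    have "real (m l) * ((\<Sum>j=1..total (n s) l. dev g s j \<omega>) / real (total (n s) l)) =
        (\<Sum>j=1..total (n s) t. (if j \<le> total (n s) l then real (m l) / real (total (n s) l) else 0) * dev g s j \<omega>)" for s
    proof -
      have "(\<Sum>j=1..total (n s) t. (if j \<le> total (n s) l then real (m l) / real (total (n s) l) else 0) * dev g s j \<omega>) =
         (\<Sum>j=1..total (n s) l. (if j \<le> total (n s) l then real (m l) / real (total (n s) l) else 0) * dev g s j \<omega>)"
        using l total_mono[of l t "n s"] by (intro sum.mono_neutral_right) auto
      also have "\<dots> = (\<Sum>j=1..total (n s) l. real (m l) / real (total (n s) l) * dev g s j \<omega>)"
        by (rule sum.cong) auto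
      finally show ?thesis by (simp add: sum_divide_distrib sum_distrib_left)
    qed
    then show "real (m l) * (g \<bullet> (theta_hat b n D l \<omega> - \<theta>c)) =
      (\<Sum>s\<in>UNIV. \<Sum>j=1..total (n s) t. (if j \<le> total (n s) l then real (m l) / real (total (n s) l) else 0) * dev g s j \<omega>)"
      using l by (simp add: theta_hat_inner sum_distrib_left)
  qed
  also have "\<dots> = (\<Sum>s\<in>UNIV. \<Sum>l=p+1..t. \<Sum>j=1..total (n s) t. (if j \<le> total (n s) l then real (m l) / real (total (n s) l) else 0) * dev g s j \<omega>)"
    by (rule sum.swap)
  also have "\<dots> = (\<Sum>s\<in>UNIV. \<Sum>j=1..total (n s) t. input_weight m (n s) p t j * dev g s j \<omega>)"
    unfolding input_weight_def sum_distrib_right by (intro sum.cong refl sum.swap)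
  also have "\<dots> = (\<Sum>(s, j)\<in>(SIGMA s:UNIV. {1..total (n s) t}). input_weight m (n s) p t j * dev g s j \<omega>)"
    by (subst sum.Sigma) auto
  finally show ?thesis .
qed

text \<open>The matrix is block diagonal, so its quadratic form splits into the variances of the
  streams.\<close>

lemma sum_dev_var: "(\<Sum>s\<in>UNIV. dev_var g s / nbar s) = g \<bullet> (Sigma_D_bar M b nbar D *v g)"
proof -
  let ?c = "\<lambda>k k'. inverse (nbar (b k)) * covariance M (\<lambda>\<omega>. D (b k) 1 \<omega> k) (\<lambda>\<omega>. D (b k) 1 \<omega> k')"
  have "g \<bullet> (Sigma_D_bar M b nbar D *v g) = (\<Sum>k\<in>UNIV. \<Sum>k'\<in>UNIV. if b k' = b k then g $ k * g $ k' * ?c k k' else 0)"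
    by (auto simp: Sigma_D_bar_def inner_vec_def matrix_vector_mult_def sum_distrib_left intro!: sum.cong)
  also have "\<dots> = (\<Sum>k\<in>UNIV. \<Sum>k'\<in>block b (b k). g $ k * g $ k' * ?c k k')"
    by (simp add: block_def sum.If_cases)
  also have "\<dots> = (\<Sum>s\<in>UNIV. \<Sum>k\<in>{k\<in>UNIV. b k = s}. \<Sum>k'\<in>block b (b k). g $ k * g $ k' * ?c k k')"
    by (rule sum.group[symmetric]) auto
  also have "\<dots> = (\<Sum>s\<in>UNIV. dev_var g s / nbar s)"
    unfolding dev_var_def sum_divide_distrib
    by (intro sum.cong refl) (auto simp: block_def divide_inverse mult_ac)
  finally show ?thesis by simp
qed

lemma input_char_tendsto:
  assumes m_pos: "\<And>t. t \<ge> 1 \<Longrightarrow> m t \<ge> 1" and m_bdd: "\<And>t. t \<ge> 1 \<Longrightarrow> m t \<le> B"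
    and m_lim: "(\<lambda>t. real (total m t) / real t) \<longlonglongrightarrow> mbar" and mbar: "mbar > 0"
    and n_lim: "\<And>s. (\<lambda>t. real (total (n s) t) / real t) \<longlonglongrightarrow> nbar s" and nbar: "\<And>s. nbar s > 0"
    and \<eta>: "0 \<le> \<eta>" "\<eta> < 1"
  shows "(\<lambda>t. \<integral>\<omega>. cis (window_scale m \<eta> t * (\<Sum>l=dropped \<eta> t + 1..t. real (m l) * (g \<bullet> (theta_hat b n D l \<omega> - \<theta>c)))) \<partial>M)
    \<longlonglongrightarrow> of_real (exp (- (lambda_I \<eta> * (g \<bullet> (Sigma_D_bar M b nbar D *v g))) / 2))"
proof -
  define c where "c s t j = window_scale m \<eta> t * input_weight m (n s) (dropped \<eta> t) t j" for s t j
  define \<mu> where "\<mu> s = distr M borel (dev g s 1)" for s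
  let ?I = "\<lambda>t. SIGMA s:UNIV. {1..total (n s) t}"
  have rd: "real_distribution (\<mu> s)" for s
    unfolding \<mu>_def by (rule real_distribution_distr) (simp add: dev_measurable)
  have prod: "(\<integral>\<omega>. cis (window_scale m \<eta> t * (\<Sum>l=dropped \<eta> t + 1..t. real (m l) * (g \<bullet> (theta_hat b n D l \<omega> - \<theta>c)))) \<partial>M)
      = (\<Prod>s\<in>UNIV. \<Prod>j\<in>{1..total (n s) t}. char (\<mu> s) (c s t j))" for t
  proof -
    define \<xi> where "\<xi> p \<omega> = c (fst p) t (snd p) * dev g (fst p) (snd p) \<omega>" for p \<omega>
    have ind: "indep_vars (\<lambda>_. borel) \<xi> (?I t)"
    proof -
      have "indep_vars (\<lambda>_. borel) (\<lambda>p \<omega>. (\<lambda>x. c (fst p) t (snd p) * x) ((case p of (s, j) \<Rightarrow> dev g s j) \<omega>)) (?I t)"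
        by (rule indep_vars_compose2[OF indep_vars_subset[OF indep_dev]]) auto
      then show ?thesis by (simp add: \<xi>_def[abs_def] case_prod_unfold)
    qed
    have meas: "\<xi> p \<in> borel_measurable M" if "p \<in> ?I t" for p
      using ind that by (auto simp: indep_vars_def)
    have "window_scale m \<eta> t * (\<Sum>l=dropped \<eta> t + 1..t. real (m l) * (g \<bullet> (theta_hat b n D l \<omega> - \<theta>c))) = (\<Sum>p\<in>?I t. \<xi> p \<omega>)" for \<omega>
      unfolding weighted_theta_hat_sum sum_distrib_left
      by (rule sum.cong) (auto simp: \<xi>_def c_def)
    then have "(\<integral>\<omega>. cis (window_scale m \<eta> t * (\<Sum>l=dropped \<eta> t + 1..t. real (m l) * (g \<bullet> (theta_hat b n D l \<omega> - \<theta>c)))) \<partial>M)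
      = char (distr M borel (\<lambda>\<omega>. \<Sum>p\<in>?I t. \<xi> p \<omega>)) 1"
      unfolding char_def using meas
      by (subst integral_distr) (auto intro!: borel_measurable_sum simp: cis_conv_exp)
    also have "\<dots> = (\<Prod>p\<in>?I t. char (distr M borel (\<xi> p)) 1)"
      by (rule char_distr_sum[OF ind])
    also have "\<dots> = (\<Prod>(s, j)\<in>?I t. char (\<mu> s) (c s t j))"
    proof (rule prod.cong[OF refl])
      fix p assume "p \<in> ?I t"
      then obtain s j where p: "p = (s, j)" "j \<ge> 1" by auto
      have "char (distr M borel (\<xi> p)) 1 = char (distr M borel (dev g s j)) (c s t j)"
        unfolding char_def using meas[OF \<open>p \<in> ?I t\<close>] dev_measurable[OF p(2), of g s]
        by (subst (1 2) integral_distr) (auto simp: \<xi>_def p)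
      then show "char (distr M borel (\<xi> p)) 1 = (case p of (s, j) \<Rightarrow> char (\<mu> s) (c s t j))"
        using distr_dev[OF p(2), of g s] by (simp add: \<mu>_def p)
    qed
    also have "\<dots> = (\<Prod>s\<in>UNIV. \<Prod>j\<in>{1..total (n s) t}. char (\<mu> s) (c s t j))"
      by (subst prod.Sigma) auto
    finally show ?thesis .
  qed
  have lim: "(\<lambda>t. \<Prod>j\<in>{1..total (n s) t}. char (\<mu> s) (c s t j)) \<longlonglongrightarrow> of_real (exp (- (dev_var g s * (lambda_I \<eta> / nbar s)) / 2))" for s
  proof (rule prod_char_tendsto[OF rd])
    have [measurable]: "dev g s 1 \<in> borel_measurable M" by (simp add: dev_measurable)
    show "integrable (\<mu> s) (\<lambda>x. x)" "(\<integral>x. x \<partial>\<mu> s) = 0" "integrable (\<mu> s) (\<lambda>x. x\<^sup>2)" "(\<integral>x. x\<^sup>2 \<partial>\<mu> s) = dev_var g s"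
      using dev_moments_1[of g s] by (simp_all add: \<mu>_def integral_distr integrable_distr_eq)
    show "\<bar>c s t j\<bar> \<le> window_scale m \<eta> t * (\<Sum>l=1..t. real (m l) / real (total (n s) l))" if "j \<in> {1..total (n s) t}" for t j
    proof -
      have "\<bar>c s t j\<bar> = window_scale m \<eta> t * input_weight m (n s) (dropped \<eta> t) t j"
        unfolding c_def by (intro abs_of_nonneg mult_nonneg_nonneg window_scale_nonneg input_weight_nonneg \<eta>)
      also have "\<dots> \<le> window_scale m \<eta> t * (\<Sum>l=1..t. real (m l) / real (total (n s) l))"
      proof (intro mult_left_mono window_scale_nonneg \<eta> order_trans[OF input_weight_le])
        show "(\<Sum>l=dropped \<eta> t + 1..t. real (m l) / real (total (n s) l)) \<le> (\<Sum>l=1..t. real (m l) / real (total (n s) l))"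
          by (rule sum_mono2) auto
      qed
      finally show ?thesis .
    qed
    show "(\<lambda>t. window_scale m \<eta> t * (\<Sum>l=1..t. real (m l) / real (total (n s) l))) \<longlonglongrightarrow> 0"
      unfolding window_scale_def by (rule input_weight_sup_tendsto[OF n_pos m_bdd m_lim mbar \<eta>])
    show "(\<lambda>t. \<Sum>j\<in>{1..total (n s) t}. (c s t j)\<^sup>2) \<longlonglongrightarrow> lambda_I \<eta> / nbar s"
      unfolding c_def window_scale_def
      by (rule sum_input_weight_square_tendsto[OF m_pos m_bdd n_pos m_lim mbar n_lim nbar \<eta>])
  qed
  have "(\<lambda>t. \<Prod>s\<in>UNIV. \<Prod>j\<in>{1..total (n s) t}. char (\<mu> s) (c s t j))
      \<longlonglongrightarrow> (\<Prod>s\<in>UNIV. of_real (exp (- (dev_var g s * (lambda_I \<eta> / nbar s)) / 2)))"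
    by (intro tendsto_prod lim)
  also have "(\<Prod>s\<in>UNIV. complex_of_real (exp (- (dev_var g s * (lambda_I \<eta> / nbar s)) / 2))) =
      of_real (exp (- (lambda_I \<eta> * (\<Sum>s\<in>UNIV. dev_var g s / nbar s)) / 2))"
    by (simp add: of_real_prod[symmetric] exp_sum[symmetric] sum_negf sum_distrib_left sum_divide_distrib mult_ac
        del: of_real_prod)
  finally show ?thesis unfolding prod sum_dev_var .
qed

end

section \<open>The linearization error\<close>

text \<open>The sequence is constrained from the index 1 on only, because there is no estimate at stage
  0.\<close>

lemma continuous_within_sequence:
  fixes F :: "'a::{first_countable_topology, t2_space} \<Rightarrow> 'b::topological_space"
  assumes F: "continuous (at a within S) F" and x: "\<And>l. l \<ge> 1 \<Longrightarrow> x l \<in> S" "x \<longlonglongrightarrow> a"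
  shows "(\<lambda>l. F (x l)) \<longlonglongrightarrow> F a"
proof -
  have "(\<lambda>l. x (Suc l)) \<longlonglongrightarrow> a" using x(2) by (rule LIMSEQ_Suc)
  then have "(F \<circ> (\<lambda>l. x (Suc l))) \<longlonglongrightarrow> F a"
    using F[unfolded continuous_within_sequentially, rule_format, of "\<lambda>l. x (Suc l)"] x(1) by simp
  then show ?thesis using filterlim_sequentially_Suc[of "\<lambda>l. F (x l)"] by (simp add: comp_def)
qed

lemma norm_cis_diff_le: "norm (cis x - cis y) \<le> min 2 \<bar>x - y\<bar>"
proof -
  have eq: "cis x - cis y = cis y * (cis (x - y) - 1)" by (simp add: right_diff_distrib cis_mult)
  have "norm (cis (x - y) - 1) \<le> \<bar>x - y\<bar>" using iexp_approx1[of "x - y" 0] by (simp add: cis_conv_exp)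
  then have "norm (cis x - cis y) \<le> \<bar>x - y\<bar>" by (simp add: eq norm_mult)
  moreover have "norm (cis x - cis y) \<le> 2" using norm_triangle_ineq4[of "cis x" "cis y"] by simp
  ultimately show ?thesis by simp
qed

lemma mult_le_weighted_squares:
  fixes x y :: real assumes "c > 0"
  shows "x * y \<le> (x\<^sup>2 / c + c * y\<^sup>2) / 2"
proof -
  have "0 \<le> (x - c * y)\<^sup>2 / c" using assms by simp
  also have "(x - c * y)\<^sup>2 / c = x\<^sup>2 / c + c * y\<^sup>2 - 2 * (x * y)"
    using assms by (simp add: power2_eq_square field_simps)
  finally show ?thesis by simp
qed

lemma (in input_data) theta_hat_compose_measurable:
  fixes \<Theta> :: "(real^'d) set" and h :: "real^'d \<Rightarrow> real"
  assumes \<theta>_in: "\<And>\<omega>. \<omega> \<in> space M \<Longrightarrow> theta_hat b n D l \<omega> \<in> \<Theta>" and h: "continuous_on \<Theta> h"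
  shows "(\<lambda>\<omega>. h (theta_hat b n D l \<omega>)) \<in> borel_measurable M"
proof -
  have "theta_hat b n D l \<in> measurable M (restrict_space borel \<Theta>)"
    using \<theta>_in by (intro measurable_restrict_space2) auto
  from measurable_compose[OF this borel_measurable_continuous_on_restrict[OF h]] show ?thesis .
qed

text \<open>The error at stage \<open>l\<close> is \<open>q * d\<close>, with \<open>d\<close> the
  distance of the estimate from \<open>\<theta>c\<close> and \<open>q\<close> the difference quotient,
  which tends to 0 almost surely but need not be integrable. The part of \<open>q\<close> up to 1 has
  second moments tending to 0, so its products with \<open>d\<close> have expectation
  \<open>o (1 / sqrt l)\<close>. The part above 1 vanishes from some random stage on, and contributes a
  fixed sum times a vanishing scale. Bounding the error by 2 before taking expectations is harmless,
  since it enters through characters only.\<close>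

lemma (in input_data) remainder_tendsto:
  fixes \<Theta> :: "(real^'d) set" and h :: "real^'d \<Rightarrow> real"
  assumes \<theta>c: "\<theta>c \<in> \<Theta>" and \<theta>_in: "\<And>t \<omega>. t \<ge> 1 \<Longrightarrow> \<omega> \<in> space M \<Longrightarrow> theta_hat b n D t \<omega> \<in> \<Theta>"
    and h: "continuous_on \<Theta> h" "(h has_derivative (\<lambda>x. g \<bullet> x)) (at \<theta>c within \<Theta>)"
    and m_bdd: "\<And>t. t \<ge> 1 \<Longrightarrow> m t \<le> B"
    and m_lim: "(\<lambda>t. real (total m t) / real t) \<longlonglongrightarrow> mbar" and mbar: "mbar > 0"
    and \<eta>: "0 \<le> \<eta>" "\<eta> < 1"
  shows "(\<lambda>t. \<integral>\<omega>. min 2 \<bar>window_scale m \<eta> t * (\<Sum>l=dropped \<eta> t + 1..t. real (m l) *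
      (h (theta_hat b n D l \<omega>) - h \<theta>c - g \<bullet> (theta_hat b n D l \<omega> - \<theta>c)))\<bar> \<partial>M) \<longlonglongrightarrow> 0"
proof -
  let ?\<theta> = "theta_hat b n D"
  have h_meas: "(\<lambda>\<omega>. h (?\<theta> l \<omega>)) \<in> borel_measurable M" if "l \<ge> 1" for l
    by (rule theta_hat_compose_measurable[OF \<theta>_in[OF that] h(1)])
  define R where "R \<theta> = h \<theta> - h \<theta>c - g \<bullet> (\<theta> - \<theta>c)" for \<theta>
  define q where "q \<theta> = \<bar>R \<theta>\<bar> / norm (\<theta> - \<theta>c)" for \<theta>
  define d where "d l \<omega> = norm (?\<theta> l \<omega> - \<theta>c)" for l \<omega>
  define q' where "q' l \<omega> = min 1 (q (?\<theta> l \<omega>))" for l \<omega>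
  define q'' where "q'' l \<omega> = (q (?\<theta> l \<omega>) - q' l \<omega>) * d l \<omega>" for l \<omega>
  have R_meas: "(\<lambda>\<omega>. R (?\<theta> l \<omega>)) \<in> borel_measurable M" if "l \<ge> 1" for l
    unfolding R_def using h_meas[OF that] by measurable
  have d_meas [measurable]: "d l \<in> borel_measurable M" for l unfolding d_def by measurable
  have q_meas: "(\<lambda>\<omega>. q (?\<theta> l \<omega>)) \<in> borel_measurable M" if "l \<ge> 1" for l
    unfolding q_def using R_meas[OF that] by measurable
  have q'_meas: "q' l \<in> borel_measurable M" if "l \<ge> 1" for l
    unfolding q'_def using q_meas[OF that] by measurable
  have q''_meas: "q'' l \<in> borel_measurable M" if "l \<ge> 1" for l
    unfolding q''_def using q_meas[OF that] q'_meas[OF that] by measurable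
  have q_nonneg: "0 \<le> q \<theta>" for \<theta> by (simp add: q_def)
  have q': "0 \<le> q' l \<omega>" "q' l \<omega> \<le> 1" for l \<omega> using q_nonneg by (auto simp: q'_def)
  have q''_nonneg: "0 \<le> q'' l \<omega>" for l \<omega> unfolding q''_def q'_def d_def by simp
  have R_eq: "\<bar>R (?\<theta> l \<omega>)\<bar> = q' l \<omega> * d l \<omega> + q'' l \<omega>" for l \<omega>
    by (auto simp: q''_def q_def d_def R_def algebra_simps)
  have "((\<lambda>y. (1 / norm (y - \<theta>c)) *\<^sub>R (h y - (h \<theta>c + g \<bullet> (y - \<theta>c)))) \<longlongrightarrow> 0) (at \<theta>c within \<Theta>)"
    using h(2) unfolding has_derivative_within by blast
  from tendsto_norm[OF this] have "(q \<longlongrightarrow> q \<theta>c) (at \<theta>c within \<Theta>)"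
    by (simp add: q_def[abs_def] R_def diff_diff_eq)
  then have q_cont: "continuous (at \<theta>c within \<Theta>) q" by (simp add: continuous_within)
  have q_lim: "AE \<omega> in M. (\<lambda>l. q (?\<theta> l \<omega>)) \<longlonglongrightarrow> 0"
    using AE_space theta_hat_AE_tendsto
  proof eventually_elim
    case (elim \<omega>)
    from continuous_within_sequence[OF q_cont, of "\<lambda>l. ?\<theta> l \<omega>"] elim \<theta>_in show ?case by (simp add: q_def)
  qed
  obtain C where C: "C \<ge> 0" "\<And>l. l \<ge> 1 \<Longrightarrow> integrable M (\<lambda>\<omega>. (d l \<omega>)\<^sup>2)"
    "\<And>l. l \<ge> 1 \<Longrightarrow> (\<integral>\<omega>. (d l \<omega>)\<^sup>2 \<partial>M) \<le> C / real l"
    using theta_hat_second_moment unfolding d_def by blast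
  define y where "y l = (\<integral>\<omega>. (q' l \<omega>)\<^sup>2 \<partial>M)" for l
  have q'_sq_int: "integrable M (\<lambda>\<omega>. (q' l \<omega>)\<^sup>2)" if "l \<ge> 1" for l
  proof (rule integrable_const_bound[of _ 1])
    show "AE \<omega> in M. norm ((q' l \<omega>)\<^sup>2) \<le> 1" using q' by (intro AE_I2) (auto intro: power_le_one)
  qed (use q'_meas[OF that] in measurable)
  have "(\<lambda>l. \<integral>\<omega>. (q' (Suc l) \<omega>)\<^sup>2 \<partial>M) \<longlonglongrightarrow> (\<integral>\<omega>. 0 \<partial>M)"
  proof (rule integral_dominated_convergence[where w="\<lambda>_. 1"])
    show "AE \<omega> in M. (\<lambda>l. (q' (Suc l) \<omega>)\<^sup>2) \<longlonglongrightarrow> 0"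
      using q_lim
    proof eventually_elim
      case (elim \<omega>)
      from LIMSEQ_Suc[OF elim] have "(\<lambda>l. (min 1 (q (?\<theta> (Suc l) \<omega>)))\<^sup>2) \<longlonglongrightarrow> (min 1 0)\<^sup>2"
        by (intro tendsto_intros)
      then show ?case by (simp add: q'_def)
    qed
    show "AE \<omega> in M. norm ((q' (Suc l) \<omega>)\<^sup>2) \<le> 1" for l
      using q' by (intro AE_I2) (auto intro: power_le_one)
    show "(\<lambda>\<omega>. (q' (Suc l) \<omega>)\<^sup>2) \<in> borel_measurable M" for l
      using q'_meas[of "Suc l"] by measurable
  qed auto
  then have y: "y \<longlonglongrightarrow> 0" unfolding y_def using filterlim_sequentially_Suc[of "\<lambda>l. \<integral>\<omega>. (q' l \<omega>)\<^sup>2 \<partial>M"] by simp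
  have y_nonneg: "0 \<le> y l" for l by (simp add: y_def)
  \<comment> \<open>The balance between the two squares; the summand \<open>1 / l\<close> keeps it positive if \<open>y l = 0\<close>.\<close>
  define \<delta> where "\<delta> l = sqrt (y l) + 1 / real l" for l
  have "\<delta> \<longlonglongrightarrow> sqrt 0 + 0" unfolding \<delta>_def by (intro tendsto_intros y lim_1_over_n)
  then have \<delta>_lim: "\<delta> \<longlonglongrightarrow> 0" by simp
  have prod_int: "integrable M (\<lambda>\<omega>. q' l \<omega> * d l \<omega>)"
    and prod_le: "(\<integral>\<omega>. q' l \<omega> * d l \<omega> \<partial>M) \<le> (1 + C) * \<delta> l / sqrt (real l)" if l: "l \<ge> 1" for l
  proof -
    have \<delta>pos: "\<delta> l > 0" using l y_nonneg[of l] by (simp add: \<delta>_def add_nonneg_pos)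
    define c where "c = \<delta> l * sqrt (real l)"
    have c: "c > 0" using \<delta>pos l by (simp add: c_def)
    have d0: "0 \<le> d l \<omega>" for \<omega> by (simp add: d_def)
    have bound: "q' l \<omega> * d l \<omega> \<le> ((q' l \<omega>)\<^sup>2 / c + c * (d l \<omega>)\<^sup>2) / 2" for \<omega>
      by (rule mult_le_weighted_squares[OF c])
    have bi: "integrable M (\<lambda>\<omega>. ((q' l \<omega>)\<^sup>2 / c + c * (d l \<omega>)\<^sup>2) / 2)"
      using q'_sq_int[OF l] C(2)[OF l] by simp
    have q'm: "q' l \<in> borel_measurable M" by (rule q'_meas[OF l])
    show int: "integrable M (\<lambda>\<omega>. q' l \<omega> * d l \<omega>)"
    proof (rule Bochner_Integration.integrable_bound[OF bi])
      show "(\<lambda>\<omega>. q' l \<omega> * d l \<omega>) \<in> borel_measurable M" using q'm by measurable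
      show "AE \<omega> in M. norm (q' l \<omega> * d l \<omega>) \<le> norm (((q' l \<omega>)\<^sup>2 / c + c * (d l \<omega>)\<^sup>2) / 2)"
      proof (intro AE_I2)
        fix \<omega>
        have "0 \<le> q' l \<omega> * d l \<omega>" using q' d0 by simp
        with bound[of \<omega>] show "norm (q' l \<omega> * d l \<omega>) \<le> norm (((q' l \<omega>)\<^sup>2 / c + c * (d l \<omega>)\<^sup>2) / 2)" by simp
      qed
    qed
    have "(\<integral>\<omega>. q' l \<omega> * d l \<omega> \<partial>M) \<le> (\<integral>\<omega>. ((q' l \<omega>)\<^sup>2 / c + c * (d l \<omega>)\<^sup>2) / 2 \<partial>M)"
      by (rule integral_mono[OF int bi bound])
    also have "\<dots> = (y l / c + c * (\<integral>\<omega>. (d l \<omega>)\<^sup>2 \<partial>M)) / 2"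
      using q'_sq_int[OF l] C(2)[OF l] by (simp add: y_def)
    also have "\<dots> \<le> (\<delta> l / sqrt (real l) + C * \<delta> l / sqrt (real l)) / 2"
    proof -
      have "sqrt (y l) * sqrt (y l) \<le> \<delta> l * \<delta> l"
        using y_nonneg[of l] by (intro mult_mono) (auto simp: \<delta>_def)
      then have "y l \<le> \<delta> l * \<delta> l" using y_nonneg[of l] by simp
      then have "y l / c \<le> \<delta> l * \<delta> l / c" using c by (intro divide_right_mono) auto
      also have "\<dots> = \<delta> l / sqrt (real l)" using \<delta>pos by (simp add: c_def)
      finally have 1: "y l / c \<le> \<delta> l / sqrt (real l)" .
      have "c * (\<integral>\<omega>. (d l \<omega>)\<^sup>2 \<partial>M) \<le> c * (C / real l)" using C(3)[OF l] c by (intro mult_left_mono) auto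
      also have "\<dots> = C * \<delta> l * (sqrt (real l) / real l)" by (simp add: c_def)
      also have "sqrt (real l) / real l = 1 / sqrt (real l)" using l by (simp add: field_simps)
      finally have 2: "c * (\<integral>\<omega>. (d l \<omega>)\<^sup>2 \<partial>M) \<le> C * \<delta> l / sqrt (real l)" by simp
      show ?thesis by (intro divide_right_mono add_mono 1 2) simp
    qed
    also have "\<dots> \<le> (1 + C) * \<delta> l / sqrt (real l)"
    proof -
      have "0 \<le> (1 + C) * \<delta> l / sqrt (real l)" using C(1) \<delta>pos by simp
      then show ?thesis by (simp add: algebra_simps add_divide_distrib)
    qed
    finally show "(\<integral>\<omega>. q' l \<omega> * d l \<omega> \<partial>M) \<le> (1 + C) * \<delta> l / sqrt (real l)" .
  qed
  let ?\<tau> = "window_scale m \<eta>"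
  note \<tau>_lim = window_scale_tendsto[OF m_lim mbar \<eta>]
  have \<tau>_nonneg: "0 \<le> ?\<tau> t" for t by (rule window_scale_nonneg[OF \<eta>])
  define U where "U t \<omega> = ?\<tau> t * (real B * (\<Sum>l=1..t. q' l \<omega> * d l \<omega>))" for t \<omega>
  define V where "V t \<omega> = ?\<tau> t * (real B * (\<Sum>l=1..t. q'' l \<omega>))" for t \<omega>
  have U_int: "integrable M (U t)" for t unfolding U_def using prod_int by auto
  have V_meas: "V t \<in> borel_measurable M" for t
    unfolding V_def using q''_meas by (auto intro!: borel_measurable_times borel_measurable_sum)
  have V_nonneg: "0 \<le> V t \<omega>" for t \<omega>
    unfolding V_def by (intro mult_nonneg_nonneg \<tau>_nonneg sum_nonneg q''_nonneg) auto
  have V_int: "integrable M (\<lambda>\<omega>. min 2 (V t \<omega>))" for t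
    by (rule integrable_const_bound[of _ 2]) (use V_nonneg V_meas in \<open>auto intro!: AE_I2\<close>)
  have "(\<lambda>t. \<integral>\<omega>. U t \<omega> \<partial>M) \<longlonglongrightarrow> 0"
  proof (rule Lim_null_comparison[OF always_eventually])
    have "(\<lambda>t. (?\<tau> t * sqrt (real t)) * (real B * ((1 + C) * ((\<Sum>l=1..t. \<delta> l / sqrt (real l)) / sqrt (real t)))))
        \<longlonglongrightarrow> lambda_S \<eta> / mbar * (real B * ((1 + C) * 0))"
      by (intro tendsto_intros \<tau>_lim sqrt_average_null \<delta>_lim)
    then show "(\<lambda>t. (?\<tau> t * sqrt (real t)) * (real B * ((1 + C) * ((\<Sum>l=1..t. \<delta> l / sqrt (real l)) / sqrt (real t)))))
        \<longlonglongrightarrow> 0" by simp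
    show "\<forall>t. norm (\<integral>\<omega>. U t \<omega> \<partial>M) \<le> (?\<tau> t * sqrt (real t)) * (real B * ((1 + C) * ((\<Sum>l=1..t. \<delta> l / sqrt (real l)) / sqrt (real t))))"
    proof
      fix t
      have "0 \<le> U t \<omega>" for \<omega>
        unfolding U_def using q' by (intro mult_nonneg_nonneg \<tau>_nonneg sum_nonneg) (auto simp: d_def)
      then have "norm (\<integral>\<omega>. U t \<omega> \<partial>M) = (\<integral>\<omega>. U t \<omega> \<partial>M)" by simp
      also have "\<dots> = ?\<tau> t * (real B * (\<Sum>l=1..t. \<integral>\<omega>. q' l \<omega> * d l \<omega> \<partial>M))"
        unfolding U_def using prod_int by (simp add: Bochner_Integration.integral_sum)
      also have "\<dots> \<le> ?\<tau> t * (real B * (\<Sum>l=1..t. (1 + C) * \<delta> l / sqrt (real l)))"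
        by (intro mult_left_mono sum_mono prod_le \<tau>_nonneg) auto
      also have "\<dots> = ?\<tau> t * (real B * ((1 + C) * (\<Sum>l=1..t. \<delta> l / sqrt (real l))))"
        by (simp add: sum_distrib_left)
      also have "\<dots> = (?\<tau> t * sqrt (real t)) * (real B * ((1 + C) * ((\<Sum>l=1..t. \<delta> l / sqrt (real l)) / sqrt (real t))))"
        by (cases "t = 0") auto
      finally show "norm (\<integral>\<omega>. U t \<omega> \<partial>M) \<le> (?\<tau> t * sqrt (real t)) * (real B * ((1 + C) * ((\<Sum>l=1..t. \<delta> l / sqrt (real l)) / sqrt (real t))))" .
    qed
  qed
  moreover have "(\<lambda>t. \<integral>\<omega>. min 2 (V t \<omega>) \<partial>M) \<longlonglongrightarrow> (\<integral>\<omega>. 0 \<partial>M)"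
  proof (rule integral_dominated_convergence[where w="\<lambda>_. 2"])
    show "AE \<omega> in M. (\<lambda>t. min 2 (V t \<omega>)) \<longlonglongrightarrow> 0"
      using q_lim
    proof eventually_elim
      case (elim \<omega>)
      have "\<forall>\<^sub>F l in sequentially. q (?\<theta> l \<omega>) < 1" by (rule order_tendstoD(2)[OF elim]) simp
      then obtain L where "\<And>l. l \<ge> L \<Longrightarrow> q (?\<theta> l \<omega>) < 1" unfolding eventually_sequentially by blast
      then have L: "q'' l \<omega> = 0" if "l \<ge> L" for l using that by (simp add: q''_def q'_def less_imp_le)
      have "(\<lambda>t. ?\<tau> t * (real B * (\<Sum>l=1..L. q'' l \<omega>))) \<longlonglongrightarrow> 0 * (real B * (\<Sum>l=1..L. q'' l \<omega>))"
        by (intro tendsto_intros \<tau>_lim)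
      then have "(\<lambda>t. V t \<omega>) \<longlonglongrightarrow> 0 * (real B * (\<Sum>l=1..L. q'' l \<omega>))"
      proof (rule Lim_transform_eventually)
        show "\<forall>\<^sub>F t in sequentially. ?\<tau> t * (real B * (\<Sum>l=1..L. q'' l \<omega>)) = V t \<omega>"
          using eventually_ge_at_top[of L]
        proof eventually_elim
          case (elim t)
          have "(\<Sum>l=1..t. q'' l \<omega>) = (\<Sum>l=1..L. q'' l \<omega>)"
            using elim L by (intro sum.mono_neutral_right) auto
          then show ?case by (simp add: V_def)
        qed
      qed
      then have "(\<lambda>t. min 2 (V t \<omega>)) \<longlonglongrightarrow> min 2 0" by (intro tendsto_intros) simp
      then show ?case by simp
    qed
    show "AE \<omega> in M. norm (min 2 (V t \<omega>)) \<le> 2" for t using V_nonneg by (intro AE_I2) auto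
    show "(\<lambda>\<omega>. min 2 (V t \<omega>)) \<in> borel_measurable M" for t using V_int by auto
  qed auto
  ultimately have lim: "(\<lambda>t. (\<integral>\<omega>. U t \<omega> \<partial>M) + (\<integral>\<omega>. min 2 (V t \<omega>) \<partial>M)) \<longlonglongrightarrow> 0"
    using tendsto_add by fastforce
  have "norm (\<integral>\<omega>. min 2 \<bar>?\<tau> t * (\<Sum>l=dropped \<eta> t + 1..t. real (m l) * R (?\<theta> l \<omega>))\<bar> \<partial>M)
      \<le> (\<integral>\<omega>. U t \<omega> \<partial>M) + (\<integral>\<omega>. min 2 (V t \<omega>) \<partial>M)" for t
  proof -
    define X where "X \<omega> = \<bar>?\<tau> t * (\<Sum>l=dropped \<eta> t + 1..t. real (m l) * R (?\<theta> l \<omega>))\<bar>" for \<omega>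
    have X_meas: "X \<in> borel_measurable M"
      unfolding X_def using R_meas
      by (intro borel_measurable_abs borel_measurable_times borel_measurable_sum) auto
    have X_le: "X \<omega> \<le> U t \<omega> + V t \<omega>" for \<omega>
    proof -
      have "X \<omega> = ?\<tau> t * \<bar>\<Sum>l=dropped \<eta> t + 1..t. real (m l) * R (?\<theta> l \<omega>)\<bar>"
        using \<tau>_nonneg by (simp add: X_def abs_mult)
      also have "\<dots> \<le> ?\<tau> t * (\<Sum>l=dropped \<eta> t + 1..t. real B * \<bar>R (?\<theta> l \<omega>)\<bar>)"
      proof (intro mult_left_mono \<tau>_nonneg order_trans[OF sum_abs] sum_mono)
        fix l assume "l \<in> {dropped \<eta> t + 1..t}"
        then have "m l \<le> B" using m_bdd by simp
        then show "\<bar>real (m l) * R (?\<theta> l \<omega>)\<bar> \<le> real B * \<bar>R (?\<theta> l \<omega>)\<bar>"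
          by (auto simp: abs_mult intro!: mult_right_mono)
      qed
      also have "\<dots> \<le> ?\<tau> t * (\<Sum>l=1..t. real B * \<bar>R (?\<theta> l \<omega>)\<bar>)"
        by (intro mult_left_mono \<tau>_nonneg sum_mono2) auto
      also have "\<dots> = U t \<omega> + V t \<omega>"
        unfolding R_eq U_def V_def
        by (simp add: sum_distrib_left[symmetric] sum.distrib distrib_left)
      finally show ?thesis .
    qed
    have U0: "0 \<le> U t \<omega>" for \<omega>
      unfolding U_def using q' by (intro mult_nonneg_nonneg \<tau>_nonneg sum_nonneg) (auto simp: d_def)
    have "norm (\<integral>\<omega>. min 2 (X \<omega>) \<partial>M) = (\<integral>\<omega>. min 2 (X \<omega>) \<partial>M)" by (simp add: X_def)
    also have "\<dots> \<le> (\<integral>\<omega>. U t \<omega> + min 2 (V t \<omega>) \<partial>M)"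
    proof (rule integral_mono)
      show "integrable M (\<lambda>\<omega>. min 2 (X \<omega>))"
      proof (rule integrable_const_bound[of _ 2])
        show "AE \<omega> in M. norm (min 2 (X \<omega>)) \<le> 2" by (simp add: X_def)
        show "(\<lambda>\<omega>. min 2 (X \<omega>)) \<in> borel_measurable M" using X_meas by measurable
      qed
      show "min 2 (X \<omega>) \<le> U t \<omega> + min 2 (V t \<omega>)" for \<omega>
        using X_le[of \<omega>] U0[of \<omega>] by (simp add: min_def)
    qed (use U_int V_int in auto)
    also have "\<dots> = (\<integral>\<omega>. U t \<omega> \<partial>M) + (\<integral>\<omega>. min 2 (V t \<omega>) \<partial>M)" using U_int V_int by simp
    finally show ?thesis by (simp add: X_def)
  qed
  then show "(\<lambda>t. \<integral>\<omega>. min 2 \<bar>?\<tau> t * (\<Sum>l=dropped \<eta> t + 1..t. real (m l) *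
      (h (?\<theta> l \<omega>) - h \<theta>c - g \<bullet> (?\<theta> l \<omega> - \<theta>c)))\<bar> \<partial>M) \<longlonglongrightarrow> 0"
    unfolding R_def[symmetric] by (intro Lim_null_comparison[OF always_eventually lim] allI)
qed

section \<open>Linear forms of the simulation estimates\<close>

text \<open>The output laws are not assumed to depend measurably on the parameter. What is known is that
  the probabilities of events under the law at an estimate are almost surely equal to measurable
  functions. They are therefore measurable on the completion of the probability space, and expectations
  that involve them are taken there.\<close>

lemma borel_measurable_completion_AE:
  fixes f g :: "'a \<Rightarrow> real"
  assumes f: "f \<in> borel_measurable M" and eq: "AE x in M. f x = g x"
  shows "g \<in> borel_measurable (completion M)"
proof (rule measurableI)
  fix A :: "real set" assume A: "A \<in> sets borel"
  show "g -` A \<inter> space (completion M) \<in> sets (completion M)"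
  proof (rule completion.in_sets_AE)
    show "f -` A \<inter> space M \<in> sets (completion M)" using measurable_sets[OF f A] by auto
    show "AE x in completion M. (x \<in> f -` A \<inter> space M) = (x \<in> g -` A \<inter> space (completion M))"
      using AE_completion[OF eq] by eventually_elim auto
  qed auto
qed simp

locale simulation = input_data M b D n \<theta>c
  for M :: "'w measure" and b :: "'d::finite \<Rightarrow> 's::finite" and D n \<theta>c +
  fixes \<Theta> :: "(real^'d) set" and Q :: "real^'d \<Rightarrow> 'z measure" and X :: "real^'d \<Rightarrow> 'z \<Rightarrow> real^'k"
    and m :: "nat \<Rightarrow> nat" and Y :: "nat \<Rightarrow> nat \<Rightarrow> 'w \<Rightarrow> real^'k"
  assumes \<theta>c_in: "\<theta>c \<in> \<Theta>"
    and theta_hat_in: "\<And>t \<omega>. t \<ge> 1 \<Longrightarrow> \<omega> \<in> space M \<Longrightarrow> theta_hat b n D t \<omega> \<in> \<Theta>"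
    and Q: "\<And>\<theta>. \<theta> \<in> \<Theta> \<Longrightarrow> prob_space (Q \<theta>)"
    and X: "\<And>\<theta>. \<theta> \<in> \<Theta> \<Longrightarrow> X \<theta> \<in> borel_measurable (Q \<theta>)"
    and X_law_continuous: "converges_in_law (output_law Q X) (output_law Q X \<theta>c) (at \<theta>c within \<Theta>)"
    and X_cov: "\<And>\<theta> i j. \<theta> \<in> \<Theta> \<Longrightarrow> covariance_exists (Q \<theta>) (\<lambda>z. X \<theta> z $ i) (\<lambda>z. X \<theta> z $ j)"
    and X_cov_continuous: "continuous_on \<Theta> (output_cov Q X)"
    and m_pos: "\<And>t. t \<ge> 1 \<Longrightarrow> m t \<ge> 1"
    and Y: "\<And>l r. l \<ge> 1 \<Longrightarrow> r \<in> {1..m l} \<Longrightarrow> Y l r \<in> borel_measurable M"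
    and Y_cond: "\<And>J A. finite J \<Longrightarrow> J \<subseteq> {(l, r). l \<ge> 1 \<and> r \<in> {1..m l}} \<Longrightarrow>
      (\<And>l r. (l, r) \<in> J \<Longrightarrow> A l r \<in> sets borel) \<Longrightarrow>
      AE \<omega> in M.
        real_cond_exp M (theta_hat_algebra M b n D)
          (indicator {\<omega>' \<in> space M. \<forall>(l, r)\<in>J. Y l r \<omega>' \<in> A l r}) \<omega>
        = (\<Prod>(l, r)\<in>J. measure (output_law Q X (theta_hat b n D l \<omega>)) (A l r))"
begin

definition stage_law :: "nat \<Rightarrow> 'w \<Rightarrow> (real^'k) measure" where
  "stage_law l \<omega> = output_law Q X (theta_hat b n D l \<omega>)"

lemma output_law_prob: "\<theta> \<in> \<Theta> \<Longrightarrow> prob_space (output_law Q X \<theta>)"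
  unfolding output_law_def by (rule prob_space.prob_space_distr[OF Q X])

lemma stage_law: 
  assumes "l \<ge> 1" "\<omega> \<in> space M"
  shows "prob_space (stage_law l \<omega>)" "sets (stage_law l \<omega>) = sets borel"
  unfolding stage_law_def using output_law_prob[OF theta_hat_in[OF assms]] by (simp_all add: output_law_def)

lemma subalgebra_theta_hat: "subalgebra M (theta_hat_algebra M b n D)"
proof -
  let ?f = "\<lambda>\<omega>. restrict (\<lambda>t. theta_hat b n D t \<omega>) {1..}"
  have f: "?f \<in> measurable M (PiM {1..} (\<lambda>_. borel))" by (rule measurable_restrict) measurable
  have "sets (theta_hat_algebra M b n D) \<subseteq> sets M"
    unfolding theta_hat_algebra_def using measurable_space[OF f] measurable_sets[OF f]
    by (subst sets_vimage_algebra2) auto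
  then show ?thesis by (simp add: subalgebra_def theta_hat_algebra_def)
qed

lemma stage_law_measurable:
  assumes "l \<ge> 1" "A \<in> sets borel"
  shows "(\<lambda>\<omega>. measure (stage_law l \<omega>) A) \<in> borel_measurable (completion M)"
proof (rule borel_measurable_completion_AE)
  show "AE \<omega> in M. real_cond_exp M (theta_hat_algebra M b n D)
      (indicator {\<omega>' \<in> space M. \<forall>(l', r)\<in>{(l, 1)}. Y l' r \<omega>' \<in> A}) \<omega> = measure (stage_law l \<omega>) A"
    \<comment> \<open>Every stage has a first replication, because \<open>m l \<ge> 1\<close>.\<close>
    using Y_cond[of "{(l, 1)}" "\<lambda>_ _. A"] assms m_pos[OF assms(1)] by (simp add: stage_law_def)
qed (rule borel_measurable_cond_exp2)

text \<open>Taking expectations in the description of the conditional law leaves an unconditional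
  identity, which already determines all expectations needed.\<close>

lemma joint_law:
  assumes J: "finite J" "J \<subseteq> {(l, r). l \<ge> 1 \<and> r \<in> {1..m l}}" and A: "\<And>p. p \<in> J \<Longrightarrow> A p \<in> sets borel"
  shows "measure (completion M) {\<omega> \<in> space (completion M). \<forall>p\<in>J. Y (fst p) (snd p) \<omega> \<in> A p} =
    (\<integral>\<omega>. (\<Prod>p\<in>J. measure (stage_law (fst p) \<omega>) (A p)) \<partial>completion M)"
proof -
  interpret F: finite_measure_subalgebra M "theta_hat_algebra M b n D"
    by unfold_locales (rule subalgebra_theta_hat)
  define E where "E = {\<omega> \<in> space M. \<forall>p\<in>J. Y (fst p) (snd p) \<omega> \<in> A p}"
  have Y_J: "Y (fst p) (snd p) \<in> borel_measurable M" if "p \<in> J" for p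
    using Y[of "fst p" "snd p"] that J(2) by auto
  have E: "E \<in> sets M"
    unfolding E_def using J(1) A Y_J
    by (intro sets.sets_Collect_finite_All) (auto intro: measurable_sets_Collect)
  let ?c = "real_cond_exp M (theta_hat_algebra M b n D) (indicator E)"
  have ae: "AE \<omega> in M. ?c \<omega> = (\<Prod>p\<in>J. measure (stage_law (fst p) \<omega>) (A p))"
    using Y_cond[OF J, of "\<lambda>l r. A (l, r)"] A by (simp add: stage_law_def E_def case_prod_unfold)
  have E_int: "integrable M (indicator E :: 'w \<Rightarrow> real)" using E by (simp add: emeasure_eq_measure)
  have "measure (completion M) E = measure M E" using E by simp
  also have "\<dots> = (\<integral>\<omega>. indicator E \<omega> \<partial>M)"
    using sets.sets_into_space[OF E] by (simp add: Int_absorb2)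
  also have "\<dots> = (\<integral>\<omega>. ?c \<omega> \<partial>M)" using F.real_cond_exp_int(2)[OF E_int] by simp
  also have "\<dots> = (\<integral>\<omega>. ?c \<omega> \<partial>completion M)" by (rule integral_completion[symmetric]) (rule borel_measurable_cond_exp2)
  also have "\<dots> = (\<integral>\<omega>. (\<Prod>p\<in>J. measure (stage_law (fst p) \<omega>) (A p)) \<partial>completion M)"
  proof (rule integral_cong_AE)
    show "?c \<in> borel_measurable (completion M)" by (rule measurable_completion[OF borel_measurable_cond_exp2])
    show "(\<lambda>\<omega>. \<Prod>p\<in>J. measure (stage_law (fst p) \<omega>) (A p)) \<in> borel_measurable (completion M)"
      using J(2) A by (intro borel_measurable_prod stage_law_measurable) auto
    show "AE \<omega> in completion M. ?c \<omega> = (\<Prod>p\<in>J. measure (stage_law (fst p) \<omega>) (A p))"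
      by (rule AE_completion[OF ae])
  qed
  finally show ?thesis by (simp add: E_def)
qed

definition form_mean :: "real^'k \<Rightarrow> real^'d \<Rightarrow> real" where
  "form_mean v \<theta> = (\<integral>z. v \<bullet> X \<theta> z \<partial>Q \<theta>)"

definition noise_char :: "real^'k \<Rightarrow> real \<Rightarrow> real^'d \<Rightarrow> complex" where
  "noise_char v \<tau> \<theta> = (\<integral>z. cis (\<tau> * (v \<bullet> X \<theta> z - form_mean v \<theta>)) \<partial>Q \<theta>)"

lemma output_moments:
  assumes \<theta>: "\<theta> \<in> \<Theta>"
  shows "integrable (Q \<theta>) (\<lambda>z. v \<bullet> X \<theta> z)"
    and "form_mean v \<theta> = (\<Sum>i\<in>UNIV. v $ i * output_mean Q X i \<theta>)"
    and "integrable (Q \<theta>) (\<lambda>z. (v \<bullet> X \<theta> z - form_mean v \<theta>)\<^sup>2)"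
    and "(\<integral>z. (v \<bullet> X \<theta> z - form_mean v \<theta>)\<^sup>2 \<partial>Q \<theta>) = v \<bullet> (output_cov Q X \<theta> *v v)"
proof -
  interpret Q: prob_space "Q \<theta>" by (rule Q[OF \<theta>])
  have int: "integrable (Q \<theta>) (\<lambda>z. X \<theta> z $ i)" for i using X_cov[OF \<theta>, of i i] by (simp add: covariance_exists_def)
  then show "integrable (Q \<theta>) (\<lambda>z. v \<bullet> X \<theta> z)" by (simp add: inner_vec_def)
  show mean: "form_mean v \<theta> = (\<Sum>i\<in>UNIV. v $ i * output_mean Q X i \<theta>)"
    using int by (simp add: form_mean_def output_mean_def inner_vec_def Bochner_Integration.integral_sum)
  let ?c = "\<lambda>i z. X \<theta> z $ i - output_mean Q X i \<theta>"
  have "v \<bullet> X \<theta> z - form_mean v \<theta> = (\<Sum>i\<in>UNIV. v $ i * ?c i z)" for z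
    by (simp add: mean inner_vec_def right_diff_distrib sum_subtractf)
  then have eq: "(v \<bullet> X \<theta> z - form_mean v \<theta>)\<^sup>2 = (\<Sum>i\<in>UNIV. \<Sum>j\<in>UNIV. v $ i * v $ j * (?c i z * ?c j z))" for z
    by (simp add: power2_eq_square sum_product mult_ac)
  have int2: "integrable (Q \<theta>) (\<lambda>z. ?c i z * ?c j z)" for i j
    using X_cov[OF \<theta>, of i j] by (simp add: covariance_exists_def output_mean_def)
  show "integrable (Q \<theta>) (\<lambda>z. (v \<bullet> X \<theta> z - form_mean v \<theta>)\<^sup>2)" unfolding eq using int2 by auto
  show "(\<integral>z. (v \<bullet> X \<theta> z - form_mean v \<theta>)\<^sup>2 \<partial>Q \<theta>) = v \<bullet> (output_cov Q X \<theta> *v v)"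
    unfolding eq using int2
    by (simp add: Bochner_Integration.integral_sum output_cov_def covariance_def output_mean_def inner_vec_def
        matrix_vector_mult_def sum_distrib_left mult_ac)
qed

lemma stage_law_char:
  assumes "l \<ge> 1" "\<omega> \<in> space M"
  shows "(\<integral>y. cis (\<tau> * (v \<bullet> y)) \<partial>stage_law l \<omega>) =
    cis (\<tau> * form_mean v (theta_hat b n D l \<omega>)) * noise_char v \<tau> (theta_hat b n D l \<omega>)"
proof -
  let ?\<theta> = "theta_hat b n D l \<omega>"
  have \<theta>: "?\<theta> \<in> \<Theta>" by (rule theta_hat_in[OF assms])
  have "(\<integral>y. cis (\<tau> * (v \<bullet> y)) \<partial>stage_law l \<omega>) = (\<integral>z. cis (\<tau> * (v \<bullet> X ?\<theta> z)) \<partial>Q ?\<theta>)"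
    unfolding stage_law_def output_law_def using X[OF \<theta>] by (subst integral_distr) (auto simp: cis_conv_exp)
  also have "\<dots> = (\<integral>z. cis (\<tau> * form_mean v ?\<theta>) * cis (\<tau> * (v \<bullet> X ?\<theta> z - form_mean v ?\<theta>)) \<partial>Q ?\<theta>)"
    by (simp add: cis_mult right_diff_distrib)
  finally show ?thesis by (simp add: noise_char_def)
qed

lemma noise_char_le: "\<theta> \<in> \<Theta> \<Longrightarrow> norm (noise_char v \<tau> \<theta>) \<le> 1"
proof -
  assume \<theta>: "\<theta> \<in> \<Theta>"
  interpret Q: prob_space "Q \<theta>" by (rule Q[OF \<theta>])
  have "norm (noise_char v \<tau> \<theta>) \<le> (\<integral>z. norm (cis (\<tau> * (v \<bullet> X \<theta> z - form_mean v \<theta>))) \<partial>Q \<theta>)"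
    unfolding noise_char_def by (rule integral_norm_bound)
  then show ?thesis by (simp add: Q.prob_space)
qed

text \<open>This is deterministic: \<open>x\<close> stands for one trajectory of the estimates.\<close>

lemma noise_prod_tendsto:
  assumes m_lim: "(\<lambda>t. real (total m t) / real t) \<longlonglongrightarrow> mbar" and mbar: "mbar > 0"
    and \<eta>: "0 \<le> \<eta>" "\<eta> < 1" and mean_cont: "continuous_on \<Theta> (form_mean v)"
    and x: "\<And>l. l \<ge> 1 \<Longrightarrow> x l \<in> \<Theta>" "x \<longlonglongrightarrow> \<theta>c"
  shows "(\<lambda>t. \<Prod>p\<in>(SIGMA l:{dropped \<eta> t + 1..t}. {1..m l}). noise_char v (window_scale m \<eta> t) (x (fst p)))
    \<longlonglongrightarrow> of_real (exp (- (lambda_S \<eta> / mbar * (v \<bullet> (output_cov Q X \<theta>c *v v))) / 2))"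
proof -
  \<comment> \<open>A harmless value at index 0, so that every law in the sequence belongs to \<open>\<Theta>\<close>.\<close>
  define x' where "x' l = (if l = 0 then \<theta>c else x l)" for l
  have x'_in: "x' l \<in> \<Theta>" for l using x(1) \<theta>c_in by (simp add: x'_def)
  have "(\<lambda>l. x' (Suc l)) \<longlonglongrightarrow> \<theta>c" using LIMSEQ_Suc[OF x(2)] by (simp add: x'_def)
  then have x'_lim: "x' \<longlonglongrightarrow> \<theta>c" using filterlim_sequentially_Suc[of x'] by simp
  have mean_lim: "(\<lambda>l. form_mean v (x' l)) \<longlonglongrightarrow> form_mean v \<theta>c"
    by (rule continuous_within_sequence[OF _ _ x'_lim])
      (use mean_cont \<theta>c_in x'_in in \<open>auto simp: continuous_on_eq_continuous_within\<close>)
  have cov_lim: "(\<lambda>l. output_cov Q X (x' l)) \<longlonglongrightarrow> output_cov Q X \<theta>c"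
    by (rule continuous_within_sequence[OF _ _ x'_lim])
      (use X_cov_continuous \<theta>c_in x'_in in \<open>auto simp: continuous_on_eq_continuous_within\<close>)
  have quad_lim: "(\<lambda>l. v \<bullet> (output_cov Q X (x' l) *v v)) \<longlonglongrightarrow> v \<bullet> (output_cov Q X \<theta>c *v v)"
    unfolding matrix_quadratic_form by (intro tendsto_intros cov_lim)
  let ?V = "\<lambda>l z. v \<bullet> X (x' l) z" and ?a = "\<lambda>l. form_mean v (x' l)"
  have var_lim: "(\<lambda>l. \<integral>z. (?V l z - ?a l)\<^sup>2 \<partial>Q (x' l)) \<longlonglongrightarrow> v \<bullet> (output_cov Q X \<theta>c *v v)"
    using quad_lim output_moments(4)[OF x'_in] by simp
  have V_meas: "?V l \<in> borel_measurable (Q (x' l))" for l using X[OF x'_in] by measurable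
  have weak: "(\<lambda>l. \<integral>z. f (?V l z) \<partial>Q (x' l)) \<longlonglongrightarrow> (\<integral>z. f (v \<bullet> X \<theta>c z) \<partial>Q \<theta>c)"
    if f: "continuous_on UNIV f" "bounded (range f)" for f :: "real \<Rightarrow> real"
  proof -
    have fv: "continuous_on UNIV (\<lambda>y. f (v \<bullet> y))"
      by (rule continuous_on_compose2[OF f(1)]) (auto intro!: continuous_intros)
    have fm: "(\<lambda>y. f (v \<bullet> y)) \<in> borel_measurable borel" by (rule borel_measurable_continuous_onI[OF fv])
    have eq: "(\<integral>y. f (v \<bullet> y) \<partial>output_law Q X \<theta>) = (\<integral>z. f (v \<bullet> X \<theta> z) \<partial>Q \<theta>)" if "\<theta> \<in> \<Theta>" for \<theta>
      unfolding output_law_def using integral_distr[OF X[OF that] fm] .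
    have "bounded (range (\<lambda>y. f (v \<bullet> y)))" by (rule bounded_subset[OF f(2)]) auto
    then have "continuous (at \<theta>c within \<Theta>) (\<lambda>\<theta>. \<integral>y. f (v \<bullet> y) \<partial>output_law Q X \<theta>)"
      using X_law_continuous fv unfolding converges_in_law_def continuous_within by blast
    from continuous_within_sequence[OF this x'_in x'_lim] show ?thesis
      by (simp add: eq x'_in \<theta>c_in)
  qed
  have "(\<lambda>t. \<Prod>(l, r)\<in>(SIGMA l:{dropped \<eta> t + 1..t}. {1..m l}). \<integral>z. cis (window_scale m \<eta> t * (?V l z - ?a l)) \<partial>Q (x' l))
    \<longlonglongrightarrow> of_real (exp (- (lambda_S \<eta> / mbar * (v \<bullet> (output_cov Q X \<theta>c *v v))) / 2))"
  proof (rule prod_noise_char_tendsto[OF m_lim mbar \<eta>])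
    fix l
    show "prob_space (Q (x' l))" by (rule Q[OF x'_in])
    then interpret Q: prob_space "Q (x' l)" .
    show "(\<lambda>z. ?V l z - ?a l) \<in> borel_measurable (Q (x' l))" using V_meas by measurable
    show "integrable (Q (x' l)) (\<lambda>z. ?V l z - ?a l)" using output_moments(1)[OF x'_in] by simp
    show "(\<integral>z. ?V l z - ?a l \<partial>Q (x' l)) = 0"
      using output_moments(1)[OF x'_in] by (simp add: form_mean_def Q.prob_space)
    show "integrable (Q (x' l)) (\<lambda>z. (?V l z - ?a l)\<^sup>2)" by (rule output_moments(3)[OF x'_in])
  next
    fix \<epsilon> :: real assume "\<epsilon> > 0"
    show "\<exists>\<tau>0>0. \<exists>L. \<forall>l\<ge>L. \<forall>\<tau>. \<bar>\<tau>\<bar> \<le> \<tau>0 \<longrightarrow>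
        (\<integral>z. min (6 * (?V l z - ?a l)\<^sup>2) (\<bar>\<tau>\<bar> * \<bar>?V l z - ?a l\<bar> ^ 3) \<partial>Q (x' l)) \<le> \<epsilon>"
      by (rule uniform_lindeberg[where ?P0.0="Q \<theta>c" and ?V0.0="\<lambda>z. v \<bullet> X \<theta>c z" and ?a0.0="form_mean v \<theta>c"])
        (use Q X V_meas x'_in \<theta>c_in output_moments(3,4) weak mean_lim var_lim \<open>\<epsilon> > 0\<close> in auto)
  qed (rule var_lim)
  moreover have "(\<Prod>(l, r)\<in>(SIGMA l:{dropped \<eta> t + 1..t}. {1..m l}). \<integral>z. cis (window_scale m \<eta> t * (?V l z - ?a l)) \<partial>Q (x' l)) =
     (\<Prod>p\<in>(SIGMA l:{dropped \<eta> t + 1..t}. {1..m l}). noise_char v (window_scale m \<eta> t) (x (fst p)))" for t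
    by (rule prod.cong) (auto simp: noise_char_def x'_def)
  ultimately show ?thesis by simp
qed

text \<open>Conditioning on the estimates replaces each replication by its characteristic function under
  the estimate of its stage. Centring these at their own means leaves a phase, which carries the input
  error.\<close>

lemma output_char_factorization:
  assumes mean_cont: "continuous_on \<Theta> (form_mean v)" and J: "J = (SIGMA l:{p+1..t}. {1..m l})"
  shows "\<And>l. l \<ge> 1 \<Longrightarrow> (\<lambda>\<omega>. noise_char v \<tau> (theta_hat b n D l \<omega>)) \<in> borel_measurable (completion M)"
    and "(\<integral>\<omega>. cis (\<tau> * (\<Sum>q\<in>J. v \<bullet> Y (fst q) (snd q) \<omega> - form_mean v \<theta>c)) \<partial>M) =
      (\<integral>\<omega>. cis (\<tau> * (\<Sum>l=p+1..t. real (m l) * (form_mean v (theta_hat b n D l \<omega>) - form_mean v \<theta>c)))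
        * (\<Prod>q\<in>J. noise_char v \<tau> (theta_hat b n D (fst q) \<omega>)) \<partial>completion M)"
proof -
  let ?\<theta> = "theta_hat b n D"
  interpret C: prob_space "completion M" by (rule prob_space_completion)
  have sp: "space (completion M) = space M" by simp
  have J_fin: "finite J" "J \<subseteq> {(l, r). l \<ge> 1 \<and> r \<in> {1..m l}}" unfolding J by auto
  have J_l: "fst q \<ge> 1" "snd q \<in> {1..m (fst q)}" if "q \<in> J" for q using J_fin(2) that by auto
  have h_meas: "(\<lambda>y. cis (\<tau> * (v \<bullet> y))) \<in> borel_measurable borel" for v :: "real^'k" unfolding cis_conv_exp by measurable
  have mean_meas: "(\<lambda>\<omega>. form_mean v (?\<theta> l \<omega>)) \<in> borel_measurable (completion M)" if "l \<ge> 1" for l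
    by (rule measurable_completion[OF theta_hat_compose_measurable[OF theta_hat_in[OF that] mean_cont]])
  have kernel_meas: "(\<lambda>\<omega>. \<integral>y. cis (\<tau> * (v \<bullet> y)) \<partial>stage_law l \<omega>) \<in> borel_measurable (completion M)" if "l \<ge> 1" for l
  proof (rule C.expectation_kernel_step(1)[where N=borel and Z="\<lambda>_. 0" and G="\<lambda>_. 0" and G'="\<lambda>_. 0"])
    show "(\<lambda>\<omega>. measure (stage_law l \<omega>) A) \<in> borel_measurable (completion M)" if "A \<in> sets borel" for A
      by (rule stage_law_measurable[OF \<open>l \<ge> 1\<close> that])
  qed (use stage_law[OF that] h_meas in auto)
  show noise_meas: "(\<lambda>\<omega>. noise_char v \<tau> (?\<theta> l \<omega>)) \<in> borel_measurable (completion M)" if "l \<ge> 1" for l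
  proof -
    have eq: "noise_char v \<tau> (?\<theta> l \<omega>) = cis (- (\<tau> * form_mean v (?\<theta> l \<omega>))) * (\<integral>y. cis (\<tau> * (v \<bullet> y)) \<partial>stage_law l \<omega>)"
      if "\<omega> \<in> space (completion M)" for \<omega>
      using stage_law_char[OF \<open>l \<ge> 1\<close>, of \<omega> \<tau> v] that by (simp add: cis_mult mult.assoc[symmetric])
    have "(\<lambda>\<omega>. cis (- (\<tau> * form_mean v (?\<theta> l \<omega>))) * (\<integral>y. cis (\<tau> * (v \<bullet> y)) \<partial>stage_law l \<omega>)) \<in> borel_measurable (completion M)"
      using mean_meas[OF that] kernel_meas[OF that] unfolding cis_conv_exp by measurable
    then show ?thesis by (subst measurable_cong[OF eq])
  qed
  have Y_J: "Y (fst q) (snd q) \<in> borel_measurable M" if "q \<in> J" for q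
    using Y J_l[OF that] by blast
  have joint: "(\<integral>\<omega>. (\<Prod>q\<in>J. cis (\<tau> * (v \<bullet> Y (fst q) (snd q) \<omega>))) \<partial>completion M) =
      (\<integral>\<omega>. (\<Prod>q\<in>J. \<integral>y. cis (\<tau> * (v \<bullet> y)) \<partial>stage_law (fst q) \<omega>) \<partial>completion M)"
    by (rule C.expectation_conditionally_independent(2)[OF J_fin(1), where N=borel and
          Z="\<lambda>q. Y (fst q) (snd q)" and \<kappa>="\<lambda>q. stage_law (fst q)" and h="\<lambda>_ y. cis (\<tau> * (v \<bullet> y))"])
      (use J_l stage_law stage_law_measurable joint_law[OF J_fin] h_meas measurable_completion[OF Y_J] in auto)
  define c where "c = cis (- (\<tau> * (real (card J) * form_mean v \<theta>c)))"
  have cis_sum: "cis (\<Sum>q\<in>J. f q) = (\<Prod>q\<in>J. cis (f q))" for f :: "nat \<times> nat \<Rightarrow> real"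
    by (simp add: cis_conv_exp sum_distrib_left exp_sum[OF J_fin(1)])
  have sumJ: "(\<Sum>q\<in>J. f (fst q)) = (\<Sum>l=p+1..t. real (m l) * f l)" for f :: "nat \<Rightarrow> real"
  proof -
    have "(\<Sum>q\<in>J. f (fst q)) = (\<Sum>(l, r)\<in>J. f l)" by (simp add: case_prod_unfold)
    then show ?thesis unfolding J by (subst (asm) sum.Sigma[symmetric]) auto
  qed
  have meas: "(\<lambda>\<omega>. \<Prod>q\<in>J. cis (\<tau> * (v \<bullet> Y (fst q) (snd q) \<omega>))) \<in> borel_measurable M"
    by (intro borel_measurable_prod measurable_compose[OF Y_J h_meas])
  have "(\<integral>\<omega>. cis (\<tau> * (\<Sum>q\<in>J. v \<bullet> Y (fst q) (snd q) \<omega> - form_mean v \<theta>c)) \<partial>M) =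
      (\<integral>\<omega>. c * (\<Prod>q\<in>J. cis (\<tau> * (v \<bullet> Y (fst q) (snd q) \<omega>))) \<partial>M)"
    unfolding c_def cis_sum[symmetric]
    by (simp add: cis_mult sum_subtractf sum_distrib_left right_diff_distrib)
  also have "\<dots> = c * (\<integral>\<omega>. (\<Prod>q\<in>J. cis (\<tau> * (v \<bullet> Y (fst q) (snd q) \<omega>))) \<partial>completion M)"
    by (simp add: integral_completion[OF meas])
  also have "\<dots> = (\<integral>\<omega>. c * (\<Prod>q\<in>J. \<integral>y. cis (\<tau> * (v \<bullet> y)) \<partial>stage_law (fst q) \<omega>) \<partial>completion M)"
    unfolding joint by simp
  also have "\<dots> = (\<integral>\<omega>. cis (\<tau> * (\<Sum>l=p+1..t. real (m l) * (form_mean v (?\<theta> l \<omega>) - form_mean v \<theta>c)))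
        * (\<Prod>q\<in>J. noise_char v \<tau> (?\<theta> (fst q) \<omega>)) \<partial>completion M)"
  proof (rule Bochner_Integration.integral_cong[OF refl])
    fix \<omega> assume "\<omega> \<in> space (completion M)"
    then have "(\<Prod>q\<in>J. \<integral>y. cis (\<tau> * (v \<bullet> y)) \<partial>stage_law (fst q) \<omega>) =
        (\<Prod>q\<in>J. cis (\<tau> * form_mean v (?\<theta> (fst q) \<omega>)) * noise_char v \<tau> (?\<theta> (fst q) \<omega>))"
      using J_l by (intro prod.cong refl stage_law_char) auto
    also have "\<dots> = cis (\<Sum>q\<in>J. \<tau> * form_mean v (?\<theta> (fst q) \<omega>)) * (\<Prod>q\<in>J. noise_char v \<tau> (?\<theta> (fst q) \<omega>))"
      unfolding cis_sum by (rule prod.distrib)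
    finally have "c * (\<Prod>q\<in>J. \<integral>y. cis (\<tau> * (v \<bullet> y)) \<partial>stage_law (fst q) \<omega>) =
        cis ((\<Sum>q\<in>J. \<tau> * form_mean v (?\<theta> (fst q) \<omega>)) - \<tau> * (real (card J) * form_mean v \<theta>c)) * (\<Prod>q\<in>J. noise_char v \<tau> (?\<theta> (fst q) \<omega>))"
      by (simp add: c_def cis_mult mult.assoc[symmetric])
    also have "(\<Sum>q\<in>J. \<tau> * form_mean v (?\<theta> (fst q) \<omega>)) - \<tau> * (real (card J) * form_mean v \<theta>c) =
        \<tau> * (\<Sum>q\<in>J. form_mean v (?\<theta> (fst q) \<omega>) - form_mean v \<theta>c)"
      by (simp add: sum_subtractf sum_distrib_left right_diff_distrib)
    also have "(\<Sum>q\<in>J. form_mean v (?\<theta> (fst q) \<omega>) - form_mean v \<theta>c) = (\<Sum>l=p+1..t. real (m l) * (form_mean v (?\<theta> l \<omega>) - form_mean v \<theta>c))"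
      by (rule sumJ)
    finally show "c * (\<Prod>q\<in>J. \<integral>y. cis (\<tau> * (v \<bullet> y)) \<partial>stage_law (fst q) \<omega>) =
       cis (\<tau> * (\<Sum>l=p+1..t. real (m l) * (form_mean v (?\<theta> l \<omega>) - form_mean v \<theta>c))) * (\<Prod>q\<in>J. noise_char v \<tau> (?\<theta> (fst q) \<omega>))" .
  qed
  finally show "(\<integral>\<omega>. cis (\<tau> * (\<Sum>q\<in>J. v \<bullet> Y (fst q) (snd q) \<omega> - form_mean v \<theta>c)) \<partial>M) =
      (\<integral>\<omega>. cis (\<tau> * (\<Sum>l=p+1..t. real (m l) * (form_mean v (?\<theta> l \<omega>) - form_mean v \<theta>c)))
        * (\<Prod>q\<in>J. noise_char v \<tau> (?\<theta> (fst q) \<omega>)) \<partial>completion M)" .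
qed

text \<open>In the proof, \<open>E\<close> is the phase, \<open>A\<close> its linearization and
  \<open>\<Phi>\<close> the centred product. Here \<open>E * \<Phi>\<close> differs from
  \<open>A * cS\<close> by the convergence of \<open>\<Phi>\<close> to the constant \<open>cS\<close>
  and by the linearization error. The expectation of \<open>A\<close> converges by the central limit
  theorem for the input part.\<close>

theorem scalar_char_tendsto:
  assumes mean_cont: "continuous_on \<Theta> (form_mean v)"
    and mean_deriv: "(form_mean v has_derivative (\<lambda>x. g \<bullet> x)) (at \<theta>c within \<Theta>)"
    and m_bdd: "\<And>t. t \<ge> 1 \<Longrightarrow> m t \<le> B"
    and m_lim: "(\<lambda>t. real (total m t) / real t) \<longlonglongrightarrow> mbar" and mbar: "mbar > 0"
    and n_lim: "\<And>s. (\<lambda>t. real (total (n s) t) / real t) \<longlonglongrightarrow> nbar s" and nbar: "\<And>s. nbar s > 0"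
    and \<eta>: "0 \<le> \<eta>" "\<eta> < 1"
  shows "(\<lambda>t. \<integral>\<omega>. cis (window_scale m \<eta> t *
      (\<Sum>q\<in>(SIGMA l:{dropped \<eta> t + 1..t}. {1..m l}). v \<bullet> Y (fst q) (snd q) \<omega> - form_mean v \<theta>c)) \<partial>M)
    \<longlonglongrightarrow> of_real (exp (- (lambda_I \<eta> * (g \<bullet> (Sigma_D_bar M b nbar D *v g))
        + lambda_S \<eta> / mbar * (v \<bullet> (output_cov Q X \<theta>c *v v))) / 2))"
proof -
  let ?\<theta> = "theta_hat b n D" and ?\<tau> = "window_scale m \<eta>" and ?J = "\<lambda>t. SIGMA l:{dropped \<eta> t + 1..t}. {1..m l}"
  define sI sS where "sI = lambda_I \<eta> * (g \<bullet> (Sigma_D_bar M b nbar D *v g))"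
    and "sS = lambda_S \<eta> / mbar * (v \<bullet> (output_cov Q X \<theta>c *v v))"
  interpret C: prob_space "completion M" by (rule prob_space_completion)
  define \<Phi> where "\<Phi> t \<omega> = (\<Prod>q\<in>?J t. noise_char v (?\<tau> t) (?\<theta> (fst q) \<omega>))" for t \<omega>
  define E where "E t \<omega> = cis (?\<tau> t * (\<Sum>l=dropped \<eta> t + 1..t. real (m l) * (form_mean v (?\<theta> l \<omega>) - form_mean v \<theta>c)))" for t \<omega>
  define A where "A t \<omega> = cis (?\<tau> t * (\<Sum>l=dropped \<eta> t + 1..t. real (m l) * (g \<bullet> (?\<theta> l \<omega> - \<theta>c))))" for t \<omega>
  define cS where "cS = complex_of_real (exp (- sS / 2))"
  have J_l: "fst q \<ge> 1" if "q \<in> ?J t" for q t using that by auto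
  have mean_meas: "(\<lambda>\<omega>. form_mean v (?\<theta> l \<omega>)) \<in> borel_measurable M" if "l \<ge> 1" for l
    by (rule theta_hat_compose_measurable[OF theta_hat_in[OF that] mean_cont])
  have \<Phi>_meas [measurable]: "\<Phi> t \<in> borel_measurable (completion M)" for t
    unfolding \<Phi>_def using J_l
    by (intro borel_measurable_prod output_char_factorization(1)[OF mean_cont refl]) auto
  have E_meas0 [measurable]: "E t \<in> borel_measurable M" for t
    unfolding E_def cis_conv_exp using mean_meas
    by (intro measurable_compose[OF _ borel_measurable_continuous_onI[OF continuous_on_exp]] borel_measurable_times
        borel_measurable_of_real borel_measurable_sum borel_measurable_diff) (auto intro: continuous_intros)
  have A_meas0 [measurable]: "A t \<in> borel_measurable M" for t
    unfolding A_def cis_conv_exp by measurable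
  have E_meas [measurable]: "E t \<in> borel_measurable (completion M)" for t by (rule measurable_completion[OF E_meas0])
  have A_meas [measurable]: "A t \<in> borel_measurable (completion M)" for t by (rule measurable_completion[OF A_meas0])
  have \<Phi>_le: "norm (\<Phi> t \<omega>) \<le> 1" if "\<omega> \<in> space M" for t \<omega>
    unfolding \<Phi>_def prod_norm[symmetric]
    by (intro prod_le_1) (use that theta_hat_in noise_char_le in auto)
  have EA_le: "norm (E t \<omega>) = 1" "norm (A t \<omega>) = 1" for t \<omega> by (simp_all add: E_def A_def)
  have v0: "0 \<le> v \<bullet> (output_cov Q X \<theta>c *v v)"
    unfolding output_moments(4)[OF \<theta>c_in, symmetric] by simp
  have "0 \<le> sS" unfolding sS_def using v0 mbar \<eta> by (simp add: lambda_S_def)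
  then have cS_le: "norm cS \<le> 1" by (simp add: cS_def)
  have "AE \<omega> in completion M. (\<lambda>t. norm (\<Phi> t \<omega> - cS)) \<longlonglongrightarrow> 0"
    using AE_space AE_completion[OF theta_hat_AE_tendsto]
  proof eventually_elim
    case (elim \<omega>)
    have "(\<lambda>t. \<Phi> t \<omega>) \<longlonglongrightarrow> cS"
      unfolding \<Phi>_def cS_def sS_def
      by (rule noise_prod_tendsto[OF m_lim mbar \<eta> mean_cont]) (use elim theta_hat_in in auto)
    then show ?case by (simp add: tendsto_norm_zero LIM_zero)
  qed
  then have "(\<lambda>t. \<integral>\<omega>. norm (\<Phi> t \<omega> - cS) \<partial>completion M) \<longlonglongrightarrow> (\<integral>\<omega>. 0 \<partial>completion M)"
  proof (intro integral_dominated_convergence[where w="\<lambda>_. 2"])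
    show "AE \<omega> in completion M. norm (norm (\<Phi> t \<omega> - cS)) \<le> 2" for t
    proof (intro AE_I2)
      fix \<omega> assume "\<omega> \<in> space (completion M)"
      then show "norm (norm (\<Phi> t \<omega> - cS)) \<le> 2"
        using norm_triangle_ineq4[of "\<Phi> t \<omega>" cS] \<Phi>_le[of \<omega> t] cS_le by simp
    qed
  qed auto
  then have lim1: "(\<lambda>t. \<integral>\<omega>. norm (\<Phi> t \<omega> - cS) \<partial>completion M) \<longlonglongrightarrow> 0" by simp
  define r where "r t \<omega> = min 2 \<bar>?\<tau> t * (\<Sum>l=dropped \<eta> t + 1..t. real (m l) *
      (form_mean v (?\<theta> l \<omega>) - form_mean v \<theta>c - g \<bullet> (?\<theta> l \<omega> - \<theta>c)))\<bar>" for t \<omega>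
  have r_meas [measurable]: "r t \<in> borel_measurable M" for t
    unfolding r_def using mean_meas
    by (intro borel_measurable_min borel_measurable_abs borel_measurable_times borel_measurable_sum borel_measurable_diff
        borel_measurable_inner) auto
  have lim2: "(\<lambda>t. \<integral>\<omega>. r t \<omega> \<partial>M) \<longlonglongrightarrow> 0"
    unfolding r_def by (rule remainder_tendsto[OF \<theta>c_in theta_hat_in mean_cont mean_deriv m_bdd m_lim mbar \<eta>])
  have EA: "norm (E t \<omega> - A t \<omega>) \<le> r t \<omega>" for t \<omega>
  proof -
    have eq: "?\<tau> t * (\<Sum>l=dropped \<eta> t + 1..t. real (m l) * (form_mean v (?\<theta> l \<omega>) - form_mean v \<theta>c)) -
       ?\<tau> t * (\<Sum>l=dropped \<eta> t + 1..t. real (m l) * (g \<bullet> (?\<theta> l \<omega> - \<theta>c))) =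
       ?\<tau> t * (\<Sum>l=dropped \<eta> t + 1..t. real (m l) * (form_mean v (?\<theta> l \<omega>) - form_mean v \<theta>c - g \<bullet> (?\<theta> l \<omega> - \<theta>c)))"
      by (simp only: right_diff_distrib[symmetric] sum_subtractf[symmetric])
    show ?thesis unfolding E_def A_def r_def eq[symmetric] by (rule norm_cis_diff_le)
  qed
  have bound: "norm ((\<integral>\<omega>. E t \<omega> * \<Phi> t \<omega> \<partial>completion M) - (\<integral>\<omega>. A t \<omega> \<partial>M) * cS) \<le>
      (\<integral>\<omega>. norm (\<Phi> t \<omega> - cS) \<partial>completion M) + (\<integral>\<omega>. r t \<omega> \<partial>M)" for t
  proof -
    have r_int: "integrable (completion M) (r t)"
      by (rule C.integrable_const_bound[of _ 2]) (auto intro!: AE_I2 measurable_completion[OF r_meas] simp: r_def)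
    have \<Phi>_int: "integrable (completion M) (\<lambda>\<omega>. norm (\<Phi> t \<omega> - cS))"
    proof (rule C.integrable_const_bound[of _ 2])
      show "AE \<omega> in completion M. norm (norm (\<Phi> t \<omega> - cS)) \<le> 2"
      proof (intro AE_I2)
        fix \<omega> assume "\<omega> \<in> space (completion M)"
        then show "norm (norm (\<Phi> t \<omega> - cS)) \<le> 2"
          using norm_triangle_ineq4[of "\<Phi> t \<omega>" cS] \<Phi>_le[of \<omega> t] cS_le by simp
      qed
    qed auto
    have E\<Phi>_int: "integrable (completion M) (\<lambda>\<omega>. E t \<omega> * \<Phi> t \<omega>)"
      by (rule C.integrable_const_bound[of _ 1]) (auto intro!: AE_I2 simp: norm_mult EA_le \<Phi>_le)
    have A_int: "integrable (completion M) (A t)"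
      by (rule C.integrable_const_bound[of _ 1]) (auto intro!: AE_I2 simp: EA_le)
    have "(\<integral>\<omega>. E t \<omega> * \<Phi> t \<omega> \<partial>completion M) - (\<integral>\<omega>. A t \<omega> \<partial>M) * cS =
        (\<integral>\<omega>. E t \<omega> * \<Phi> t \<omega> - A t \<omega> * cS \<partial>completion M)"
      using E\<Phi>_int A_int by (simp add: integral_completion[OF A_meas0])
    also have "norm \<dots> \<le> (\<integral>\<omega>. norm (E t \<omega> * \<Phi> t \<omega> - A t \<omega> * cS) \<partial>completion M)"
      by (rule integral_norm_bound)
    also have "\<dots> \<le> (\<integral>\<omega>. norm (\<Phi> t \<omega> - cS) + r t \<omega> \<partial>completion M)"
    proof (rule integral_mono)
      show "integrable (completion M) (\<lambda>\<omega>. norm (E t \<omega> * \<Phi> t \<omega> - A t \<omega> * cS))" using E\<Phi>_int A_int by auto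
      fix \<omega>
      have "E t \<omega> * \<Phi> t \<omega> - A t \<omega> * cS = E t \<omega> * (\<Phi> t \<omega> - cS) + (E t \<omega> - A t \<omega>) * cS" by (simp add: algebra_simps)
      also have "norm \<dots> \<le> norm (E t \<omega> * (\<Phi> t \<omega> - cS)) + norm ((E t \<omega> - A t \<omega>) * cS)" by (rule norm_triangle_ineq)
      also have "norm ((E t \<omega> - A t \<omega>) * cS) \<le> r t \<omega> * 1"
        unfolding norm_mult by (intro mult_mono EA cS_le) (auto simp: r_def)
      finally show "norm (E t \<omega> * \<Phi> t \<omega> - A t \<omega> * cS) \<le> norm (\<Phi> t \<omega> - cS) + r t \<omega>"
        by (simp add: norm_mult EA_le)
    qed (use \<Phi>_int r_int in auto)
    also have "\<dots> = (\<integral>\<omega>. norm (\<Phi> t \<omega> - cS) \<partial>completion M) + (\<integral>\<omega>. r t \<omega> \<partial>M)"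
      using \<Phi>_int r_int by (simp add: integral_completion[OF r_meas])
    finally show ?thesis .
  qed
  have "(\<lambda>t. (\<integral>\<omega>. E t \<omega> * \<Phi> t \<omega> \<partial>completion M) - (\<integral>\<omega>. A t \<omega> \<partial>M) * cS) \<longlonglongrightarrow> 0"
    by (rule Lim_null_comparison[OF always_eventually[OF allI[OF bound]]]) (use tendsto_add[OF lim1 lim2] in simp)
  moreover have "(\<lambda>t. (\<integral>\<omega>. A t \<omega> \<partial>M) * cS) \<longlonglongrightarrow> of_real (exp (- sI / 2)) * cS"
    unfolding A_def sI_def
    by (intro tendsto_mult tendsto_const input_char_tendsto[OF m_pos m_bdd m_lim mbar n_lim nbar \<eta>])
  ultimately have "(\<lambda>t. \<integral>\<omega>. E t \<omega> * \<Phi> t \<omega> \<partial>completion M) \<longlonglongrightarrow> of_real (exp (- sI / 2)) * cS"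
    using tendsto_add by fastforce
  also have "of_real (exp (- sI / 2)) * cS = of_real (exp (- (sI + sS) / 2))"
    by (simp add: cS_def exp_add[symmetric] add_divide_distrib flip: of_real_mult)
  finally show ?thesis
    unfolding output_char_factorization(2)[OF mean_cont refl] E_def \<Phi>_def sI_def sS_def .
qed

end

section \<open>Asymptotic normality of the estimated differences\<close>

lemma matrix_bilinear_sum:
  fixes C :: "real^'n^'n" and u :: "real^'j" and w :: "'j \<Rightarrow> real^'n"
  shows "(\<Sum>a\<in>UNIV. u $ a *\<^sub>R w a) \<bullet> (C *v (\<Sum>a\<in>UNIV. u $ a *\<^sub>R w a)) =
    (\<Sum>a\<in>UNIV. \<Sum>a'\<in>UNIV. u $ a * u $ a' * (w a \<bullet> (C *v w a')))"
proof -
  have "C *v (\<Sum>a\<in>UNIV. u $ a *\<^sub>R w a) = (\<Sum>a\<in>UNIV. u $ a *\<^sub>R (C *v w a))"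
    by (simp add: linear_sum[OF matrix_vector_mul_linear] linear_cmul[OF matrix_vector_mul_linear])
  then show ?thesis by (simp only: inner_sum_left) (simp add: inner_sum_right sum_distrib_left mult_ac)
qed

theorem theorem3:
  fixes M :: "'w measure"
    and \<Theta> :: "(real^'d) set" and \<theta>c :: "real^'d"
    and b :: "'d \<Rightarrow> 's::finite"
    and D :: "'s \<Rightarrow> nat \<Rightarrow> 'w \<Rightarrow> 'd \<Rightarrow> real"
    and n :: "'s \<Rightarrow> nat \<Rightarrow> nat" and nbar :: "'s \<Rightarrow> real"
    and m :: "nat \<Rightarrow> nat" and mbar :: real
    and Q :: "real^'d \<Rightarrow> 'z measure" and X :: "real^'d \<Rightarrow> 'z \<Rightarrow> real^'k"
    and Y :: "nat \<Rightarrow> nat \<Rightarrow> 'w \<Rightarrow> real^'k"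
    and \<eta> :: real and i :: 'k and e :: "'j::finite \<Rightarrow> 'k"
  assumes K: "CARD('k) \<ge> 2"
    and M: "prob_space M"
    and true_param: "\<theta>c \<in> \<Theta>"
    and Q: "\<And>\<theta>. \<theta> \<in> \<Theta> \<Longrightarrow> prob_space (Q \<theta>)"
    and X: "\<And>\<theta>. \<theta> \<in> \<Theta> \<Longrightarrow> X \<theta> \<in> borel_measurable (Q \<theta>)"
    \<comment> \<open>The parametric family is continuous at the true parameter, as far as the outputs are concerned.
      Continuity of means and covariances alone does not give the Lindeberg condition.\<close>
    and X_law_continuous:
      "converges_in_law (output_law Q X) (output_law Q X \<theta>c) (at \<theta>c within \<Theta>)"
    and D_indep: "prob_space.indep_vars M (\<lambda>(s, j). block_space b s) (\<lambda>(s, j). D s j) (UNIV \<times> {1..})"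
    and D_ident: "\<And>s j. j \<ge> 1 \<Longrightarrow> distr M (block_space b s) (D s j) = distr M (block_space b s) (D s 1)"
    and D_mean: "\<And>s k. k \<in> block b s \<Longrightarrow>
      integrable M (\<lambda>\<omega>. D s 1 \<omega> k) \<and> (\<integral>\<omega>. D s 1 \<omega> k \<partial>M) = \<theta>c $ k"
    and n_pos: "\<And>s t. t \<ge> 1 \<Longrightarrow> n s t \<ge> 1"
    and m_pos: "\<And>t. t \<ge> 1 \<Longrightarrow> m t \<ge> 1"
    and theta_hat_in: "\<And>t \<omega>. t \<ge> 1 \<Longrightarrow> \<omega> \<in> space M \<Longrightarrow> theta_hat b n D t \<omega> \<in> \<Theta>"
    and Y: "\<And>l r. l \<ge> 1 \<Longrightarrow> r \<in> {1..m l} \<Longrightarrow> Y l r \<in> borel_measurable M"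
    and Y_cond: "\<And>J A. finite J \<Longrightarrow> J \<subseteq> {(l, r). l \<ge> 1 \<and> r \<in> {1..m l}} \<Longrightarrow>
      (\<And>l r. (l, r) \<in> J \<Longrightarrow> A l r \<in> sets borel) \<Longrightarrow>
      AE \<omega> in M.
        real_cond_exp M (theta_hat_algebra M b n D)
          (indicator {\<omega>' \<in> space M. \<forall>(l, r)\<in>J. Y l r \<omega>' \<in> A l r}) \<omega>
        = (\<Prod>(l, r)\<in>J. measure (output_law Q X (theta_hat b n D l \<omega>)) (A l r))"
    and B1: "\<And>s k k'. k \<in> block b s \<Longrightarrow> k' \<in> block b s \<Longrightarrow>
      covariance_exists M (\<lambda>\<omega>. D s 1 \<omega> k) (\<lambda>\<omega>. D s 1 \<omega> k')"
    and B2_exists: "\<And>\<theta> i j. \<theta> \<in> \<Theta> \<Longrightarrow>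
      covariance_exists (Q \<theta>) (\<lambda>z. X \<theta> z $ i) (\<lambda>z. X \<theta> z $ j)"
    and B2_continuous: "continuous_on \<Theta> (output_cov Q X)"
    and B3: "\<And>i. twice_continuously_differentiable_on \<Theta> (output_mean Q X i)"
    and B4_n_bounded: "\<And>s. \<exists>B. \<forall>t\<ge>1. n s t \<le> B"
    and B4_m_bounded: "\<exists>B. \<forall>t\<ge>1. m t \<le> B"
    and B4_nbar: "\<And>s. nbar s > 0" "\<And>s. (\<lambda>t. real (total (n s) t) / real t) \<longlonglongrightarrow> nbar s"
    and B4_mbar: "mbar > 0" "(\<lambda>t. real (total m t) / real t) \<longlonglongrightarrow> mbar"
    and eta: "0 \<le> \<eta>" "\<eta> < 1"
    \<comment> \<open>\<open>e\<close> enumerates the designs other than \<open>i\<close>, so that \<open>real^'j\<close> is the (K - 1)-dimensional space\<close>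
    and e: "bij_betw e UNIV (UNIV - {i})"
  shows "\<exists>\<nu>. is_multivariate_normal 0
      (\<chi> a a'.
          lambda_I \<eta> * (gradient_within \<Theta> (output_diff Q X i (e a)) \<theta>c \<bullet>
             (Sigma_D_bar M b nbar D *v gradient_within \<Theta> (output_diff Q X i (e a')) \<theta>c))
        + lambda_S \<eta> * inverse mbar *
             covariance (Q \<theta>c) (\<lambda>z. X \<theta>c z $ i - X \<theta>c z $ e a) (\<lambda>z. X \<theta>c z $ i - X \<theta>c z $ e a')) \<nu> \<and>
      converges_in_law
        (\<lambda>t. distr M borel (\<lambda>\<omega>. sqrt (real t) *\<^sub>R
           (\<chi> a. delta_hat \<eta> m Y i (e a) t \<omega> - output_diff Q X i (e a) \<theta>c)))
        \<nu> sequentially"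
proof -
  interpret S: simulation M b D n \<theta>c \<Theta> Q X m Y
    by (intro simulation.intro input_data.intro input_data_axioms.intro simulation_axioms.intro)
      (fact M D_indep D_ident D_mean B1 n_pos true_param theta_hat_in Q X X_law_continuous B2_exists
        B2_continuous m_pos Y Y_cond)+
  from B4_m_bounded obtain B where B: "\<And>t. t \<ge> 1 \<Longrightarrow> m t \<le> B" by blast
  define G where "G a = gradient_within \<Theta> (output_diff Q X i (e a)) \<theta>c" for a
  \<comment> \<open>\<open>w a\<close> picks the difference between design \<open>i\<close> and design \<open>e a\<close>; \<open>V u\<close> and \<open>g u\<close> below are the
    combinations with coefficients \<open>u\<close> of these vectors and of the gradients.\<close>
  define w where "w a = axis i 1 - axis (e a) (1::real)" for a
  define C :: "real^'j^'j" where "C = (\<chi> a a'. lambda_I \<eta> * (G a \<bullet> (Sigma_D_bar M b nbar D *v G a'))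
      + lambda_S \<eta> * inverse mbar *
        covariance (Q \<theta>c) (\<lambda>z. X \<theta>c z $ i - X \<theta>c z $ e a) (\<lambda>z. X \<theta>c z $ i - X \<theta>c z $ e a'))"
  define V :: "real^'j \<Rightarrow> real^'k" where "V u = (\<Sum>a\<in>UNIV. u $ a *\<^sub>R w a)" for u
  define g :: "real^'j \<Rightarrow> real^'d" where "g u = (\<Sum>a\<in>UNIV. u $ a *\<^sub>R G a)" for u
  have w_inner: "w a \<bullet> y = y $ i - y $ e a" for a y
    by (simp add: w_def inner_diff_left inner_axis')
  have V_inner: "V u \<bullet> y = (\<Sum>a\<in>UNIV. u $ a * (y $ i - y $ e a))" for u y
    by (simp add: V_def inner_sum_left w_inner)
  have mean_V: "S.form_mean (V u) \<theta> = (\<Sum>a\<in>UNIV. u $ a * output_diff Q X i (e a) \<theta>)" if "\<theta> \<in> \<Theta>" for u \<theta>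
  proof -
    have "S.form_mean (V u) \<theta> = V u \<bullet> (\<chi> i. output_mean Q X i \<theta>)"
      by (simp add: S.output_moments(2)[OF that] inner_vec_def)
    then show ?thesis by (simp add: V_inner output_diff_def)
  qed
  have diff_deriv: "\<exists>g. (output_diff Q X i k has_derivative (\<lambda>h. g \<bullet> h)) (at \<theta> within \<Theta>)" if "\<theta> \<in> \<Theta>" for k \<theta>
  proof -
    have "\<exists>g. (output_mean Q X k has_derivative (\<lambda>h. g \<bullet> h)) (at \<theta> within \<Theta>)" for k
      using B3[of k] that unfolding twice_continuously_differentiable_on_def by blast
    then obtain g1 g2 where "(output_mean Q X i has_derivative (\<lambda>h. g1 \<bullet> h)) (at \<theta> within \<Theta>)"
      "(output_mean Q X k has_derivative (\<lambda>h. g2 \<bullet> h)) (at \<theta> within \<Theta>)" by blast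
    from has_derivative_diff[OF this]
    have "(output_diff Q X i k has_derivative (\<lambda>h. (g1 - g2) \<bullet> h)) (at \<theta> within \<Theta>)"
      by (simp add: output_diff_def[abs_def] inner_diff_left)
    then show ?thesis by blast
  qed
  have G_deriv: "(output_diff Q X i (e a) has_derivative (\<lambda>h. G a \<bullet> h)) (at \<theta>c within \<Theta>)" for a
    unfolding G_def gradient_within_def by (rule someI_ex[OF diff_deriv[OF true_param]])
  have mean_deriv: "(S.form_mean (V u) has_derivative (\<lambda>h. g u \<bullet> h)) (at \<theta>c within \<Theta>)" for u
  proof -
    have "((\<lambda>\<theta>. \<Sum>a\<in>UNIV. u $ a * output_diff Q X i (e a) \<theta>) has_derivative (\<lambda>h. \<Sum>a\<in>UNIV. u $ a * (G a \<bullet> h))) (at \<theta>c within \<Theta>)"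
      by (intro has_derivative_sum has_derivative_mult_right G_deriv)
    then have "((\<lambda>\<theta>. \<Sum>a\<in>UNIV. u $ a * output_diff Q X i (e a) \<theta>) has_derivative (\<lambda>h. g u \<bullet> h)) (at \<theta>c within \<Theta>)"
      by (simp add: g_def inner_sum_left)
    then show ?thesis
      by (rule has_derivative_transform[OF true_param, rotated]) (simp add: mean_V)
  qed
  have mean_cont: "continuous_on \<Theta> (S.form_mean (V u))" for u
  proof -
    have "continuous_on \<Theta> (output_diff Q X i (e a))" for a
      using diff_deriv has_derivative_continuous by (fastforce simp: continuous_on_eq_continuous_within)
    then have "continuous_on \<Theta> (\<lambda>\<theta>. \<Sum>a\<in>UNIV. u $ a * output_diff Q X i (e a) \<theta>)"
      by (intro continuous_intros)
    then show ?thesis by (subst continuous_on_cong[OF refl mean_V])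
  qed
  have w_cov: "w a \<bullet> (output_cov Q X \<theta>c *v w a') =
      covariance (Q \<theta>c) (\<lambda>z. X \<theta>c z $ i - X \<theta>c z $ e a) (\<lambda>z. X \<theta>c z $ i - X \<theta>c z $ e a')" for a a'
  proof -
    interpret Q: prob_space "Q \<theta>c" by (rule Q[OF true_param])
    let ?Z = "\<lambda>k z. X \<theta>c z $ k - output_mean Q X k \<theta>c"
    have int: "integrable (Q \<theta>c) (\<lambda>z. X \<theta>c z $ k)" for k
      using B2_exists[OF true_param, of k k] by (simp add: covariance_exists_def)
    have int2: "integrable (Q \<theta>c) (\<lambda>z. ?Z k z * ?Z k' z)" for k k'
      using B2_exists[OF true_param, of k k'] by (simp add: covariance_exists_def output_mean_def)
    have cov: "output_cov Q X \<theta>c $ k $ k' = (\<integral>z. ?Z k z * ?Z k' z \<partial>Q \<theta>c)" for k k'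
      by (simp add: output_cov_def covariance_def output_mean_def)
    have "covariance (Q \<theta>c) (\<lambda>z. X \<theta>c z $ i - X \<theta>c z $ e a) (\<lambda>z. X \<theta>c z $ i - X \<theta>c z $ e a') =
        (\<integral>z. ?Z i z * ?Z i z - ?Z i z * ?Z (e a') z - ?Z (e a) z * ?Z i z + ?Z (e a) z * ?Z (e a') z \<partial>Q \<theta>c)"
      unfolding covariance_def using int
      by (intro Bochner_Integration.integral_cong refl) (simp add: output_mean_def algebra_simps)
    also have "\<dots> = output_cov Q X \<theta>c $ i $ i - output_cov Q X \<theta>c $ i $ e a' - output_cov Q X \<theta>c $ e a $ i + output_cov Q X \<theta>c $ e a $ e a'"
      unfolding cov using int2 by simp
    also have "\<dots> = w a \<bullet> (output_cov Q X \<theta>c *v w a')"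
      by (simp add: w_inner) (simp add: w_def matrix_vector_mult_diff_distrib matrix_vector_mult_basis column_def)
    finally show ?thesis by simp
  qed
  have quad: "u \<bullet> (C *v u) = lambda_I \<eta> * (g u \<bullet> (Sigma_D_bar M b nbar D *v g u))
      + lambda_S \<eta> / mbar * (V u \<bullet> (output_cov Q X \<theta>c *v V u))" for u
    unfolding g_def V_def matrix_bilinear_sum unfolding matrix_quadratic_form w_cov
    by (simp add: C_def sum_distrib_left sum.distrib[symmetric] divide_inverse algebra_simps)
  have cov_sym: "covariance P U W = covariance P W U" for P :: "'x measure" and U W
    by (simp add: covariance_def mult.commute)
  have SD_sym: "x \<bullet> (Sigma_D_bar M b nbar D *v y) = y \<bullet> (Sigma_D_bar M b nbar D *v x)" for x y
  proof -
    have "transpose (Sigma_D_bar M b nbar D) = Sigma_D_bar M b nbar D"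
      by (auto simp: transpose_def Sigma_D_bar_def vec_eq_iff covariance_def mult.commute)
    then show ?thesis by (metis dot_lmul_matrix inner_commute transpose_matrix_vector)
  qed
  have C_sym: "transpose C = C"
    by (auto simp: transpose_def C_def vec_eq_iff SD_sym covariance_def mult.commute)
  have C_psd: "0 \<le> u \<bullet> (C *v u)" for u
  proof -
    have "0 \<le> S.dev_var (g u) s" for s
      unfolding S.dev_moments_1(4)[symmetric] by simp
    then have "0 \<le> g u \<bullet> (Sigma_D_bar M b nbar D *v g u)"
      unfolding S.sum_dev_var[symmetric] using B4_nbar(1) by (intro sum_nonneg divide_nonneg_pos)
    moreover have "0 \<le> V u \<bullet> (output_cov Q X \<theta>c *v V u)"
      unfolding S.output_moments(4)[OF true_param, symmetric] by simp
    ultimately show ?thesis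
      unfolding quad using lambda_I_nonneg[OF eta] eta B4_mbar(1)
      by (intro add_nonneg_nonneg mult_nonneg_nonneg) (auto simp: lambda_S_def)
  qed
  obtain \<nu> where \<nu>: "is_multivariate_normal 0 C \<nu>"
    and \<nu>_char: "\<And>u. (\<integral>x. cis (u \<bullet> x) \<partial>\<nu>) = of_real (exp (- (u \<bullet> (C *v u)) / 2))"
    using multivariate_normal_exists[OF C_sym C_psd] by blast
  define \<Delta> :: "nat \<Rightarrow> 'w \<Rightarrow> real^'j" where
    "\<Delta> t \<omega> = sqrt (real t) *\<^sub>R (\<chi> a. delta_hat \<eta> m Y i (e a) t \<omega> - output_diff Q X i (e a) \<theta>c)" for t \<omega>
  have \<Delta>_meas: "\<Delta> t \<in> borel_measurable M" for t
  proof -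
    have "(\<lambda>\<omega>. mu_hat \<eta> m Y k t \<omega>) \<in> borel_measurable M" for k
      unfolding mu_hat_def Let_def
    proof (intro borel_measurable_divide borel_measurable_sum borel_measurable_const)
      fix l r assume "l \<in> {nat \<lfloor>\<eta> * real t\<rfloor> + 1..t}" "r \<in> {1..m l}"
      then have "Y l r \<in> borel_measurable M" by (intro Y) auto
      then have "(\<lambda>\<omega>. axis k 1 \<bullet> Y l r \<omega>) \<in> borel_measurable M" by measurable
      then show "(\<lambda>\<omega>. Y l r \<omega> $ k) \<in> borel_measurable M" by (simp add: inner_axis')
    qed
    then show ?thesis
      by (subst borel_measurable_euclidean_space)
        (auto simp: \<Delta>_def delta_hat_def Basis_vec_def inner_axis)
  qed
  have \<Delta>_inner: "\<forall>\<^sub>F t in sequentially. \<forall>\<omega>. u \<bullet> \<Delta> t \<omega> = window_scale m \<eta> t *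
      (\<Sum>q\<in>(SIGMA l:{dropped \<eta> t + 1..t}. {1..m l}). V u \<bullet> Y (fst q) (snd q) \<omega> - S.form_mean (V u) \<theta>c)" for u
  proof -
    \<comment> \<open>Eventually some stage is retained, so the estimators do not divide by 0.\<close>
    have "mbar * (1 - \<eta>) > 0" using B4_mbar(1) eta by simp
    from order_tendstoD(1)[OF window_average_tendsto(2)[OF B4_mbar(2) eta(1)] this]
    show ?thesis using eventually_gt_at_top[of 0]
    proof eventually_elim
      case (elim t)
      let ?J = "SIGMA l:{dropped \<eta> t + 1..t}. {1..m l}"
      define W where "W = real (total m t) - real (total m (dropped \<eta> t))"
      have W: "W > 0" using elim by (simp add: W_def zero_less_divide_iff)
      have card: "real (card ?J) = W"
        using total_window[OF dropped_le[OF eta], of m t] by (simp add: W_def)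
      show ?case
      proof
        fix \<omega>
        have mu: "mu_hat \<eta> m Y k t \<omega> = (\<Sum>q\<in>?J. Y (fst q) (snd q) \<omega> $ k) / W" for k
          unfolding mu_hat_def Let_def dropped_def[symmetric] W_def
          by (subst sum.Sigma) (auto simp: case_prod_unfold)
        have "(\<Sum>q\<in>?J. V u \<bullet> Y (fst q) (snd q) \<omega>) = (\<Sum>a\<in>UNIV. u $ a * (\<Sum>q\<in>?J. Y (fst q) (snd q) \<omega> $ i - Y (fst q) (snd q) \<omega> $ e a))"
          unfolding V_inner sum_distrib_left by (rule sum.swap)
        also have "\<dots> = (\<Sum>a\<in>UNIV. u $ a * (W * delta_hat \<eta> m Y i (e a) t \<omega>))"
          unfolding delta_hat_def mu using W by (simp add: sum_subtractf right_diff_distrib)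
        finally have 1: "(\<Sum>q\<in>?J. V u \<bullet> Y (fst q) (snd q) \<omega>) = W * (\<Sum>a\<in>UNIV. u $ a * delta_hat \<eta> m Y i (e a) t \<omega>)"
          by (simp add: sum_distrib_left mult_ac)
        have "(\<Sum>q\<in>?J. V u \<bullet> Y (fst q) (snd q) \<omega> - S.form_mean (V u) \<theta>c) =
            W * (\<Sum>a\<in>UNIV. u $ a * delta_hat \<eta> m Y i (e a) t \<omega>) - W * S.form_mean (V u) \<theta>c"
          by (simp only: sum_subtractf 1 sum_constant card)
        also have "\<dots> = W * (\<Sum>a\<in>UNIV. u $ a * (delta_hat \<eta> m Y i (e a) t \<omega> - output_diff Q X i (e a) \<theta>c))"
          unfolding mean_V[OF true_param] by (simp only: right_diff_distrib sum_subtractf)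
        finally have 2: "(\<Sum>q\<in>?J. V u \<bullet> Y (fst q) (snd q) \<omega> - S.form_mean (V u) \<theta>c) =
            W * (\<Sum>a\<in>UNIV. u $ a * (delta_hat \<eta> m Y i (e a) t \<omega> - output_diff Q X i (e a) \<theta>c))" .
        have "u \<bullet> \<Delta> t \<omega> = sqrt (real t) * (\<Sum>a\<in>UNIV. u $ a * (delta_hat \<eta> m Y i (e a) t \<omega> - output_diff Q X i (e a) \<theta>c))"
          by (simp only: \<Delta>_def inner_scaleR_right inner_vec_def[of u] inner_real_def vec_lambda_beta)
        then show "u \<bullet> \<Delta> t \<omega> = window_scale m \<eta> t * (\<Sum>q\<in>?J. V u \<bullet> Y (fst q) (snd q) \<omega> - S.form_mean (V u) \<theta>c)"
          unfolding 2 window_scale_def W_def[symmetric] using W by simp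
      qed
    qed
  qed
  have "converges_in_law (\<lambda>t. distr M borel (\<Delta> t)) \<nu> sequentially"
  proof (rule levy_continuity_euclidean)
    show "prob_space (distr M borel (\<Delta> t))" for t by (rule S.prob_space_distr[OF \<Delta>_meas])
    show "prob_space \<nu>" "sets \<nu> = sets borel" using \<nu> by (auto simp: is_multivariate_normal_def)
    fix u :: "real^'j"
    have eq: "(\<integral>x. cis (u \<bullet> x) \<partial>distr M borel (\<Delta> t)) = (\<integral>\<omega>. cis (u \<bullet> \<Delta> t \<omega>) \<partial>M)" for t
      by (rule integral_distr[OF \<Delta>_meas]) (rule cis_inner_measurable)
    have "(\<lambda>t. \<integral>\<omega>. cis (window_scale m \<eta> t *
        (\<Sum>q\<in>(SIGMA l:{dropped \<eta> t + 1..t}. {1..m l}). V u \<bullet> Y (fst q) (snd q) \<omega> - S.form_mean (V u) \<theta>c)) \<partial>M)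
      \<longlonglongrightarrow> of_real (exp (- (u \<bullet> (C *v u)) / 2))"
      unfolding quad
      by (rule S.scalar_char_tendsto[OF mean_cont mean_deriv B B4_mbar(2,1) B4_nbar(2,1) eta])
    then show "(\<lambda>t. \<integral>x. cis (u \<bullet> x) \<partial>distr M borel (\<Delta> t)) \<longlonglongrightarrow> (\<integral>x. cis (u \<bullet> x) \<partial>\<nu>)"
      unfolding eq \<nu>_char
      by (rule Lim_transform_eventually) (use \<Delta>_inner[of u] in eventually_elim, simp)
  qed simp
  with \<nu> show ?thesis unfolding C_def G_def \<Delta>_def[abs_def] by blast
qed

end
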